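(* Let $n\ge 1$, let $F:\mathbb{B}_n\to\mathbb{D}$ be holomorphic, and let $z_1,z_2,z_3\in\mathbb{B}_n$ be pairwise different. Put $\lambda_j:=F(z_j)$, $j=1,2,3$. Then the $3$-point Pick problem $$\mathbb{B}_n\to\mathbb{D},\quad z_j\mapsto\lambda_j,\quad j=1,2,3,$$ is extremal if and only if there is a holomorphic map $f:\mathbb{D}\to\mathbb{B}_n$ such that at least one of the following holds: (i) $f$ passes through the points $z_1,z_2,z_3$ (i.e. $z_1,z_2,z_3\in f(\mathbb{D})$) and $F\circ f$ is a non-constant Blaschke product of degree at most $2$; or (ii) $f$ passes through at least two of the points $z_1,z_2,z_3$ and $F\circ f$ is a Blaschke product of degree $1$.
   Context: $\mathbb{D}$ is the open unit disc in $\mathbb{C}$ and $\mathbb{B}_n$ is the open Euclidean unit ball in $\mathbb{C}^n$. Blaschke products are finite Blaschke products (a unimodular constant factor is allowed). For pairwise distinct points $z_1,\dots,z_N$ in a domain $D$ and $\lambda_1,\dots,\lambda_N\in\mathbb{D}$, the $N$-point Pick problem $D\to\mathbb{D}$, $z_j\mapsto\lambda_j$, asks for a holomorphic $F:D\to\mathbb{D}$ with $F(z_j)=\lambda_j$ for all $j$. A solvable problem is called extremal if there is no holomorphic $G:D\to\mathbb{D}$ with $G(z_j)=\lambda_j$, $j=1,\dots,N$, whose image $G(D)$ is relatively compact in $\mathbb{D}$. *)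

theory Defs
  imports "HOL-Complex_Analysis.Complex_Analysis"
begin

abbreviation unit_disc :: "complex set" where
  "unit_disc \<equiv> ball 0 1"

(* The norm of complex^'n is the Euclidean one, so this is the Euclidean ball of
   C^n with n = CARD('n). *)
abbreviation unit_ball :: "(complex ^ 'n) set" where
  "unit_ball \<equiv> ball 0 1"

(* Holomorphy in several variables as complex Frechet differentiability:
   has_derivative is only real-linear, so complex linearity is required separately. *)
definition holomorphic_fun_on :: "(complex ^ 'n \<Rightarrow> complex) \<Rightarrow> (complex ^ 'n) set \<Rightarrow> bool"
    (infixl "holomorphic'_fun'_on" 50) where
  "F holomorphic_fun_on D \<longleftrightarrow>
     (\<forall>z\<in>D. \<exists>F'. Vector_Spaces.linear (*s) (*) F' \<and> (F has_derivative F') (at z within D))"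

definition holomorphic_curve_on :: "(complex \<Rightarrow> complex ^ 'n) \<Rightarrow> complex set \<Rightarrow> bool"
    (infixl "holomorphic'_curve'_on" 50) where
  "f holomorphic_curve_on D \<longleftrightarrow> (\<forall>i. (\<lambda>t. f t $ i) holomorphic_on D)"

definition relatively_compact_in :: "'a::topological_space set \<Rightarrow> 'a set \<Rightarrow> bool" where
  "relatively_compact_in S T \<longleftrightarrow> compact (closure S) \<and> closure S \<subseteq> T"

definition pick_solution ::
    "(complex ^ 'n) set \<Rightarrow> nat \<Rightarrow> (nat \<Rightarrow> complex ^ 'n) \<Rightarrow> (nat \<Rightarrow> complex)
      \<Rightarrow> (complex ^ 'n \<Rightarrow> complex) \<Rightarrow> bool" where
  "pick_solution D N z w F \<longleftrightarrow>
     F holomorphic_fun_on D \<and> F ` D \<subseteq> unit_disc \<and> (\<forall>j\<in>{1..N}. F (z j) = w j)"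

definition pick_extremal ::
    "(complex ^ 'n) set \<Rightarrow> nat \<Rightarrow> (nat \<Rightarrow> complex ^ 'n) \<Rightarrow> (nat \<Rightarrow> complex) \<Rightarrow> bool" where
  "pick_extremal D N z w \<longleftrightarrow>
     (\<exists>F. pick_solution D N z w F) \<and>
     \<not> (\<exists>G. pick_solution D N z w G \<and> relatively_compact_in (G ` D) unit_disc)"

(* Only the values on the unit disc matter; degree 0 means a unimodular constant. *)
definition blaschke_product :: "nat \<Rightarrow> (complex \<Rightarrow> complex) \<Rightarrow> bool" where
  "blaschke_product d B \<longleftrightarrow>
     (\<exists>c a. norm c = 1 \<and> (\<forall>k<d. a k \<in> unit_disc) \<and>
        (\<forall>t\<in>unit_disc. B t = c * (\<Prod>k<d. (t - a k) / (1 - cnj (a k) * t))))"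

end

theory Submission
  imports Defs
begin

text \<open>
  Fix the points \<open>z\<^sub>1, z\<^sub>2, z\<^sub>3\<close>. The set \<open>P\<close> of values \<open>(F z\<^sub>1, F z\<^sub>2, F z\<^sub>3)\<close> of functions bounded by 1 on the
  ball is contained in the set \<open>Q\<close> of those triples which are interpolated along every analytic disc,
  and extremal problems correspond to boundary points of \<open>P\<close>. The theorem amounts to \<open>P = Q\<close> up to closure.

  After moving \<open>z\<^sub>1\<close> and its value to \<open>0\<close>, dividing by the variable of the disc turns both the existence of a
  disc through \<open>0, z, w\<close> at the parameters \<open>0, s, t\<close> and the solvability of the corresponding problem in the
  disc into one inequality each (\<open>E(s,t) \<ge> 0\<close> and \<open>H(s,t) \<ge> 0\<close>). At a boundary point of \<open>Q\<close> at
  which no two of the points form an extremal two-point problem, there are \<open>s, t\<close> with \<open>E = 0 = H\<close>, and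
  \<open>H \<ge> 0\<close> wherever \<open>E \<ge> 0\<close>. Hence the gradients of \<open>E\<close> and \<open>H\<close> are proportional, which
  determines the Blaschke product in terms of the disc. Up to automorphisms the disc is
  \<open>\<xi> \<mapsto> (p \<xi>, q \<xi>\<^sup>2)\<close> with \<open>p\<^sup>2 + q\<^sup>2 = 1\<close>, the Blaschke product is \<open>\<xi>\<^sup>2\<close>, and
  \<open>(x\<^sub>1\<^sup>2 + 2 q x\<^sub>2) / (1 + q\<^sup>2)\<close> interpolates on the ball. The remaining boundary points are reached by
  approximating the extreme points of \<open>Q\<close>.
\<close>

section \<open>Complex inner product, holomorphy in several variables, automorphisms of the ball\<close>

text \<open>The passage to a touching disc fails at data for which some pair is extremal: the nodes
  of the discs may run to the circle and leave no limiting disc. Strictness of all three pair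
  inequalities keeps the nodes inside. This is why extreme points of Q are approximated instead of
  treated directly. Off a common geodesic, two extremal pairs cannot occur together, so some
  coordinate has only strict pairs. Perturbing it must leave Q in one of two opposite directions,
  and shrinking radially to the boundary of Q makes the remaining pair strict as well; convexity
  then gives all of Q. On a common geodesic a holomorphic left inverse yields P = Q at once.

  Comparing closures is enough: extremality of q enters as the statement that (1 + \<epsilon>) q
  lies outside Q for every \<epsilon> > 0, and this gap absorbs the approximation error.

  The function on the ball comes from the arithmetic-geometric mean inequality |x1|^2 + 2 q |x2|
  \<le> |x1|^2 + |x2|^2 + q^2 \<le> 1 + q^2, with equality on the boundary of the disc.\<close>

abbreviation nsq :: "'a::real_normed_vector \<Rightarrow> real" where
  "nsq x \<equiv> (norm x)\<^sup>2"

definition cinner :: "complex ^ 'n \<Rightarrow> complex ^ 'n \<Rightarrow> complex" where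
  "cinner x y = (\<Sum>i\<in>UNIV. x $ i * cnj (y $ i))"

lemma cinner_simps [simp]:
  "cinner (x + y) w = cinner x w + cinner y w"
  "cinner (x - y) w = cinner x w - cinner y w"
  "cinner (- x) w = - cinner x w"
  "cinner (c *s x) w = c * cinner x w"
  "cinner w (x + y) = cinner w x + cinner w y"
  "cinner w (x - y) = cinner w x - cinner w y"
  "cinner w (- x) = - cinner w x"
  "cinner w (c *s x) = cnj c * cinner w x"
  "cinner 0 w = 0" "cinner w 0 = 0"
  by (simp_all add: cinner_def algebra_simps sum.distrib sum_subtractf sum_distrib_left sum_negf)

lemma cnj_cinner: "cnj (cinner x y) = cinner y x"
  by (simp add: cinner_def mult.commute)

lemma cinner_self: "cinner x x = of_real (nsq x)"
  by (simp add: cinner_def norm_vec_def L2_set_def sum_nonneg complex_norm_square[symmetric])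

lemma norm_scale_complex: "norm (c *s x) = norm c * norm (x :: complex ^ 'n)"
  by (simp add: norm_vec_def norm_mult L2_set_right_distrib)

lemma Re_cinner: "Re (cinner x y) = inner x y"
  by (simp add: cinner_def inner_vec_def inner_complex_def)

lemma norm_cinner_le: "norm (cinner x y) \<le> norm x * norm y"
proof (cases "cinner x y = 0")
  case False
  \<comment> \<open>Rotating \<open>x\<close> by this unimodular factor makes the product real and
    nonnegative, so that the real Cauchy-Schwarz inequality applies.\<close>
  define c where "c = cnj (cinner x y) / norm (cinner x y)"
  have c: "norm c = 1" using False by (simp add: c_def norm_divide)
  have "cinner (c *s x) y = of_real (norm (cinner x y))"
    using False by (simp add: c_def complex_norm_square[symmetric] power2_eq_square mult.commute)
  then have "norm (cinner x y) = inner (c *s x) y"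
    by (metis Re_cinner Re_complex_of_real)
  also have "\<dots> \<le> norm (c *s x) * norm y" by (rule norm_cauchy_schwarz)
  finally show ?thesis using c by (simp add: norm_scale_complex)
qed simp

lemma norm_eq_cinner: "nsq x = Re (cinner x x)"
  by (simp add: cinner_self)

lemma cinner_less_1:
  assumes "norm x \<le> 1" "norm y < 1"
  shows "norm (cinner x y) < 1"
proof -
  have "norm x * norm y < 1"
    using assms by (metis mult_left_le mult.commute mult_left_le_one_le norm_ge_zero order_le_less_trans)
  then show ?thesis using norm_cinner_le[of x y] by linarith
qed

lemma one_minus_cinner_neq_0:
  assumes "norm x \<le> 1" "norm y < 1"
  shows "1 - cinner x y \<noteq> 0" "1 - cinner y x \<noteq> 0"
  using cinner_less_1[OF assms] by (auto, metis cnj_cinner complex_mod_cnj less_irrefl norm_one)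

text \<open>A Frechet derivative is additive already, so complex homogeneity is all that remains to
  be verified.\<close>

lemma holomorphic_fun_on_iff:
  "F holomorphic_fun_on D \<longleftrightarrow>
     (\<forall>z\<in>D. \<exists>F'. (F has_derivative F') (at z within D) \<and> (\<forall>c x. F' (c *s x) = c * F' x))"
proof -
  have "Vector_Spaces.linear (*s) (*) F' \<longleftrightarrow> (\<forall>c x. F' (c *s x) = c * F' x)"
    if "(F has_derivative F') (at z within D)" for F' and z
    using has_derivative_linear[OF that] 
    by (auto simp: Vector_Spaces.linear_iff vec.vector_space_axioms
        vector_space_over_itself.vector_space_axioms linear_add)
  then show ?thesis unfolding holomorphic_fun_on_def by blast
qed

lemma holomorphic_fun_const: "(\<lambda>x. c) holomorphic_fun_on D"
  unfolding holomorphic_fun_on_iff by (auto intro!: exI[of _ "\<lambda>x. 0"])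

lemma bounded_linear_cinner: "bounded_linear (\<lambda>x. cinner x w)"
  by (rule bounded_linear_intro[where K = "norm w"], simp, simp add: cinner_def scaleR_sum_right)
    (simp add: norm_cinner_le)

lemma holomorphic_fun_cinner: "(\<lambda>x. cinner x w) holomorphic_fun_on D"
  unfolding holomorphic_fun_on_iff
  by (auto intro!: exI[of _ "\<lambda>x. cinner x w"] bounded_linear_imp_has_derivative bounded_linear_cinner)

lemma holomorphic_fun_nth: "(\<lambda>x. x $ i) holomorphic_fun_on D"
  unfolding holomorphic_fun_on_iff
  by (auto intro!: exI[of _ "\<lambda>x. x $ i"] bounded_linear_imp_has_derivative)

lemma holomorphic_fun_compose:
  assumes F: "F holomorphic_fun_on D" and h: "h holomorphic_on S" and "open S" and "F ` D \<subseteq> S"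
  shows "(\<lambda>x. h (F x)) holomorphic_fun_on D"
  unfolding holomorphic_fun_on_iff
proof
  fix z assume z: "z \<in> D"
  obtain F' where F': "(F has_derivative F') (at z within D)" "\<And>c x. F' (c *s x) = c * F' x"
    using F z unfolding holomorphic_fun_on_iff by metis
  have "(h has_field_derivative deriv h (F z)) (at (F z))"
    using h assms(3,4) z holomorphic_derivI by blast
  then have "(h has_derivative (*) (deriv h (F z))) (at (F z))"
    by (simp add: has_field_derivative_def)
  then have "((\<lambda>x. h (F x)) has_derivative (\<lambda>x. deriv h (F z) * F' x)) (at z within D)"
    using F'(1) by (rule has_derivative_compose[rotated])
  then show "\<exists>G. ((\<lambda>x. h (F x)) has_derivative G) (at z within D) \<and> (\<forall>c x. G (c *s x) = c * G x)"
    using F'(2) by (metis mult.left_commute)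
qed

lemma holomorphic_fun_add:
  assumes "F holomorphic_fun_on D" "G holomorphic_fun_on D"
  shows "(\<lambda>x. F x + G x) holomorphic_fun_on D"
  unfolding holomorphic_fun_on_iff
proof
  fix z assume z: "z \<in> D"
  obtain F' where F': "(F has_derivative F') (at z within D)" "\<And>c x. F' (c *s x) = c * F' x"
    using assms(1) z unfolding holomorphic_fun_on_iff by metis
  obtain G' where G': "(G has_derivative G') (at z within D)" "\<And>c x. G' (c *s x) = c * G' x"
    using assms(2) z unfolding holomorphic_fun_on_iff by metis
  show "\<exists>H. ((\<lambda>x. F x + G x) has_derivative H) (at z within D) \<and> (\<forall>c x. H (c *s x) = c * H x)"
    by (rule exI[of _ "\<lambda>x. F' x + G' x"]) (auto intro!: has_derivative_add F' G' simp: F' G' algebra_simps)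
qed

lemma holomorphic_fun_mult:
  assumes "F holomorphic_fun_on D" "G holomorphic_fun_on D"
  shows "(\<lambda>x. F x * G x) holomorphic_fun_on D"
  unfolding holomorphic_fun_on_iff
proof
  fix z assume z: "z \<in> D"
  obtain F' where F': "(F has_derivative F') (at z within D)" "\<And>c x. F' (c *s x) = c * F' x"
    using assms(1) z unfolding holomorphic_fun_on_iff by metis
  obtain G' where G': "(G has_derivative G') (at z within D)" "\<And>c x. G' (c *s x) = c * G' x"
    using assms(2) z unfolding holomorphic_fun_on_iff by metis
  show "\<exists>H. ((\<lambda>x. F x * G x) has_derivative H) (at z within D) \<and> (\<forall>c x. H (c *s x) = c * H x)"
    by (rule exI[of _ "\<lambda>x. F z * G' x + F' x * G z"])
      (auto intro!: has_derivative_mult F' G' simp: F' G' algebra_simps)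
qed

lemma holomorphic_fun_diff:
  assumes "F holomorphic_fun_on D" "G holomorphic_fun_on D"
  shows "(\<lambda>x. F x - G x) holomorphic_fun_on D"
  using holomorphic_fun_add[OF assms(1) holomorphic_fun_mult[OF holomorphic_fun_const[of "-1"] assms(2)]]
  by simp

lemma holomorphic_fun_divide:
  assumes "F holomorphic_fun_on D" "G holomorphic_fun_on D" "\<And>x. x \<in> D \<Longrightarrow> G x \<noteq> 0"
  shows "(\<lambda>x. F x / G x) holomorphic_fun_on D"
proof -
  have "(\<lambda>x. inverse (G x)) holomorphic_fun_on D"
    by (rule holomorphic_fun_compose[OF assms(2), of inverse "- {0}"])
      (use assms(3) in \<open>auto intro!: holomorphic_intros\<close>)
  then show ?thesis
    unfolding divide_inverse by (rule holomorphic_fun_mult[OF assms(1)])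
qed

lemma holomorphic_fun_power:
  assumes "F holomorphic_fun_on D"
  shows "(\<lambda>x. F x ^ k) holomorphic_fun_on D"
  by (induction k) (auto intro!: holomorphic_fun_const holomorphic_fun_mult assms)

lemma holomorphic_fun_sum:
  assumes "\<And>i. i \<in> I \<Longrightarrow> F i holomorphic_fun_on D"
  shows "(\<lambda>x. \<Sum>i\<in>I. F i x) holomorphic_fun_on D"
  using assms by (induction I rule: infinite_finite_induct)
    (auto intro!: holomorphic_fun_const holomorphic_fun_add)

lemma holomorphic_fun_prod:
  assumes "\<And>i. i \<in> I \<Longrightarrow> F i holomorphic_fun_on D"
  shows "(\<lambda>x. \<Prod>i\<in>I. F i x) holomorphic_fun_on D"
  using assms by (induction I rule: infinite_finite_induct)
    (auto intro!: holomorphic_fun_const holomorphic_fun_mult)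

lemmas holomorphic_fun_intros = holomorphic_fun_const holomorphic_fun_cinner holomorphic_fun_nth
  holomorphic_fun_add holomorphic_fun_diff holomorphic_fun_mult holomorphic_fun_divide
  holomorphic_fun_power

lemma has_derivative_vec_lambda:
  fixes f f' :: "'a::real_normed_vector \<Rightarrow> 'b::real_normed_vector ^ 'c"
  assumes "\<And>i. ((\<lambda>x. f x $ i) has_derivative (\<lambda>x. f' x $ i)) (at z within D)"
  shows "(f has_derivative f') (at z within D)"
proof -
  have e: "(\<Sum>i\<in>UNIV. axis i (y $ i)) = y" for y :: "'b ^ 'c"
    by (simp add: vec_eq_iff axis_def)
  have bl: "bounded_linear (\<lambda>y::'b. axis (i::'c) y)" for i
    by (rule bounded_linear_intro[where K = 1]) 
      (auto simp: vec_eq_iff axis_def norm_vec_def L2_set_def if_distrib[of norm] if_distrib[of "\<lambda>x. x\<^sup>2"] cong: if_cong)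
  have "((\<lambda>x. \<Sum>i\<in>UNIV. axis i (f x $ i)) has_derivative (\<lambda>x. \<Sum>i\<in>UNIV. axis i (f' x $ i))) (at z within D)"
    by (intro has_derivative_sum bounded_linear.has_derivative[OF bl] assms)
  then show ?thesis by (simp add: e)
qed

lemma holomorphic_fun_o_curve:
  assumes F: "F holomorphic_fun_on D" and f: "f holomorphic_curve_on S" and "f ` S \<subseteq> D"
  shows "(\<lambda>t. F (f t)) holomorphic_on S"
  unfolding holomorphic_on_def
proof
  fix t assume t: "t \<in> S"
  obtain F' where F': "(F has_derivative F') (at (f t) within D)" "\<And>c x. F' (c *s x) = c * F' x"
    using F t assms(3) unfolding holomorphic_fun_on_iff by (metis image_subset_iff)
  have "\<exists>d. ((\<lambda>t. f t $ i) has_field_derivative d) (at t within S)" for i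
    using f t unfolding holomorphic_curve_on_def holomorphic_on_def field_differentiable_def by blast
  then obtain d where d: "\<And>i. ((\<lambda>t. f t $ i) has_field_derivative d i) (at t within S)" by metis
  have "(f has_derivative (\<lambda>u. u *s (\<chi> i. d i))) (at t within S)"
    by (rule has_derivative_vec_lambda)
      (use d in \<open>simp add: has_field_derivative_def mult.commute[of _ "d _"]\<close>)
  then have "((\<lambda>t. F (f t)) has_derivative (\<lambda>u. F' (u *s (\<chi> i. d i)))) (at t within S)"
    by (rule has_derivative_in_compose) (rule has_derivative_subset[OF F'(1) assms(3)])
  moreover have "F' (u *s (\<chi> i. d i)) = F' (\<chi> i. d i) * u" for u
    by (simp add: F'(2))
  ultimately show "(\<lambda>t. F (f t)) field_differentiable at t within S"
    unfolding field_differentiable_def has_field_derivative_def by auto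
qed

lemma holomorphic_fun_o:
  fixes g :: "complex ^ 'm \<Rightarrow> complex ^ 'n"
  assumes F: "F holomorphic_fun_on D" and g: "\<And>i. (\<lambda>x. g x $ i) holomorphic_fun_on S" and "g ` S \<subseteq> D"
  shows "(\<lambda>x. F (g x)) holomorphic_fun_on S"
  unfolding holomorphic_fun_on_iff
proof
  fix t assume t: "t \<in> S"
  obtain F' where F': "(F has_derivative F') (at (g t) within D)" "\<And>c x. F' (c *s x) = c * F' x"
    using F t assms(3) unfolding holomorphic_fun_on_iff by (metis image_subset_iff)
  have "\<exists>d. ((\<lambda>x. g x $ i) has_derivative d) (at t within S) \<and> (\<forall>c x. d (c *s x) = c * d x)" for i
    using g t unfolding holomorphic_fun_on_iff by blast
  then obtain d where d: "\<And>i. ((\<lambda>x. g x $ i) has_derivative d i) (at t within S)" 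
    "\<And>i c x. d i (c *s x) = c * d i x" by metis
  have "(g has_derivative (\<lambda>u. \<chi> i. d i u)) (at t within S)"
    by (rule has_derivative_vec_lambda) (use d in simp)
  then have "((\<lambda>x. F (g x)) has_derivative (\<lambda>u. F' (\<chi> i. d i u))) (at t within S)"
    by (rule has_derivative_in_compose) (rule has_derivative_subset[OF F'(1) assms(3)])
  moreover have "(\<chi> i. d i (c *s x)) = c *s (\<chi> i. d i x)" for c x
    by (simp add: vec_eq_iff d)
  ultimately show "\<exists>G. ((\<lambda>x. F (g x)) has_derivative G) (at t within S) \<and> (\<forall>c x. G (c *s x) = c * G x)"
    using F'(2) by metis
qed

text \<open>The involutive automorphism of the ball interchanging \<open>0\<close> and \<open>a\<close>; the usual term
  \<open>(1 - s) / |a|\<^sup>2\<close> is written as \<open>1 / (1 + s)\<close>, which makes sense for \<open>a = 0\<close> as well.\<close>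

definition ball_auto :: "complex ^ 'n \<Rightarrow> complex ^ 'n \<Rightarrow> complex ^ 'n" where
  "ball_auto a x = (1 / (1 - cinner x a)) *s
     (a - of_real (sqrt (1 - nsq a)) *s x - (cinner x a / of_real (1 + sqrt (1 - nsq a))) *s a)"

lemma ball_auto_0 [simp]: "ball_auto a 0 = a"
  by (simp add: ball_auto_def)

context
  fixes a :: "complex ^ 'n" and s :: real
  assumes a: "norm a < 1" and s: "s = sqrt (1 - nsq a)"
begin

lemma ball_auto_sqrt: "s > 0" "cinner a a = 1 - of_real s ^ 2" 
proof -
  have "nsq a < 1" using a by (simp add: power_less_one_iff abs_square_less_1)
  then show "s > 0" "cinner a a = 1 - of_real s ^ 2"
    unfolding s by (auto simp: cinner_self simp flip: of_real_power)
qed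

lemma one_plus_s: "(1 + of_real s :: complex) \<noteq> 0"
  using ball_auto_sqrt(1) by (metis add_pos_pos of_real_1 of_real_add of_real_eq_0_iff less_irrefl zero_less_one)

lemma ball_auto_alt: "ball_auto a x = (1 / (1 - cinner x a)) *s
     (a - of_real s *s x - (cinner x a / (1 + of_real s)) *s a)"
  by (simp add: ball_auto_def s)

lemma ball_auto_cinner:
  assumes "norm x \<le> 1" "norm y \<le> 1"
  shows "1 - cinner (ball_auto a x) (ball_auto a y) =
    (1 - cinner a a) * (1 - cinner x y) / ((1 - cinner x a) * (1 - cinner a y))"
proof -
  define X where "X = a - of_real s *s x - (cinner x a / (1 + of_real s)) *s a"
  define Y where "Y = a - of_real s *s y - (cinner y a / (1 + of_real s)) *s a"
  define A B C where "A = cinner x a" and "B = cinner a y" and "C = cinner x y"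
  have ns: "1 - A \<noteq> 0" "1 - B \<noteq> 0"
    using one_minus_cinner_neq_0[OF assms(1) a] one_minus_cinner_neq_0[OF assms(2) a]
    unfolding A_def B_def by auto
  have cy: "cnj (cinner y a) = B" "cinner y a = cnj B" unfolding B_def by (simp_all add: cnj_cinner)
  \<comment> \<open>In terms of \<open>u\<close> the only denominators are powers of
    \<open>u\<close>; clearing them leaves a polynomial identity in \<open>u\<close>,
    \<open>A\<close>, \<open>B\<close>, \<open>C\<close>.\<close>
  define u where "u = (1 + of_real s :: complex)"
  have u: "u \<noteq> 0" "cnj u = u" using one_plus_s by (auto simp: u_def)
  have su: "of_real s = u - 1" by (simp add: u_def)
  have ca: "cinner a a = 1 - (u-1)^2" using ball_auto_sqrt(2) su by simp
  have XY: "cinner X Y = (1-(u-1)^2) - (u-1) * A - A / u * (1-(u-1)^2)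
     - (u-1) * B + (u-1)^2 * C + (u-1) * A * B / u
     - B / u * (1-(u-1)^2) + (u-1) * A * B / u + A * B / u^2 * (1-(u-1)^2)"
    unfolding X_def Y_def u_def[symmetric]
    apply (simp only: cinner_simps ca cy  A_def[symmetric] B_def[symmetric] C_def[symmetric] su
       complex_cnj_divide complex_cnj_diff complex_cnj_one u(2))
    using u(1) apply (simp add: divide_simps)
    apply (simp add: algebra_simps power2_eq_square)
    done
  have "(1 - A) * (1 - B) - cinner X Y = (1 - cinner a a) * (1 - C)"
    unfolding XY ca using u(1) apply (simp add: divide_simps)
    apply (simp add: algebra_simps power2_eq_square)
    done
  moreover have "cinner (ball_auto a x) (ball_auto a y) = cinner X Y / ((1 - A) * (1 - B))"
    unfolding ball_auto_alt X_def[symmetric] Y_def[symmetric] using cy ns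
    by (simp add: A_def)
  moreover have "1 - cinner X Y / ((1 - A) * (1 - B)) = ((1 - A) * (1 - B) - cinner X Y) / ((1 - A) * (1 - B))"
    using ns by (simp add: divide_simps)
  ultimately show ?thesis unfolding A_def[symmetric] B_def[symmetric] C_def[symmetric]
    by simp
qed

lemma ball_auto_cinner_a:
  assumes "norm x \<le> 1"
  shows "1 - cinner (ball_auto a x) a = of_real s ^ 2 / (1 - cinner x a)"
proof -
  have n: "1 - cinner x a \<noteq> 0" using one_minus_cinner_neq_0[OF assms a] by auto
  have "cinner x a / (1 + of_real s) * (1 - of_real s ^ 2) = cinner x a * (1 - of_real s)"
    using one_plus_s by (simp add: field_simps power2_eq_square)
  then have "cinner (a - of_real s *s x - (cinner x a / (1 + of_real s)) *s a) a = 1 - of_real s ^ 2 - cinner x a"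
    by (simp only: cinner_simps ball_auto_sqrt(2)) (simp add: algebra_simps)
  then have "cinner (ball_auto a x) a = (1 - of_real s ^ 2 - cinner x a) / (1 - cinner x a)"
    unfolding ball_auto_alt by (simp only: cinner_simps) simp
  then show ?thesis using n by (simp add: field_simps)
qed

lemma ball_auto_involution:
  assumes "norm x \<le> 1"
  shows "ball_auto a (ball_auto a x) = x"
proof -
  define A where "A = cinner x a"
  define u where "u = (1 + of_real s :: complex)"
  have u: "u \<noteq> 0" "u - 1 \<noteq> 0" using one_plus_s ball_auto_sqrt(1) by (auto simp: u_def)
  have su: "of_real s = u - 1" by (simp add: u_def)
  have n: "1 - A \<noteq> 0" using one_minus_cinner_neq_0[OF assms a] by (auto simp: A_def)
  define B where "B = cinner (ball_auto a x) a"
  have 1: "1 - B = (u-1)^2 / (1 - A)" using ball_auto_cinner_a[OF assms] by (simp add: A_def B_def su)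
  have B: "B = 1 - (u-1)^2 / (1 - A)" using 1 by (simp add: algebra_simps)
  show ?thesis
    unfolding ball_auto_alt[of "ball_auto a x"] B_def[symmetric] 1
    unfolding B ball_auto_alt A_def[symmetric] u_def[symmetric] su
    apply (rule vec_eq_iff[THEN iffD2])
    apply (rule allI)
    subgoal for i
      using u n apply (simp add: divide_simps)
      apply (simp add: algebra_simps power2_eq_square)
      done
    done
qed

lemma norm_ball_auto:
  assumes "norm x \<le> 1"
  shows "1 - nsq (ball_auto a x) = (1 - nsq a) * (1 - nsq x) / nsq (1 - cinner x a)"
proof -
  have "cnj (1 - cinner x a) = 1 - cinner a x" by (simp add: cnj_cinner)
  then have "(1 - cinner x a) * (1 - cinner a x) = complex_of_real (nsq (1 - cinner x a))"
    by (metis complex_norm_square of_real_power)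
  then have "complex_of_real (1 - nsq (ball_auto a x)) =
     of_real ((1 - nsq a) * (1 - nsq x) / nsq (1 - cinner x a))"
    using ball_auto_cinner[OF assms assms] by (simp add: cinner_self)
  then show ?thesis by (simp only: of_real_eq_iff)
qed

lemma ball_auto_in_ball:
  assumes "norm x < 1"
  shows "norm (ball_auto a x) < 1"
proof -
  have "nsq a < 1" "nsq x < 1" using a assms by (auto simp: abs_square_less_1)
  then have "(1 - nsq a) * (1 - nsq x) / nsq (1 - cinner x a) > 0"
    using one_minus_cinner_neq_0[of x a] a assms by auto
  then have "nsq (ball_auto a x) < 1" using norm_ball_auto[of x] assms by simp
  then show ?thesis by (simp add: abs_square_less_1)
qed

end

lemma ball_auto_self [simp]: "norm a < 1 \<Longrightarrow> ball_auto a a = 0"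
  using ball_auto_involution[of a _ 0] by simp

lemma holomorphic_fun_ball_auto:
  assumes "norm a < 1"
  shows "(\<lambda>x. ball_auto a x $ i) holomorphic_fun_on ball 0 1"
  unfolding ball_auto_alt[OF assms refl] vector_smult_component vector_minus_component
  by (intro holomorphic_fun_intros)
    (use one_minus_cinner_neq_0(1)[of _ a] one_plus_s[OF assms refl] assms in \<open>auto simp del: of_real_add\<close>)

lemma holomorphic_curve_ball_auto:
  assumes "norm a < 1" "f holomorphic_curve_on S" "f ` S \<subseteq> ball 0 1"
  shows "(\<lambda>t. ball_auto a (f t)) holomorphic_curve_on S"
  unfolding holomorphic_curve_on_def
  using holomorphic_fun_o_curve[OF holomorphic_fun_ball_auto[OF assms(1)] assms(2,3)] by blast

lemma curve_cinner:
  assumes "f holomorphic_curve_on S"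
  shows "(\<lambda>t. cinner (f t) u) holomorphic_on S"
  using holomorphic_fun_o_curve[OF holomorphic_fun_cinner assms, of UNIV u] by simp

section \<open>Schwarz-Pick in the disc and the ball\<close>

definition mob :: "complex \<Rightarrow> complex \<Rightarrow> complex" where
  "mob a z = (z - a) / (1 - cnj a * z)"

text \<open>\<open>disc_kernel s t\<close> is \<open>1 - \<rho>\<^sup>2\<close> for the pseudohyperbolic distance \<open>\<rho>\<close> of \<open>s\<close> and \<open>t\<close>.\<close>

definition disc_kernel :: "complex \<Rightarrow> complex \<Rightarrow> real" where
  "disc_kernel s t = (1 - nsq s) * (1 - nsq t) / nsq (1 - s * cnj t)"

lemma norm_sq_less_1_iff [simp]: "nsq z < 1 \<longleftrightarrow> norm z < 1"
  by (simp add: abs_square_less_1)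

lemma norm_sq_le_1_iff [simp]: "nsq z \<le> 1 \<longleftrightarrow> norm z \<le> 1"
  by (simp add: abs_square_le_1)

lemma one_minus_cnj_mult_neq_0:
  assumes "norm a < 1" "norm (z::complex) \<le> 1"
  shows "1 - cnj a * z \<noteq> 0" "1 - z * cnj a \<noteq> 0" "1 - a * cnj z \<noteq> 0" "1 - cnj z * a \<noteq> 0"
proof -
  have "norm a * norm z < 1"
    using assms by (metis mult.commute mult_left_le_one_le norm_ge_zero order_le_less_trans)
  then have "norm (cnj a * z) < 1" "norm (a * cnj z) < 1" by (simp_all add: norm_mult)
  then show "1 - cnj a * z \<noteq> 0" "1 - a * cnj z \<noteq> 0" by auto
  then show "1 - z * cnj a \<noteq> 0" "1 - cnj z * a \<noteq> 0" by (simp_all add: mult.commute)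
qed

lemma mob_kernel:
  assumes "norm a < 1" "norm z \<le> 1" "norm w \<le> 1"
  shows "1 - mob a z * cnj (mob a w) =
     of_real (1 - nsq a) * (1 - z * cnj w) / ((1 - cnj a * z) * (1 - a * cnj w))"
proof -
  have n: "1 - cnj a * z \<noteq> 0" "1 - a * cnj w \<noteq> 0"
    using one_minus_cnj_mult_neq_0 assms by auto
  have e: "complex_of_real (1 - nsq a) = 1 - a * cnj a"
    by (simp add: complex_norm_square[symmetric])
  show ?thesis unfolding e mob_def using n
    by (simp add: divide_simps) (simp add: algebra_simps)
qed

lemma of_real_norm_square_eq:
  "complex_of_real (nsq (1 - cnj a * z)) = (1 - cnj a * z) * (1 - a * cnj z)"
  unfolding complex_norm_square by simp

lemma mob_norm:
  assumes "norm a < 1" "norm z \<le> 1"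
  shows "1 - nsq (mob a z) = (1 - nsq a) * (1 - nsq z) / nsq (1 - cnj a * z)"
proof -
  have "complex_of_real (1 - nsq (mob a z)) =
     of_real (1 - nsq a) * of_real (1 - nsq z) / of_real (nsq (1 - cnj a * z))"
    using mob_kernel[OF assms(1,2,2)] 
    unfolding of_real_norm_square_eq of_real_diff[of 1] of_real_1 complex_norm_square by simp
  then show ?thesis unfolding of_real_mult[symmetric] of_real_divide[symmetric] of_real_eq_iff .
qed

lemma disc_kernel_mob:
  assumes "norm s < 1" "norm t < 1"
  shows "1 - nsq (mob s t) = disc_kernel s t"
proof -
  have "norm (1 - s * cnj t) = norm (1 - cnj s * t)"
    by (metis complex_cnj_cnj complex_cnj_diff complex_cnj_mult complex_cnj_one complex_mod_cnj)
  then show ?thesis using mob_norm[of s t] assms by (simp add: disc_kernel_def)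
qed

lemma norm_mob_less_1:
  assumes "norm a < 1" "norm z < 1"
  shows "norm (mob a z) < 1"
proof -
  have "(1 - nsq a) * (1 - nsq z) / nsq (1 - cnj a * z) > 0"
    using assms one_minus_cnj_mult_neq_0[of a z] by simp
  then have "nsq (mob a z) < 1" using mob_norm[of a z] assms by linarith
  then show ?thesis by simp
qed

lemma norm_mob_le_1:
  assumes "norm a < 1" "norm z \<le> 1"
  shows "norm (mob a z) \<le> 1"
proof -
  have "(1 - nsq a) * (1 - nsq z) / nsq (1 - cnj a * z) \<ge> 0"
    using assms by (simp add: less_imp_le)
  then have "nsq (mob a z) \<le> 1" using mob_norm[of a z] assms by linarith
  then show ?thesis by simp
qed

lemma mob_inverse:
  assumes "norm a < 1" "norm z \<le> 1"
  shows "mob (- a) (mob a z) = z"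
proof -
  have n: "1 - cnj a * z \<noteq> 0" using one_minus_cnj_mult_neq_0 assms by auto
  have aa: "1 - a * cnj a \<noteq> 0" using one_minus_cnj_mult_neq_0[of a a] assms by auto
  have 1: "mob a z + a = z * (1 - a * cnj a) / (1 - cnj a * z)"
    using n by (simp add: mob_def divide_simps) (simp add: algebra_simps)
  have 2: "1 + cnj a * mob a z = (1 - a * cnj a) / (1 - cnj a * z)"
    using n by (simp add: mob_def divide_simps) (simp add: algebra_simps)
  have "mob (- a) (mob a z) = (mob a z + a) / (1 + cnj a * mob a z)" by (simp add: mob_def)
  then show ?thesis unfolding 1 2 using n aa by simp
qed

lemma mob_self [simp]: "mob a a = 0"
  by (simp add: mob_def)

lemma mob_0 [simp]: "mob a 0 = - a"
  by (simp add: mob_def)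

lemma mob_eq_0_iff:
  assumes "norm a < 1" "norm z \<le> 1"
  shows "mob a z = 0 \<longleftrightarrow> z = a"
  using one_minus_cnj_mult_neq_0[OF assms] by (simp add: mob_def)

lemma holomorphic_mob:
  assumes "norm a < 1" "h holomorphic_on S" "h ` S \<subseteq> cball 0 1"
  shows "(\<lambda>z. mob a (h z)) holomorphic_on S"
  unfolding mob_def using assms one_minus_cnj_mult_neq_0[of a]
  by (intro holomorphic_intros) auto

lemma disc_kernel_pos: "norm s < 1 \<Longrightarrow> norm t < 1 \<Longrightarrow> disc_kernel s t > 0"
  unfolding disc_kernel_def using one_minus_cnj_mult_neq_0[of t s] by simp

lemma disc_kernel_le_1: 
  assumes "norm s < 1" "norm t < 1"
  shows "disc_kernel s t \<le> 1"
  using disc_kernel_mob[OF assms(1,2)] by (smt (verit) zero_le_power2)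

lemma curve_o_holomorphic:
  assumes "f holomorphic_curve_on S" "h holomorphic_on T" "h ` T \<subseteq> S"
  shows "(\<lambda>t. f (h t)) holomorphic_curve_on T"
  using assms holomorphic_on_compose_gen[OF assms(2) _ assms(3)]
  unfolding holomorphic_curve_on_def o_def by blast

lemma norm_one_minus_cinner_commute: "norm (1 - cinner x y) = norm (1 - cinner y x)"
proof -
  have "cnj (1 - cinner x y) = 1 - cinner y x" by (simp add: cnj_cinner)
  then show ?thesis by (metis complex_mod_cnj)
qed

text \<open>Automorphisms move \<open>s\<close> and \<open>f s\<close> to 0; pairing the resulting
  map with the direction of the image of \<open>f t\<close> gives a scalar function to which the
  Schwarz lemma applies.\<close>

lemma Schwarz_Pick_open_ball:
  fixes f :: "complex \<Rightarrow> complex ^ 'n"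
  assumes f: "f holomorphic_curve_on unit_disc" "f ` unit_disc \<subseteq> ball 0 1"
    and s: "norm s < 1" and t: "norm t < 1"
  shows "disc_kernel s t * nsq (1 - cinner (f s) (f t)) \<le> (1 - nsq (f s)) * (1 - nsq (f t))"
proof -
  have fn: "norm (f z) < 1" if "norm z < 1" for z using f(2) that by (auto simp: image_subset_iff)
  define a where "a = f s"
  have a: "norm a < 1" using fn s by (simp add: a_def)
  define y where "y = ball_auto a (f t)"
  have y: "norm y < 1" unfolding y_def using ball_auto_in_ball[OF a refl] fn t by blast
  \<comment> \<open>For \<open>y = 0\<close> division by zero makes \<open>u = 0\<close>, hence only
    \<open>norm u \<le> 1\<close> is claimed, which covers both cases.\<close>
  define u where "u = (1 / of_real (norm y)) *s y"
  have u: "norm u \<le> 1" by (simp add: u_def norm_scale_complex norm_divide)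
  define g where "g \<zeta> = cinner (ball_auto a (f (mob (-s) \<zeta>))) u" for \<zeta>
  have ms: "norm (mob (-s) z) < 1" if "norm z < 1" for z using norm_mob_less_1 that s by simp
  have c: "(\<lambda>\<zeta>. f (mob (-s) \<zeta>)) holomorphic_curve_on unit_disc"
    by (rule curve_o_holomorphic[OF f(1)])
      (use s ms in \<open>auto intro!: holomorphic_mob holomorphic_intros\<close>)
  have "(\<lambda>\<zeta>. ball_auto a (f (mob (-s) \<zeta>))) holomorphic_curve_on unit_disc"
    by (rule holomorphic_curve_ball_auto[OF a c]) (use fn ms in auto)
  then have hg: "g holomorphic_on unit_disc" unfolding g_def by (rule curve_cinner)
  have g0: "g 0 = 0" using a by (simp add: g_def a_def)
  have gn: "norm (g z) < 1" if "norm z < 1" for z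
  proof -
    have "norm (ball_auto a (f (mob (-s) z))) < 1"
      using ball_auto_in_ball[OF a refl] fn ms that by blast
    then show ?thesis
      unfolding g_def by (metis cinner_less_1 cnj_cinner complex_mod_cnj u)
  qed
  have "norm (g (mob s t)) \<le> norm (mob s t)"
    by (rule Schwarz_Lemma(1)[OF hg g0 gn norm_mob_less_1[OF s t]])
  moreover have "g (mob s t) = of_real (norm y)"
    unfolding g_def using s t by (simp add: mob_inverse y_def[symmetric] u_def cinner_self)
      (simp add: power2_eq_square)
  ultimately have "nsq y \<le> nsq (mob s t)" by (simp add: power_mono)
  then have "disc_kernel s t \<le> 1 - nsq y" using disc_kernel_mob[OF s t] by linarith
  also have "\<dots> = (1 - nsq a) * (1 - nsq (f t)) / nsq (1 - cinner (f t) a)"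
    unfolding y_def using norm_ball_auto[OF a refl] fn[OF t] by simp
  finally show ?thesis
    using one_minus_cinner_neq_0[of "f t" a] a fn[OF t]
    by (simp add: a_def norm_one_minus_cinner_commute[of "f s"] pos_le_divide_eq)
qed

text \<open>Quotients of a map by the variable take values in the closed ball only. Scaled by \<rho>
  < 1 they map into the open ball, and the inequality survives the limit \<rho> \<rightarrow>
  1.\<close>

lemma Schwarz_Pick_ball:
  fixes f :: "complex \<Rightarrow> complex ^ 'n"
  assumes f: "f holomorphic_curve_on unit_disc" "f ` unit_disc \<subseteq> cball 0 1"
    and s: "norm s < 1" and t: "norm t < 1"
  shows "disc_kernel s t * nsq (1 - cinner (f s) (f t)) \<le> (1 - nsq (f s)) * (1 - nsq (f t))"
proof (rule tendsto_le)
  show "at_left (1::real) \<noteq> bot" by simp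
  show "((\<lambda>\<rho>. (1 - (\<rho> * norm (f s))\<^sup>2) * (1 - (\<rho> * norm (f t))\<^sup>2))
      \<longlongrightarrow> (1 - nsq (f s)) * (1 - nsq (f t))) (at_left 1)"
    by (auto intro!: tendsto_eq_intros)
  show "((\<lambda>\<rho>. disc_kernel s t * nsq (1 - of_real (\<rho>^2) * cinner (f s) (f t)))
      \<longlongrightarrow> disc_kernel s t * nsq (1 - cinner (f s) (f t))) (at_left 1)"
    by (auto intro!: tendsto_eq_intros)
  have "disc_kernel s t * nsq (1 - of_real (\<rho>^2) * cinner (f s) (f t))
    \<le> (1 - (\<rho> * norm (f s))\<^sup>2) * (1 - (\<rho> * norm (f t))\<^sup>2)" if \<rho>: "0 < \<rho>" "\<rho> < 1" for \<rho> :: real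
  proof -
    have "(\<lambda>t. of_real \<rho> *s f t) holomorphic_curve_on unit_disc"
      using f(1) unfolding holomorphic_curve_on_def by (auto intro!: holomorphic_intros)
    moreover have "norm (of_real \<rho> *s f t) < 1" if "norm t < 1" for t
    proof -
      have "norm (f t) \<le> 1" using f(2) that by (auto simp: image_subset_iff)
      then show ?thesis using \<rho>
        by (simp add: norm_scale_complex) (metis mult.commute mult_left_le_one_le mult_less_cancel_left2 norm_ge_zero order_le_less_trans less_eq_real_def mult.right_neutral mult_left_mono)
    qed
    ultimately have "disc_kernel s t * nsq (1 - cinner (of_real \<rho> *s f s) (of_real \<rho> *s f t))
      \<le> (1 - nsq (of_real \<rho> *s f s)) * (1 - nsq (of_real \<rho> *s f t))"
      by (intro Schwarz_Pick_open_ball s t) auto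
    then show ?thesis using \<rho> by (simp add: norm_scale_complex power2_eq_square mult.assoc)
  qed
  then show "\<forall>\<^sub>F \<rho> in at_left 1. disc_kernel s t * nsq (1 - of_real (\<rho>^2) * cinner (f s) (f t))
    \<le> (1 - (\<rho> * norm (f s))\<^sup>2) * (1 - (\<rho> * norm (f t))\<^sup>2)"
    by (intro eventually_at_leftI[of 0]) auto
qed

text \<open>Once \<open>a\<close> and \<open>s\<close> are moved to 0, a linear disc reaches the
  image \<open>y\<close> of \<open>b\<close> at \<xi> as soon as |y| \<le> |\<xi>|, and this is the
  kernel inequality.\<close>

lemma two_point_Pick_ball:
  fixes a b :: "complex ^ 'n"
  assumes a: "norm a < 1" and b: "norm b < 1" and s: "norm s < 1" and t: "norm t < 1" and "s \<noteq> t"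
    and le: "disc_kernel s t * nsq (1 - cinner a b) \<le> (1 - nsq a) * (1 - nsq b)"
  obtains g where "g holomorphic_curve_on unit_disc" "g ` unit_disc \<subseteq> ball 0 1" "g s = a" "g t = b"
proof -
  define y where "y = ball_auto a b"
  define \<xi> where "\<xi> = mob s t"
  have \<xi>: "\<xi> \<noteq> 0" using mob_eq_0_iff[of s t] s t \<open>s \<noteq> t\<close> by (auto simp: \<xi>_def)
  have "disc_kernel s t \<le> (1 - nsq a) * (1 - nsq b) / nsq (1 - cinner b a)"
    using le one_minus_cinner_neq_0[of b a] a b
    by (simp add: pos_le_divide_eq norm_one_minus_cinner_commute[of a])
  then have "disc_kernel s t \<le> 1 - nsq y"
    unfolding y_def using norm_ball_auto[OF a refl] b by simp
  then have "nsq y \<le> nsq \<xi>" using disc_kernel_mob[OF s t] unfolding \<xi>_def by linarith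
  then have y: "norm y \<le> norm \<xi>" by (rule power2_le_imp_le) simp
  define p where "p \<zeta> = (mob s \<zeta> / \<xi>) *s y" for \<zeta>
  define g where "g \<zeta> = ball_auto a (p \<zeta>)" for \<zeta>
  have np: "norm (p \<zeta>) < 1" if "norm \<zeta> < 1" for \<zeta>
  proof -
    have "norm (p \<zeta>) = norm (mob s \<zeta>) * (norm y / norm \<xi>)"
      by (simp add: p_def norm_scale_complex norm_divide)
    also have "\<dots> \<le> norm (mob s \<zeta>) * 1"
      using y \<xi> by (intro mult_left_mono) (auto simp: divide_le_eq)
    also have "\<dots> < 1" using norm_mob_less_1[OF s that] by simp
    finally show ?thesis .
  qed
  have "p holomorphic_curve_on unit_disc"
    unfolding holomorphic_curve_on_def p_def vector_smult_component
    using s \<xi> by (auto intro!: holomorphic_intros holomorphic_mob)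
  then have "g holomorphic_curve_on unit_disc"
    unfolding g_def using np by (intro holomorphic_curve_ball_auto[OF a]) auto
  moreover have "g ` unit_disc \<subseteq> ball 0 1"
    using ball_auto_in_ball[OF a refl] np by (auto simp: g_def)
  moreover have "g s = a" by (simp add: g_def p_def)
  moreover have "g t = b"
    using \<xi> ball_auto_involution[OF a refl] b by (simp add: g_def p_def \<xi>_def[symmetric] y_def)
  ultimately show ?thesis by (rule that)
qed

text \<open>Identifying scalars with \<open>complex ^ 1\<close> turns each statement about maps into
  the disc into a special case of the one for the ball.\<close>

lemma vec1 [simp]:
  "cinner (vec a) (vec b :: complex ^ 1) = a * cnj b" "norm (vec a :: complex ^ 1) = norm a"
  by (simp_all add: cinner_def norm_vec_def L2_set_def)

lemma Schwarz_Pick_disc: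
  assumes "h holomorphic_on unit_disc" "h ` unit_disc \<subseteq> cball 0 1" "norm s < 1" "norm t < 1"
  shows "disc_kernel s t * nsq (1 - h s * cnj (h t)) \<le> (1 - nsq (h s)) * (1 - nsq (h t))"
  using Schwarz_Pick_ball[of "\<lambda>t. vec (h t) :: complex ^ 1" s t] assms
  by (auto simp: holomorphic_curve_on_def image_subset_iff)

lemma two_point_Pick_disc:
  assumes "norm a < 1" "norm b < 1" "norm s < 1" "norm t < 1" "s \<noteq> t"
    and "disc_kernel s t * nsq (1 - a * cnj b) \<le> (1 - nsq a) * (1 - nsq b)"
  obtains g where "g holomorphic_on unit_disc" "g ` unit_disc \<subseteq> ball 0 1" "g s = a" "g t = b"
proof -
  obtain g :: "complex \<Rightarrow> complex ^ 1" where g: "g holomorphic_curve_on unit_disc" "g ` unit_disc \<subseteq> ball 0 1"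
    "g s = vec a" "g t = vec b"
    using two_point_Pick_ball[of "vec a :: complex ^ 1" "vec b" s t] assms by auto
  show ?thesis
  proof (rule that[of "\<lambda>t. g t $ 1"])
    show "(\<lambda>t. g t $ 1) ` unit_disc \<subseteq> ball 0 1"
      using g(2) by (auto simp: image_subset_iff norm_vec_def L2_set_def)
  qed (use g in \<open>auto simp: holomorphic_curve_on_def\<close>)
qed

text \<open>Equality says that the pseudohyperbolic distances of \<open>s\<close>, \<open>t\<close>
  and of \<open>a\<close>, \<open>b\<close> agree, so a disc automorphism takes \<open>s\<close> to
  \<open>a\<close> and \<open>t\<close> to \<open>b\<close>; the work lies in bringing it to the
  form of a rotation after \<open>mob \<alpha>\<close>.\<close>

lemma two_point_Pick_equality:
  assumes a: "norm a < 1" and b: "norm b < 1" and s: "norm s < 1" and t: "norm t < 1" and "s \<noteq> t"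
    and eq: "disc_kernel s t * nsq (1 - a * cnj b) = (1 - nsq a) * (1 - nsq b)"
  obtains u \<alpha> where "norm u = 1" "norm \<alpha> < 1" "a = u * mob \<alpha> s" "b = u * mob \<alpha> t"
proof -
  define \<xi> where "\<xi> = mob s t"
  have \<xi>: "\<xi> \<noteq> 0" using mob_eq_0_iff[of s t] s t \<open>s \<noteq> t\<close> by (auto simp: \<xi>_def)
  have "nsq (1 - a * cnj b) \<noteq> 0" using one_minus_cnj_mult_neq_0[OF b, of a] a by auto
  then have "disc_kernel s t = disc_kernel a b" using eq by (simp add: disc_kernel_def[of a] field_simps)
  then have "nsq (mob s t) = nsq (mob a b)"
    using disc_kernel_mob[OF s t] disc_kernel_mob[OF a b] by linarith
  then have "norm (mob s t) = norm (mob a b)" by (rule power2_eq_imp_eq) simp_all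
  define c where "c = mob a b / \<xi>"
  have c: "norm c = 1" "mob a b = c * \<xi>"
    using \<xi> \<open>norm (mob s t) = norm (mob a b)\<close> by (auto simp: c_def norm_divide \<xi>_def[symmetric])
  have cc: "c * cnj c = 1" using c(1) complex_norm_square[of c] by simp
  have cs: "norm (c * s) < 1" using c s by (simp add: norm_mult)
  have n1: "1 - cnj a * c * s \<noteq> 0" using one_minus_cnj_mult_neq_0[OF a, of "c * s"] cs by (simp add: mult.assoc)
  have n2: "c - a * cnj s \<noteq> 0"
  proof
    assume "c - a * cnj s = 0"
    then have "norm a * norm s = 1" using c(1) by (metis complex_mod_cnj eq_iff_diff_eq_0 norm_mult)
    then show False using a s by (metis mult_left_le_one_le norm_ge_zero not_less order.strict_implies_order)
  qed
  \<comment> \<open>\<alpha> is the zero of \<open>mob (- a) (c * mob s \<zeta>)\<close> as a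
    function of \<zeta>, and \<open>u\<close> is the quotient of the leading coefficient of its
    numerator by the constant term of its denominator.\<close>
  define u where "u = (c - a * cnj s) / (1 - cnj a * c * s)"
  define \<alpha> where "\<alpha> = (c * s - a) / (c - a * cnj s)"
  have cnj1: "cnj (c - a * cnj s) = cnj c * (1 - cnj a * c * s)"
    using cc by (simp add: algebra_simps)
  have eqn: "norm (c - a * cnj s) = norm (1 - cnj a * c * s)"
    by (metis cnj1 complex_mod_cnj c(1) norm_mult mult_1)
  have u: "norm u = 1" using eqn n1 by (simp add: u_def norm_divide)
  have "\<alpha> = mob a (c * s) / u"
    unfolding \<alpha>_def u_def mob_def using n1 n2 by (simp add: mult.assoc)
  then have al: "norm \<alpha> < 1" using u norm_mob_less_1[OF a cs] by (simp add: norm_divide)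
  have cal: "cnj \<alpha> = (cnj s - cnj a * c) / (1 - cnj a * c * s)"
  proof -
    have "cnj \<alpha> = cnj (c * s - a) / (cnj c * (1 - cnj a * c * s))" unfolding \<alpha>_def cnj1[symmetric] by simp
    also have "cnj (c * s - a) = cnj c * (cnj s - cnj a * c)" using cc by (simp add: algebra_simps)
    finally show ?thesis using c(1) by (simp add: norm_zero) (metis mult_divide_mult_cancel_left complex_cnj_zero_iff norm_zero zero_neq_one)
  qed
  have key: "u * mob \<alpha> \<zeta> = mob (- a) (c * mob s \<zeta>)" if "norm \<zeta> < 1" for \<zeta>
  proof -
    have n3: "1 - cnj s * \<zeta> \<noteq> 0" using one_minus_cnj_mult_neq_0[OF s] that by simp
    have n4: "1 - cnj \<alpha> * \<zeta> \<noteq> 0" using one_minus_cnj_mult_neq_0[OF al] that by simp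
    have n4': "1 - cnj a * c * s - (cnj s - cnj a * c) * \<zeta> \<noteq> 0"
      using n4 n1 unfolding cal by (simp add: field_simps)
    have "u * mob \<alpha> \<zeta> = ((c - a * cnj s) * \<zeta> - (c * s - a)) / (1 - cnj a * c * s - (cnj s - cnj a * c) * \<zeta>)"
    proof -
      have "\<zeta> - \<alpha> = ((c - a * cnj s) * \<zeta> - (c * s - a)) / (c - a * cnj s)"
        using n2 by (simp add: \<alpha>_def divide_simps)
      moreover have "1 - cnj \<alpha> * \<zeta> = (1 - cnj a * c * s - (cnj s - cnj a * c) * \<zeta>) / (1 - cnj a * c * s)"
        using n1 unfolding cal by (simp add: divide_simps)
      ultimately show ?thesis using n1 n2 n4' by (simp add: mob_def u_def)
    qed
    moreover have "mob (- a) (c * mob s \<zeta>) = ((c - a * cnj s) * \<zeta> - (c * s - a)) / (1 - cnj a * c * s - (cnj s - cnj a * c) * \<zeta>)"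
    proof -
      have "c * mob s \<zeta> + a = ((c - a * cnj s) * \<zeta> - (c * s - a)) / (1 - cnj s * \<zeta>)"
        using n3 by (simp add: mob_def divide_simps) (simp add: algebra_simps)
      moreover have "1 + cnj a * (c * mob s \<zeta>) = (1 - cnj a * c * s - (cnj s - cnj a * c) * \<zeta>) / (1 - cnj s * \<zeta>)"
        using n3 by (simp add: mob_def divide_simps) (simp add: algebra_simps)
      moreover have "mob (- a) (c * mob s \<zeta>) = (c * mob s \<zeta> + a) / (1 + cnj a * (c * mob s \<zeta>))"
        by (simp add: mob_def[of "-a"])
      ultimately show ?thesis using n3 n4' by simp
    qed
    ultimately show ?thesis by simp
  qed
  show ?thesis
  proof (rule that[OF u al])
    show "a = u * mob \<alpha> s" using key[OF s] by simp
    show "b = u * mob \<alpha> t" using key[OF t] c(2) mob_inverse[of a b] a b by (simp add: \<xi>_def)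
  qed
qed

section \<open>Uniqueness of extremal interpolants in the disc\<close>

lemma holomorphic_factor_zeros:
  assumes "finite T" "T \<subseteq> S" "open S" "u holomorphic_on S" "\<And>t. t \<in> T \<Longrightarrow> u t = 0"
  shows "\<exists>v. v holomorphic_on S \<and> (\<forall>z\<in>S. u z = v z * (\<Prod>t\<in>T. z - t))"
  using assms
proof (induction T rule: finite_induct)
  case empty
  then show ?case by auto
next
  case (insert x T)
  then obtain v where v: "v holomorphic_on S" "\<forall>z\<in>S. u z = v z * (\<Prod>t\<in>T. z - t)" by auto
  have "(\<Prod>t\<in>T. x - t) \<noteq> 0" using insert by auto
  then have vx: "v x = 0" using v(2) insert by auto
  define w where "w z = (if z = x then deriv v x else (v z - v x) / (z - x))" for z
  have "w holomorphic_on S" unfolding w_def by (rule pole_lemma_open[OF v(1) \<open>open S\<close>])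
  moreover have "u z = w z * (\<Prod>t\<in>insert x T. z - t)" if "z \<in> S" for z
    using v(2) vx insert that by (auto simp: w_def)
  ultimately show ?case by blast
qed

text \<open>Uniform continuity on the closed annulus carries the zero boundary values inwards. This
  replaces boundary values of a bounded holomorphic function, which need not exist.\<close>

lemma cmod_near_circle:
  fixes m :: "complex \<Rightarrow> real"
  assumes "r1 < 1" "0 < r1" "continuous_on {z. r1 \<le> norm z \<and> norm z \<le> 1} m" "\<And>z. norm z = 1 \<Longrightarrow> m z = 0" "\<epsilon> > 0"
  obtains r where "r < 1" "0 < r" "\<And>z. r < norm z \<Longrightarrow> norm z < 1 \<Longrightarrow> \<bar>m z\<bar> < \<epsilon>"
proof -
  let ?A = "{z::complex. r1 \<le> norm z \<and> norm z \<le> 1}"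
  have "?A = cball 0 1 - ball 0 r1" by auto
  then have "compact ?A" by (simp add: compact_diff)
  then have "uniformly_continuous_on ?A m" using assms(3) compact_uniformly_continuous by blast
  then obtain \<delta> where \<delta>: "\<delta> > 0" "\<And>x y. x \<in> ?A \<Longrightarrow> y \<in> ?A \<Longrightarrow> dist y x < \<delta> \<Longrightarrow> dist (m y) (m x) < \<epsilon>"
    using assms(5) unfolding uniformly_continuous_on_def by meson
  show ?thesis
  proof (rule that[of "max r1 (1 - \<delta>)"])
    show "max r1 (1 - \<delta>) < 1" "0 < max r1 (1 - \<delta>)" using assms \<delta> by auto
    fix z :: complex assume z: "max r1 (1 - \<delta>) < norm z" "norm z < 1"
    define y where "y = z / norm z"
    have zn: "z \<noteq> 0" using z assms(2) by auto
    have y: "norm y = 1" using zn by (simp add: y_def norm_divide)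
    have "z - y = z * of_real (1 - 1 / norm z)" using zn by (simp add: y_def algebra_simps)
    then have "norm (z - y) = norm z * \<bar>1 - 1 / norm z\<bar>" by (simp only: norm_mult norm_of_real)
    also have "\<dots> = 1 - norm z" using zn z by (simp add: abs_if field_simps)
    finally have "dist z y < \<delta>" using z by (simp add: dist_norm)
    then have "dist (m z) (m y) < \<epsilon>" using \<delta>(2)[of y z] z y assms by auto
    then show "\<bar>m z\<bar> < \<epsilon>" using assms(4)[OF y] by (simp add: dist_norm)
  qed
qed

text \<open>The uniqueness part of Pick's theorem. With \<open>B = N / P\<close>, \<open>T\<^sub>p = \<Prod>(\<zeta> - t)\<close> and
  \<open>T\<^sub>s = \<Prod>(1 - t\<^sup>* \<zeta>)\<close>, the function \<open>W = - c\<^sup>* \<zeta> P (\<phi> P - N) / (T\<^sub>p T\<^sub>s)\<close> is holomorphic,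
  vanishes at \<open>0\<close>, and on the circle has real part
  \<open>(1 - Re (\<phi> B\<^sup>*)) |P / T\<^sub>p|\<^sup>2 \<ge> 0\<close>; hence it is zero.\<close>

lemma Pick_unique:
  assumes \<phi>: "\<phi> holomorphic_on unit_disc" "\<phi> ` unit_disc \<subseteq> cball 0 1"
    and c: "norm c = 1" and a: "\<And>k. k < d \<Longrightarrow> norm (a k) < 1"
    and T: "T \<subseteq> unit_disc" "finite T" "card T = d + 1"
    and agree: "\<And>t. t \<in> T \<Longrightarrow> \<phi> t = c * (\<Prod>k<d. (t - a k) / (1 - cnj (a k) * t))"
    and z: "z \<in> unit_disc"
  shows "\<phi> z = c * (\<Prod>k<d. (z - a k) / (1 - cnj (a k) * z))"
proof -
  define N where "N \<zeta> = c * (\<Prod>k<d. \<zeta> - a k)" for \<zeta>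
  define P where "P \<zeta> = (\<Prod>k<d. 1 - cnj (a k) * \<zeta>)" for \<zeta>
  define Tp where "Tp \<zeta> = (\<Prod>t\<in>T. \<zeta> - t)" for \<zeta>
  define Ts where "Ts \<zeta> = (\<Prod>t\<in>T. 1 - cnj t * \<zeta>)" for \<zeta>
  have BNP: "c * (\<Prod>k<d. (\<zeta> - a k) / (1 - cnj (a k) * \<zeta>)) = N \<zeta> / P \<zeta>" for \<zeta>
    by (simp add: N_def P_def prod_dividef)
  have P0: "P \<zeta> \<noteq> 0" if "norm \<zeta> \<le> 1" for \<zeta>
    using one_minus_cnj_mult_neq_0(1)[OF a that] by (auto simp: P_def)
  have Tn: "norm t < 1" if "t \<in> T" for t using T that by auto
  have Ts0: "Ts \<zeta> \<noteq> 0" if "norm \<zeta> \<le> 1" for \<zeta>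
    using one_minus_cnj_mult_neq_0(1)[OF Tn that] T(2) by (auto simp: Ts_def)
  define u where "u \<zeta> = \<phi> \<zeta> * P \<zeta> - N \<zeta>" for \<zeta>
  have hol: "N holomorphic_on A" "P holomorphic_on A" "Tp holomorphic_on A" "Ts holomorphic_on A" for A
    unfolding N_def P_def Tp_def Ts_def by (intro holomorphic_intros)+
  have hu: "u holomorphic_on unit_disc" unfolding u_def by (intro holomorphic_intros \<phi> hol)
  have "u t = 0" if "t \<in> T" for t
    using agree[OF that] P0[of t] Tn[OF that] unfolding u_def BNP by simp
  then obtain v where v: "v holomorphic_on unit_disc" "\<And>z. z \<in> unit_disc \<Longrightarrow> u z = v z * Tp z"
    using holomorphic_factor_zeros[OF T(2,1) open_ball hu] unfolding Tp_def by blast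
  define W where "W \<zeta> = - cnj c * \<zeta> * v \<zeta> * P \<zeta> / Ts \<zeta>" for \<zeta>
  have hW: "W holomorphic_on unit_disc"
    unfolding W_def using Ts0 by (intro holomorphic_intros v hol) auto
  \<comment> \<open>Away from the zeros of \<open>Tp\<close> one has
    \<open>W = \<kappa> - \<eta> * \<phi>\<close>. On the circle \<kappa> has real part |\<eta>|, so
    \<open>Re W\<close> is bounded below by \<open>m\<close>, which involves only functions
    continuous up to the circle.\<close>
  define \<kappa> where "\<kappa> \<zeta> = \<zeta> * cnj c * P \<zeta> * N \<zeta> / (Tp \<zeta> * Ts \<zeta>)" for \<zeta>
  define \<eta> where "\<eta> \<zeta> = \<zeta> * cnj c * (P \<zeta>)\<^sup>2 / (Tp \<zeta> * Ts \<zeta>)" for \<zeta>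
  define m where "m \<zeta> = Re (\<kappa> \<zeta>) - norm (\<eta> \<zeta>)" for \<zeta>
  obtain r1 where r1: "0 < r1" "r1 < 1" "\<And>t. t \<in> T \<Longrightarrow> norm t < r1"
  proof -
    have ne: "finite (norm ` T)" "norm ` T \<noteq> {}" using T by auto
    have "Max (norm ` T) < 1" using Tn ne by auto
    moreover have "norm t < (Max (norm ` T) + 1) / 2" if "t \<in> T" for t
      using Max_ge[OF ne(1), of "norm t"] that calculation by auto
    moreover have "0 \<le> Max (norm ` T)" using ne by (meson Max_in image_iff norm_ge_zero ex_in_conv Max_ge_iff)
    ultimately show ?thesis using that[of "(Max (norm ` T) + 1) / 2"] by auto
  qed
  have Tp0: "Tp \<zeta> \<noteq> 0" if "r1 \<le> norm \<zeta>" for \<zeta> using r1(3) that T(2) unfolding Tp_def by fastforce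
  have cm: "continuous_on {z. r1 \<le> norm z \<and> norm z \<le> 1} m"
    unfolding m_def \<kappa>_def \<eta>_def using Tp0 Ts0
    by (auto intro!: continuous_intros holomorphic_on_imp_continuous_on[of "\<lambda>x. _ x / _ x"] holomorphic_intros hol)
  have m0: "m \<zeta> = 0" if \<zeta>: "norm \<zeta> = 1" for \<zeta>
  proof -
    have zz: "\<zeta> * cnj \<zeta> = 1" using complex_norm_square[of \<zeta>] \<zeta> by simp
    have cc: "c * cnj c = 1" using complex_norm_square[of c] c by simp
    have "(\<Prod>t\<in>T. 1 - cnj t * \<zeta>) = (\<Prod>t\<in>T. \<zeta> * cnj (\<zeta> - t))"
      using zz by (intro prod.cong) (auto simp: algebra_simps)
    then have t: "Ts \<zeta> = \<zeta> ^ (d + 1) * cnj (Tp \<zeta>)"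
      by (simp add: Ts_def Tp_def prod.distrib T(3) power_add)
    have "\<zeta> * cnj (1 - cnj (a k) * \<zeta>) = \<zeta> - a k" for k
    proof -
      have "\<zeta> * cnj (1 - cnj (a k) * \<zeta>) = \<zeta> - a k * (\<zeta> * cnj \<zeta>)" by (simp add: algebra_simps)
      then show ?thesis using zz by simp
    qed
    then have "(\<Prod>k<d. \<zeta> - a k) = (\<Prod>k<d. \<zeta> * cnj (1 - cnj (a k) * \<zeta>))" by simp
    then have n: "N \<zeta> = c * \<zeta> ^ d * cnj (P \<zeta>)" by (simp add: N_def P_def prod.distrib)
    have z0: "\<zeta> \<noteq> 0" using \<zeta> by auto
    have "\<kappa> \<zeta> = (c * cnj c) * (P \<zeta> * cnj (P \<zeta>)) / (Tp \<zeta> * cnj (Tp \<zeta>))"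
      unfolding \<kappa>_def t n using z0 by (simp add: field_simps)
    also have "\<dots> = of_real (nsq (P \<zeta>) / nsq (Tp \<zeta>))"
      unfolding cc of_real_divide complex_norm_square by simp
    finally have "Re (\<kappa> \<zeta>) = nsq (P \<zeta>) / nsq (Tp \<zeta>)" by (simp only: Re_complex_of_real)
    moreover have "norm (\<eta> \<zeta>) = nsq (P \<zeta>) / nsq (Tp \<zeta>)"
      unfolding \<eta>_def t using \<zeta> c z0 by (simp add: norm_mult norm_divide norm_power power2_eq_square)
    ultimately show ?thesis by (simp add: m_def)
  qed
  have Wm: "Re (W \<zeta>) \<ge> m \<zeta>" if "r1 < norm \<zeta>" "norm \<zeta> < 1" for \<zeta>
  proof -
    have n: "Tp \<zeta> \<noteq> 0" "Ts \<zeta> \<noteq> 0" using Tp0 Ts0 that by auto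
    have vu: "v \<zeta> = u \<zeta> / Tp \<zeta>" using v(2)[of \<zeta>] that n by simp
    have "W \<zeta> = \<kappa> \<zeta> - \<eta> \<zeta> * \<phi> \<zeta>"
      unfolding W_def vu \<kappa>_def \<eta>_def u_def using n by (simp add: field_simps power2_eq_square)
    moreover have "norm (\<eta> \<zeta> * \<phi> \<zeta>) \<le> norm (\<eta> \<zeta>) * 1"
      unfolding norm_mult using \<phi>(2) that by (intro mult_left_mono) (auto simp: image_subset_iff)
    then have "Re (\<eta> \<zeta> * \<phi> \<zeta>) \<le> norm (\<eta> \<zeta>)"
      using complex_Re_le_cmod[of "\<eta> \<zeta> * \<phi> \<zeta>"] by linarith
    ultimately show ?thesis by (simp add: m_def)
  qed
  have ReW: "Re (W \<zeta>) \<ge> 0" if \<zeta>: "norm \<zeta> < 1" for \<zeta>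
  proof -
    have "Re (- W \<zeta>) \<le> \<epsilon>" if "\<epsilon> > 0" for \<epsilon>
    proof -
      obtain r where r: "r < 1" "0 < r" "\<And>z. r < norm z \<Longrightarrow> norm z < 1 \<Longrightarrow> \<bar>m z\<bar> < \<epsilon>"
        using cmod_near_circle[OF r1(2,1) cm m0 \<open>\<epsilon> > 0\<close>] by blast
      obtain q where q: "max (max r r1) (norm \<zeta>) < q" "q < 1"
        using dense[of "max (max r r1) (norm \<zeta>)" 1] r r1 \<zeta> by auto
      show ?thesis
      proof (rule maximum_real_frontier[of "\<lambda>z. - W z" "cball 0 q" \<epsilon> \<zeta>])
        have sub: "cball 0 q \<subseteq> unit_disc" using q by auto
        show "(\<lambda>z. - W z) holomorphic_on interior (cball 0 q)"
          by (intro holomorphic_intros holomorphic_on_subset[OF hW] order_trans[OF interior_subset sub])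
        show "continuous_on (closure (cball 0 q)) (\<lambda>z. - W z)"
          using holomorphic_on_imp_continuous_on[OF hW] sub
          by (auto intro!: continuous_intros intro: continuous_on_subset)
        show "\<zeta> \<in> cball 0 q" using q by auto
        fix z :: complex assume "z \<in> frontier (cball 0 q)"
        then have "norm z = q" using q r by (simp add: frontier_cball)
        then show "Re (- W z) \<le> \<epsilon>" using Wm[of z] r(3)[of z] q by auto
      qed simp
    qed
    then have "Re (- W \<zeta>) \<le> 0" using field_le_epsilon[of "Re (- W \<zeta>)" 0] by simp
    then show ?thesis by simp
  qed
  \<comment> \<open>The Cayley transform sends the right half-plane to the disc and
    \<open>W 0 = 0\<close> to 1, so the modulus of \<open>g\<close> is maximal at the interior point
    0.\<close>
  define g where "g \<zeta> = (1 - W \<zeta>) / (1 + W \<zeta>)" for \<zeta>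
  have W1: "1 + W \<zeta> \<noteq> 0" if "norm \<zeta> < 1" for \<zeta>
    using ReW[OF that] by (auto simp: complex_eq_iff)
  have W0: "W 0 = 0" by (simp add: W_def)
  have "g constant_on unit_disc"
  proof (rule maximum_modulus_principle[of g unit_disc unit_disc 0])
    show "g holomorphic_on unit_disc"
      unfolding g_def using W1 by (intro holomorphic_intros hW) auto
    show "norm (g \<zeta>) \<le> norm (g 0)" if "\<zeta> \<in> unit_disc" for \<zeta>
    proof -
      have "nsq (1 - W \<zeta>) \<le> nsq (1 + W \<zeta>)"
        using ReW[of \<zeta>] that unfolding cmod_power2 by (simp add: power2_eq_square algebra_simps)
      then have "norm (1 - W \<zeta>) \<le> norm (1 + W \<zeta>)" by (rule power2_le_imp_le) simp
      then show ?thesis using W1[of \<zeta>] that by (simp add: g_def W0 norm_divide divide_le_eq_1)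
    qed
  qed auto
  then have "W \<zeta> = 0" if "norm \<zeta> < 1" for \<zeta>
  proof -
    have "g \<zeta> = g 0" using \<open>g constant_on unit_disc\<close> that unfolding constant_on_def by auto
    then have "1 - W \<zeta> = 1 + W \<zeta>" using W1[OF that] by (simp add: g_def W0)
    then show ?thesis by (simp add: algebra_simps)
  qed
  then have u0: "u \<zeta> = 0" if "norm \<zeta> < 1" "\<zeta> \<noteq> 0" for \<zeta>
    using v(2)[of \<zeta>] that P0[of \<zeta>] Ts0[of \<zeta>] c unfolding W_def by fastforce
  \<comment> \<open>The factor \<zeta> in \<open>W\<close> vanishes at 0, so nothing about
    \<open>u 0\<close> can be read off from \<open>W = 0\<close>; continuity supplies this
    value.\<close>
  have "u 0 = 0"
  proof -
    have "(u \<longlongrightarrow> u 0) (at 0)"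
      using holomorphic_on_imp_continuous_on[OF hu] by (simp add: continuous_on_eq_continuous_at isCont_def)
    moreover have "\<forall>\<^sub>F \<zeta> in at 0. u \<zeta> = 0"
      using eventually_at_ball'[OF zero_less_one, of "0::complex" UNIV] by eventually_elim (simp add: u0)
    then have "(u \<longlongrightarrow> 0) (at 0)" by (rule tendsto_eventually)
    ultimately show ?thesis using tendsto_unique by force
  qed
  then have "u z = 0" using u0[of z] z by fastforce
  then show ?thesis unfolding BNP using P0[of z] z by (simp add: u_def field_simps)
qed

lemma Pick_unique_blaschke:
  assumes "\<phi> holomorphic_on unit_disc" "\<phi> ` unit_disc \<subseteq> cball 0 1" "blaschke_product d B"
    and "T \<subseteq> unit_disc" "finite T" "card T > d" "\<And>t. t \<in> T \<Longrightarrow> \<phi> t = B t" "z \<in> unit_disc"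
  shows "\<phi> z = B z"
proof -
  obtain c a where B: "norm c = 1" "\<forall>k<d. a k \<in> unit_disc"
    "\<forall>t\<in>unit_disc. B t = c * (\<Prod>k<d. (t - a k) / (1 - cnj (a k) * t))"
    using assms(3) unfolding blaschke_product_def by blast
  obtain T' where T': "T' \<subseteq> T" "card T' = d + 1"
    using obtain_subset_with_card_n[of "d+1" T] assms(6) by auto
  have "\<phi> t = c * (\<Prod>k<d. (t - a k) / (1 - cnj (a k) * t))" if "t \<in> T'" for t
  proof -
    have "t \<in> T" "t \<in> unit_disc" using that T'(1) assms(4) by auto
    then show ?thesis using assms(7)[of t] B(3) by simp
  qed
  then have "\<phi> z = c * (\<Prod>k<d. (z - a k) / (1 - cnj (a k) * z))"
    by (rule Pick_unique[OF assms(1,2) B(1) _ order_trans[OF T'(1) assms(4)]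
          finite_subset[OF T'(1) assms(5)] T'(2) _ assms(8), rotated]) (use B(2) in auto)
  then show ?thesis using B(3) assms(8) by simp
qed

text \<open>The product is continuous up to the boundary point 1 and has modulus 1 there, which
  radial approach turns into a lower bound for \<rho>.\<close>

lemma blaschke_product_unbounded:
  assumes "blaschke_product d B" "\<And>t. t \<in> unit_disc \<Longrightarrow> norm (B t) \<le> \<rho>"
  shows "1 \<le> \<rho>"
proof -
  obtain c a where B: "norm c = 1" "\<forall>k<d. a k \<in> unit_disc"
    "\<forall>t\<in>unit_disc. B t = c * (\<Prod>k<d. (t - a k) / (1 - cnj (a k) * t))"
    using assms(1) unfolding blaschke_product_def by blast
  define b where "b x = norm (c * (\<Prod>k<d. (of_real x - a k) / (1 - cnj (a k) * of_real x)))" for x :: real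
  have nz: "1 - cnj (a k) \<noteq> 0" if "k < d" for k
    using one_minus_cnj_mult_neq_0(1)[of "a k" 1] B(2) that by auto
  have "norm (1 - a k) = norm (1 - cnj (a k))" for k
    by (metis complex_cnj_diff complex_cnj_one complex_mod_cnj)
  then have "norm ((1 - a k) / (1 - cnj (a k))) = 1" if "k < d" for k
    using nz[OF that] by (simp add: norm_divide)
  then have "b 1 = 1" using B(1) by (simp add: b_def norm_mult prod_norm[symmetric])
  moreover have "isCont b 1"
    unfolding b_def using nz by (intro continuous_intros) auto
  ultimately have "(b \<longlongrightarrow> 1) (at_left 1)"
    by (metis isCont_def filterlim_at_split)
  moreover have "\<forall>\<^sub>F x in at_left 1. b x \<le> \<rho>"
    by (rule eventually_at_leftI[of 0]) (use assms(2) B(3) in \<open>auto simp: b_def\<close>)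
  ultimately show ?thesis by (intro tendsto_upperbound) auto
qed

section \<open>Three-point interpolation from the disc to the ball\<close>

text \<open>Up to a positive factor, \<open>pick_det (|z|\<^sup>2) (|w|\<^sup>2) \<langle>z,w\<rangle> s t\<close> is the determinant of the Pick matrix
  of the interpolation problem \<open>0 \<mapsto> 0, s \<mapsto> z, t \<mapsto> w\<close> for maps from the disc to the ball.\<close>

definition pick_det :: "real \<Rightarrow> real \<Rightarrow> complex \<Rightarrow> complex \<Rightarrow> complex \<Rightarrow> real" where
  "pick_det A B b s t = (nsq s - A) * (nsq t - B) * nsq (1 - s * cnj t)
     - nsq (s * cnj t - b) * ((1 - nsq s) * (1 - nsq t))"

abbreviation ball_det :: "complex ^ 'n \<Rightarrow> complex ^ 'n \<Rightarrow> complex \<Rightarrow> complex \<Rightarrow> real" where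
  "ball_det z w \<equiv> pick_det (nsq z) (nsq w) (cinner z w)"

abbreviation scalar_det :: "complex \<Rightarrow> complex \<Rightarrow> complex \<Rightarrow> complex \<Rightarrow> real" where
  "scalar_det l m \<equiv> pick_det (nsq l) (nsq m) (l * cnj m)"

lemma norm_one_minus_mult_cnj_commute: "norm (1 - s * cnj t) = norm (1 - t * cnj s)"
proof -
  have "cnj (1 - s * cnj t) = 1 - t * cnj s" by simp
  then show ?thesis by (metis complex_mod_cnj)
qed

lemma pick_det_kernel:
  assumes "norm s < 1" "norm t < 1"
  shows "pick_det A B b s t = nsq (1 - s * cnj t) *
     ((nsq s - A) * (nsq t - B) - disc_kernel s t * nsq (s * cnj t - b))"
proof -
  have gen: "x * K - e * g = K * (x - g / K * e)" if "K \<noteq> 0" for x K e g :: real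
    using that by (simp add: field_simps)
  show ?thesis unfolding pick_det_def disc_kernel_def
    by (rule gen) (use one_minus_cnj_mult_neq_0[of t s] assms in simp)
qed

lemma pick_det_nonneg_iff:
  assumes "norm s < 1" "norm t < 1"
  shows "0 \<le> pick_det A B b s t \<longleftrightarrow>
     disc_kernel s t * nsq (s * cnj t - b) \<le> (nsq s - A) * (nsq t - B)"
proof -
  have "nsq (1 - s * cnj t) > 0" using one_minus_cnj_mult_neq_0[of t s] assms by simp
  then show ?thesis unfolding pick_det_kernel[OF assms] by (simp add: zero_le_mult_iff)
qed

lemma pick_det_eq_0_iff:
  assumes "norm s < 1" "norm t < 1"
  shows "pick_det A B b s t = 0 \<longleftrightarrow>
     disc_kernel s t * nsq (s * cnj t - b) = (nsq s - A) * (nsq t - B)"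
proof -
  have "nsq (1 - s * cnj t) > 0" using one_minus_cnj_mult_neq_0[of t s] assms by simp
  then show ?thesis unfolding pick_det_kernel[OF assms] by auto
qed

lemma pick_scaling:
  fixes z w :: "complex ^ 'n"
  assumes "s \<noteq> 0" "t \<noteq> 0"
  shows "nsq s * nsq t * nsq (1 - cinner ((1/s) *s z) ((1/t) *s w)) = nsq (s * cnj t - cinner z w)"
    and "nsq s * (1 - nsq ((1/s) *s z)) = nsq s - nsq z"
proof -
  have "s * cnj t * (1 - cinner ((1/s) *s z) ((1/t) *s w)) = s * cnj t - cinner z w"
    using assms by (simp add: algebra_simps)
  then have "norm (s * cnj t) * norm (1 - cinner ((1/s) *s z) ((1/t) *s w)) = norm (s * cnj t - cinner z w)"
    by (metis norm_mult)
  then show "nsq s * nsq t * nsq (1 - cinner ((1/s) *s z) ((1/t) *s w)) = nsq (s * cnj t - cinner z w)"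
    by (metis complex_mod_cnj norm_mult power_mult_distrib)
  show "nsq s * (1 - nsq ((1/s) *s z)) = nsq s - nsq z"
    using assms by (simp add: norm_scale_complex norm_divide power_divide field_simps)
qed

text \<open>Multiplying the Schwarz-Pick inequality for the values of
  \<open>f \<zeta> / \<zeta>\<close> by |s|^2 |t|^2 expresses it through the values of
  \<open>f\<close> themselves.\<close>

lemma pick_scaling_le:
  fixes z w :: "complex ^ 'n"
  assumes "s \<noteq> 0" "t \<noteq> 0"
  shows "disc_kernel s t * nsq (1 - cinner ((1/s) *s z) ((1/t) *s w))
      \<le> (1 - nsq ((1/s) *s z)) * (1 - nsq ((1/t) *s w)) \<longleftrightarrow>
    disc_kernel s t * nsq (s * cnj t - cinner z w) \<le> (nsq s - nsq z) * (nsq t - nsq w)"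
    (is "?L \<le> ?R \<longleftrightarrow> _")
    and "disc_kernel s t * nsq (1 - cinner ((1/s) *s z) ((1/t) *s w))
      = (1 - nsq ((1/s) *s z)) * (1 - nsq ((1/t) *s w)) \<longleftrightarrow>
    disc_kernel s t * nsq (s * cnj t - cinner z w) = (nsq s - nsq z) * (nsq t - nsq w)"
proof -
  define c where "c = nsq s * nsq t"
  have c: "c > 0" using assms by (simp add: c_def)
  have 1: "disc_kernel s t * nsq (s * cnj t - cinner z w) = c * ?L"
    using pick_scaling(1)[OF assms, of z w] by (simp add: c_def)
  have 2: "(nsq s - nsq z) * (nsq t - nsq w) = c * ?R"
    unfolding pick_scaling(2)[OF assms, symmetric, of z] pick_scaling(2)[OF assms(2,1), symmetric, of w] c_def
    by (simp add: mult_ac)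
  show "?L \<le> ?R \<longleftrightarrow> disc_kernel s t * nsq (s * cnj t - cinner z w)
     \<le> (nsq s - nsq z) * (nsq t - nsq w)"
    unfolding 1 2 using c by simp
  show "?L = ?R \<longleftrightarrow> disc_kernel s t * nsq (s * cnj t - cinner z w)
     = (nsq s - nsq z) * (nsq t - nsq w)"
    unfolding 1 2 using c by simp
qed

lemma Schwarz_ball:
  fixes f :: "complex \<Rightarrow> complex ^ 'n"
  assumes "f holomorphic_curve_on unit_disc" "f ` unit_disc \<subseteq> cball 0 1" "f 0 = 0" "norm s < 1"
  shows "norm (f s) \<le> norm s"
proof -
  have "nsq (f s) \<le> nsq s"
    using Schwarz_Pick_ball[OF assms(1,2,4), of 0] assms(3) by (simp add: disc_kernel_def)
  then show ?thesis by (rule power2_le_imp_le) simp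
qed

lemma Schwarz_ball_quotient:
  fixes f :: "complex \<Rightarrow> complex ^ 'n"
  assumes f: "f holomorphic_curve_on unit_disc" "f ` unit_disc \<subseteq> cball 0 1" "f 0 = 0"
  obtains g where "g holomorphic_curve_on unit_disc" "g ` unit_disc \<subseteq> cball 0 1"
    "\<And>\<zeta>. norm \<zeta> < 1 \<Longrightarrow> f \<zeta> = \<zeta> *s g \<zeta>"
proof -
  have "\<exists>h. h holomorphic_on unit_disc \<and> (\<forall>\<zeta>. norm \<zeta> < 1 \<longrightarrow> f \<zeta> $ i = \<zeta> * h \<zeta>)" for i
  proof -
    have "(\<lambda>t. f t $ i) holomorphic_on ball 0 1" "f 0 $ i = 0"
      using f unfolding holomorphic_curve_on_def by auto
    then show ?thesis using Schwarz3[of "\<lambda>t. f t $ i" 1] by metis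
  qed
  then obtain h where h: "\<And>i. h i holomorphic_on unit_disc" "\<And>i \<zeta>. norm \<zeta> < 1 \<Longrightarrow> f \<zeta> $ i = \<zeta> * h i \<zeta>"
    by metis
  define g where "g \<zeta> = (\<chi> i. h i \<zeta>)" for \<zeta>
  have fg: "f \<zeta> = \<zeta> *s g \<zeta>" if "norm \<zeta> < 1" for \<zeta>
    using h(2)[OF that] by (simp add: g_def vec_eq_iff)
  have gc: "g holomorphic_curve_on unit_disc" using h(1) by (simp add: holomorphic_curve_on_def g_def)
  have g1: "norm (g \<zeta>) \<le> 1" if "norm \<zeta> < 1" "\<zeta> \<noteq> 0" for \<zeta>
    using Schwarz_ball[OF f that(1)] fg[OF that(1)] that(2) by (simp add: norm_scale_complex)
  \<comment> \<open>Division by \<zeta> bounds \<open>g\<close> only off the origin; the bound at 0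
    is the limit of these.\<close>
  have "norm (g 0) \<le> 1"
  proof (rule tendsto_upperbound[of "\<lambda>\<zeta>. norm (g \<zeta>)" _ "at 0"])
    have "((\<lambda>\<zeta>. h i \<zeta>) \<longlongrightarrow> h i 0) (at 0)" for i
      using holomorphic_on_imp_continuous_on[OF h(1)[of i]]
      by (simp add: continuous_on_eq_continuous_at isCont_def)
    then show "((\<lambda>\<zeta>. norm (g \<zeta>)) \<longlongrightarrow> norm (g 0)) (at 0)"
      unfolding g_def by (intro tendsto_norm vec_tendstoI) simp
    show "\<forall>\<^sub>F \<zeta> in at 0. norm (g \<zeta>) \<le> 1"
      using eventually_at_ball'[OF zero_less_one, of "0::complex" UNIV] by eventually_elim (simp add: g1)
  qed simp
  then have "g ` unit_disc \<subseteq> cball 0 1" using g1 by (force simp: image_subset_iff)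
  then show ?thesis using that[OF gc _ fg] by blast
qed

text \<open>This is the two-point Schwarz-Pick inequality for the quotient
  \<open>f \<zeta> / \<zeta>\<close>.\<close>

lemma three_point_necessary_ball:
  fixes f :: "complex \<Rightarrow> complex ^ 'n"
  assumes f: "f holomorphic_curve_on unit_disc" "f ` unit_disc \<subseteq> cball 0 1" "f 0 = 0"
    and s: "norm s < 1" "s \<noteq> 0" and t: "norm t < 1" "t \<noteq> 0"
  shows "0 \<le> ball_det (f s) (f t) s t"
proof -
  obtain g where g: "g holomorphic_curve_on unit_disc" "g ` unit_disc \<subseteq> cball 0 1"
    "\<And>\<zeta>. norm \<zeta> < 1 \<Longrightarrow> f \<zeta> = \<zeta> *s g \<zeta>" using Schwarz_ball_quotient[OF f] by blast
  have "g s = (1/s) *s f s" "g t = (1/t) *s f t" using g(3) s t by auto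
  then show ?thesis
    unfolding pick_det_nonneg_iff[OF s(1) t(1)]
    using Schwarz_Pick_ball[OF g(1,2) s(1) t(1)] pick_scaling_le(1)[OF s(2) t(2)] by metis
qed

lemma three_point_necessary_disc:
  assumes "h holomorphic_on unit_disc" "h ` unit_disc \<subseteq> cball 0 1" "h 0 = 0"
    and "norm s < 1" "s \<noteq> 0" "norm t < 1" "t \<noteq> 0"
  shows "0 \<le> scalar_det (h s) (h t) s t"
  using three_point_necessary_ball[of "\<lambda>t. vec (h t) :: complex ^ 1" s t] assms
  by (auto simp: holomorphic_curve_on_def image_subset_iff)

text \<open>Equality case of the Cauchy-Schwarz inequality: the squared norm of
  \<open>w - t *s a\<close> works out as |w|^2 - |t|^2.\<close>

lemma cinner_eq_imp_scale:
  assumes "cinner w a = t" "norm a = 1" "norm w \<le> norm t"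
  shows "w = t *s a"
proof -
  have 1: "cinner a w = cnj t" using assms(1) by (metis cnj_cinner)
  have "nsq (w - t *s a) = Re (cinner (w - t *s a) (w - t *s a))" by (rule norm_eq_cinner)
  also have "\<dots> = nsq w - nsq t"
    unfolding cinner_simps using assms(1,2) 1 by (simp add: cinner_self cmod_power2) (simp add: power2_eq_square)
  also have "\<dots> \<le> 0" using assms(3) by (simp add: power_mono)
  finally show ?thesis by simp
qed

text \<open>If both quotients \<open>z / s\<close> and \<open>w / t\<close> lie in the open ball, a
  two-point disc through them is multiplied by the variable. If one lies on the sphere, the right
  side of the inequality vanishes, which forces \<open>cinner z w = s * cnj t\<close> and puts both
  points on a linear disc.\<close>

lemma three_point_sufficient_ball:
  fixes z w :: "complex ^ 'n"
  assumes s: "norm s < 1" "s \<noteq> 0" and t: "norm t < 1" "t \<noteq> 0" and st: "s \<noteq> t"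
    and zw: "norm z \<le> norm s" "norm w \<le> norm t"
    and det: "0 \<le> ball_det z w s t"
  obtains f where "f holomorphic_curve_on unit_disc" "f ` unit_disc \<subseteq> ball 0 1" "f 0 = 0" "f s = z" "f t = w"
proof -
  note res = that
  have line: thesis if "norm a = 1" "z = s *s a" "w = t *s a" for a :: "complex ^ 'n"
    by (rule res[of "\<lambda>\<zeta>. \<zeta> *s a", rotated 4], use that in \<open>simp_all add: image_subset_iff norm_scale_complex\<close>)
       (auto simp: holomorphic_curve_on_def intro!: holomorphic_intros)
  have eq: "s * cnj t = cinner z w" if "norm z = norm s \<or> norm w = norm t"
  proof -
    have "disc_kernel s t * nsq (s * cnj t - cinner z w) \<le> 0"
      using det that unfolding pick_det_nonneg_iff[OF s(1) t(1)] by auto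
    then have "nsq (s * cnj t - cinner z w) \<le> 0"
      using disc_kernel_pos[OF s(1) t(1)] by (simp add: mult_le_0_iff)
    then show ?thesis by simp
  qed
  consider "norm z = norm s" | "norm w = norm t" | "norm z < norm s" "norm w < norm t" using zw by linarith
  then show ?thesis
  proof cases
    case 1
    define a where "a = (1/s) *s z"
    have a: "norm a = 1" "z = s *s a" using s 1 by (auto simp: a_def norm_scale_complex norm_divide)
    have "cnj (cinner z w) = cnj (s * cnj t)" using eq 1 by simp
    then have "cnj s * cinner w a = t * cnj s" unfolding cnj_cinner by (simp add: a(2))
    then have "cinner w a = t" using s by simp
    then show ?thesis using line[OF a] cinner_eq_imp_scale[OF _ a(1) zw(2)] by blast
  next
    case 2
    define a where "a = (1/t) *s w"
    have a: "norm a = 1" "w = t *s a" using t 2 by (auto simp: a_def norm_scale_complex norm_divide)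
    have "cinner z w = s * cnj t" using eq 2 by simp
    then have "cnj t * cinner z a = s * cnj t" by (simp add: a(2))
    then have "cinner z a = s" using t by simp
    then show ?thesis using line[OF a(1) _ a(2)] cinner_eq_imp_scale[OF _ a(1) zw(1)] by blast
  next
    case 3
    have "norm ((1/s) *s z) < 1" "norm ((1/t) *s w) < 1"
      using 3 s t by (auto simp: norm_scale_complex norm_divide)
    moreover have "disc_kernel s t * nsq (1 - cinner ((1/s) *s z) ((1/t) *s w))
      \<le> (1 - nsq ((1/s) *s z)) * (1 - nsq ((1/t) *s w))"
      using det unfolding pick_scaling_le(1)[OF s(2) t(2)] pick_det_nonneg_iff[OF s(1) t(1)] .
    ultimately obtain g where g: "g holomorphic_curve_on unit_disc" "g ` unit_disc \<subseteq> ball 0 1"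
      "g s = (1/s) *s z" "g t = (1/t) *s w"
      using two_point_Pick_ball[OF _ _ s(1) t(1) st, of "(1/s) *s z" "(1/t) *s w"] by metis
    show ?thesis
    proof (rule that[of "\<lambda>\<zeta>. \<zeta> *s g \<zeta>"])
      show "(\<lambda>\<zeta>. \<zeta> *s g \<zeta>) holomorphic_curve_on unit_disc"
        using g(1) by (auto simp: holomorphic_curve_on_def intro!: holomorphic_intros)
      show "(\<lambda>\<zeta>. \<zeta> *s g \<zeta>) ` unit_disc \<subseteq> ball 0 1"
      proof
        fix y assume "y \<in> (\<lambda>\<zeta>. \<zeta> *s g \<zeta>) ` unit_disc"
        then obtain \<zeta> where \<zeta>: "norm \<zeta> < 1" "y = \<zeta> *s g \<zeta>" by auto
        then have "norm (g \<zeta>) < 1" using g(2) by (auto simp: image_subset_iff)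
        then have "norm \<zeta> * norm (g \<zeta>) \<le> norm \<zeta>" by (simp add: mult_left_le)
        then show "y \<in> ball 0 1" using \<zeta> by (simp add: norm_scale_complex)
      qed
    qed (use g s t in auto)
  qed
qed

lemma three_point_sufficient_disc:
  assumes s: "norm s < 1" "s \<noteq> 0" and t: "norm t < 1" "t \<noteq> 0" and st: "s \<noteq> t"
    and lm: "norm l \<le> norm s" "norm m \<le> norm t"
    and det: "0 \<le> scalar_det l m s t"
  obtains h where "h holomorphic_on unit_disc" "h ` unit_disc \<subseteq> ball 0 1" "h 0 = 0" "h s = l" "h t = m"
proof -
  obtain f :: "complex \<Rightarrow> complex ^ 1" where f: "f holomorphic_curve_on unit_disc" "f ` unit_disc \<subseteq> ball 0 1"
     "f 0 = 0" "f s = vec l" "f t = vec m"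
    using three_point_sufficient_ball[OF s t st, of "vec l :: complex ^ 1" "vec m"] lm det by auto
  show ?thesis
  proof (rule that[of "\<lambda>t. f t $ 1"])
    show "(\<lambda>t. f t $ 1) ` unit_disc \<subseteq> ball 0 1"
      using f(2) by (auto simp: image_subset_iff norm_vec_def L2_set_def)
  qed (use f in \<open>auto simp: holomorphic_curve_on_def\<close>)
qed

lemma three_point_equality_disc:
  assumes s: "norm s < 1" "s \<noteq> 0" and t: "norm t < 1" "t \<noteq> 0" and st: "s \<noteq> t"
    and lm: "norm l < norm s" "norm m < norm t"
    and det: "scalar_det l m s t = 0"
  obtains v \<beta> where "norm v = 1" "norm \<beta> < 1" "l = s * (v * mob \<beta> s)" "m = t * (v * mob \<beta> t)"
proof -
  have "norm (l / s) < 1" "norm (m / t) < 1" using lm s t by (auto simp: norm_divide)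
  moreover have "disc_kernel s t * nsq (1 - (l / s) * cnj (m / t)) = (1 - nsq (l/s)) * (1 - nsq (m/t))"
  proof -
    have e: "(1/c) *s (vec x :: complex ^ 1) = vec (x / c)" for c x by (simp add: vec_eq_iff)
    show ?thesis
      using det pick_scaling_le(2)[OF s(2) t(2), of "vec l :: complex ^ 1" "vec m"]
      unfolding pick_det_eq_0_iff[OF s(1) t(1)] e by simp
  qed
  ultimately obtain v \<beta> where "norm v = 1" "norm \<beta> < 1" "l / s = v * mob \<beta> s" "m / t = v * mob \<beta> t"
    using two_point_Pick_equality[OF _ _ s(1) t(1) st] by metis
  then show ?thesis using that[of v \<beta>] s t by (simp add: field_simps)
qed

text \<open>The complex line through the quotients \<open>z / s\<close> and \<open>w / t\<close>
  cuts the ball in a disc of radius \<open>q\<close> around the point of the line nearest to 0, at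
  distance \<open>p\<close> from it. In this disc the equality case of the scalar problem applies.
  Linear independence of \<open>z\<close> and \<open>w\<close> keeps the line away from 0, so
  \<open>p > 0\<close>.\<close>

lemma three_point_equality_ball:
  fixes z w :: "complex ^ 'n" and s t :: complex
  assumes s: "norm s < 1" "s \<noteq> 0" and t: "norm t < 1" "t \<noteq> 0" and st: "s \<noteq> t"
    and zw: "norm z < norm s" "norm w < norm t"
    and det: "ball_det z w s t = 0"
    and nc: "norm (cinner z w) < norm z * norm w"
  obtains p q :: real and \<alpha> e1 e2 where "0 < p" "0 < q" "p\<^sup>2 + q\<^sup>2 = 1" "norm \<alpha> < 1"
    "cinner e1 e1 = 1" "cinner e2 e2 = 1" "cinner e1 e2 = 0"
    "z = (s * p) *s e1 + (s * (q * mob \<alpha> s)) *s e2" "w = (t * p) *s e1 + (t * (q * mob \<alpha> t)) *s e2"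
proof -
  define a b where "a = (1/s) *s z" and "b = (1/t) *s w"
  have za: "z = s *s a" and wb: "w = t *s b" using s t by (auto simp: a_def b_def)
  have ab1: "norm a < 1" "norm b < 1" using zw s t by (auto simp: a_def b_def norm_scale_complex norm_divide)
  have keq: "disc_kernel s t * nsq (1 - cinner a b) = (1 - nsq a) * (1 - nsq b)"
    using det pick_scaling_le(2)[OF s(2) t(2), of z w] unfolding pick_det_eq_0_iff[OF s(1) t(1)] a_def b_def by simp
  have indep: False if "a = x *s e" "b = y *s e" for x y :: complex and e
  proof -
    have "norm (cinner z w) = norm z * norm w"
      by (simp add: za wb that norm_mult norm_scale_complex cinner_self power2_eq_square)
    then show False using nc by simp
  qed
  define d where "d = a - b"
  have d0: "d \<noteq> 0" using indep[of 1 a 1] by (auto simp: d_def)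
  define e where "e = (1 / of_real (norm d)) *s d"
  have ee: "cinner e e = 1" using d0 unfolding cinner_self by (simp add: e_def norm_scale_complex norm_divide)
  have de: "cinner d e *s e = d" using d0 by (simp add: e_def cinner_self power2_eq_square vec_eq_iff)
  define A B where "A = cinner a e" and "B = cinner b e"
  \<comment> \<open>The foot of the perpendicular from 0 to the line; \<open>a\<close> and
    \<open>b\<close> share it because their difference is a multiple of \<open>e\<close>.\<close>
  define c0 where "c0 = a - A *s e"
  have "b = a - cinner d e *s e" unfolding de by (simp add: d_def)
  moreover have "cinner d e = A - B" by (simp add: d_def A_def B_def)
  ultimately have bc: "b = c0 + B *s e" by (simp add: c0_def vec_eq_iff algebra_simps)
  have ac: "a = c0 + A *s e" by (simp add: c0_def)
  have c0e: "cinner c0 e = 0" "cinner e c0 = 0"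
  proof -
    show "cinner c0 e = 0" by (simp add: c0_def A_def ee)
    then show "cinner e c0 = 0" by (metis cnj_cinner complex_cnj_zero)
  qed
  define p where "p = norm c0"
  have c0c0: "cinner c0 c0 = of_real (p\<^sup>2)" by (simp add: p_def cinner_self)
  have p0: "p > 0" using indep[of A e B] ac bc by (auto simp: p_def)
  have cab: "cinner a b = of_real (p\<^sup>2) + A * cnj B"
    unfolding ac bc by (simp add: c0e ee c0c0)
  have na: "nsq a = p\<^sup>2 + nsq A"
  proof -
    have "cinner a a = of_real (p\<^sup>2 + nsq A)"
      unfolding of_real_add complex_norm_square unfolding ac by (simp add: c0e ee c0c0)
    then show ?thesis unfolding cinner_self by (simp only: of_real_eq_iff)
  qed
  have nb: "nsq b = p\<^sup>2 + nsq B"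
  proof -
    have "cinner b b = of_real (p\<^sup>2 + nsq B)"
      unfolding of_real_add complex_norm_square unfolding bc by (simp add: c0e ee c0c0)
    then show ?thesis unfolding cinner_self by (simp only: of_real_eq_iff)
  qed
  have p1: "p\<^sup>2 < 1" using na ab1(1) by (smt (verit) norm_sq_less_1_iff zero_le_power2)
  define q where "q = sqrt (1 - p\<^sup>2)"
  have q: "q > 0" "q\<^sup>2 = 1 - p\<^sup>2" using p1 by (auto simp: q_def)
  have A': "1 - nsq (A / q) = (1 - nsq a) / q\<^sup>2" "1 - nsq (B / q) = (1 - nsq b) / q\<^sup>2"
    using q by (auto simp: norm_divide power_divide na nb field_simps)
  have AB: "1 - A / q * cnj (B / q) = (1 - cinner a b) / of_real (q\<^sup>2)"
    using q(1) unfolding cab by (simp add: field_simps power2_eq_square) (simp add: q(2)[unfolded power2_eq_square] flip: of_real_mult)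
  have "(1 - nsq a) / q\<^sup>2 > 0" "(1 - nsq b) / q\<^sup>2 > 0" using ab1 q(1) by auto
  then have n1: "norm (A / q) < 1" "norm (B / q) < 1" unfolding A'[symmetric] by auto
  have "disc_kernel s t * nsq (1 - A / q * cnj (B / q)) = (1 - nsq (A/q)) * (1 - nsq (B/q))"
  proof -
    have "norm (1 - A / q * cnj (B / q)) = norm (1 - cinner a b) / q\<^sup>2"
      unfolding AB norm_divide norm_of_real by simp
    then have "disc_kernel s t * nsq (1 - A / q * cnj (B / q))
       = disc_kernel s t * nsq (1 - cinner a b) / (q\<^sup>2)\<^sup>2" by (simp add: power_divide)
    then show ?thesis unfolding A' keq by (simp add: power2_eq_square)
  qed
  then obtain u \<alpha> where u: "norm u = 1" "norm \<alpha> < 1" "A / q = u * mob \<alpha> s" "B / q = u * mob \<alpha> t"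
    using two_point_Pick_equality[OF n1 s(1) t(1) st] by blast
  have uu: "u * cnj u = 1" using complex_norm_square[of u] u(1) by simp
  define e1 where "e1 = (1 / of_real p) *s c0"
  \<comment> \<open>The rotation from the scalar equality case is absorbed into the second basis
    vector.\<close>
  define e2 where "e2 = u *s e"
  have AB2: "A = q * mob \<alpha> s * u" "B = q * mob \<alpha> t * u" using u(3,4) q(1) by (auto simp: field_simps)
  show ?thesis
  proof (rule that[OF p0 q(1) _ u(2), of e1 e2])
    show "p\<^sup>2 + q\<^sup>2 = 1" using q by simp
    show "cinner e1 e1 = 1" using p0 unfolding cinner_self by (simp add: e1_def norm_scale_complex norm_divide p_def)
    show "cinner e2 e2 = 1" using uu by (simp add: e2_def ee mult.commute)
    show "cinner e1 e2 = 0" by (simp add: e1_def e2_def c0e)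
    have "c0 = of_real p *s e1" using p0 by (simp add: e1_def)
    then show "z = (s * p) *s e1 + (s * (q * mob \<alpha> s)) *s e2" "w = (t * p) *s e1 + (t * (q * mob \<alpha> t)) *s e2"
      unfolding za wb ac bc e2_def by (simp_all add: AB2 vec_eq_iff algebra_simps)
  qed
qed

section \<open>First-order condition at touching points\<close>

text \<open>The Wirtinger derivative of \<open>pick_det\<close> in \<open>s\<close>, with the
  conjugates held fixed; the one in \<open>t\<close> arises by exchanging the two points and
  conjugating \<open>b\<close>. \<open>A\<close> and \<open>B\<close> are complex here so that
  values of \<open>disc_gram\<close> can be substituted.\<close>

definition pick_det_deriv :: "complex \<Rightarrow> complex \<Rightarrow> complex \<Rightarrow> complex \<Rightarrow> complex \<Rightarrow> complex" where
  "pick_det_deriv A B b s t =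
     cnj s * (t * cnj t - B) * (1 - s * cnj t) * (1 - cnj s * t)
     - (s * cnj s - A) * (t * cnj t - B) * cnj t * (1 - cnj s * t)
     - cnj t * (cnj s * t - cnj b) * (1 - s * cnj s) * (1 - t * cnj t)
     + cnj s * (s * cnj t - b) * (cnj s * t - cnj b) * (1 - t * cnj t)"

lemma pick_det_has_real_derivative:
  "((\<lambda>\<epsilon>. pick_det A B b (s + of_real \<epsilon> * \<sigma>) (t + of_real \<epsilon> * \<tau>)) has_real_derivative
     2 * Re (pick_det_deriv A B b s t * \<sigma> + pick_det_deriv B A (cnj b) t s * \<tau>)) (at 0)"
proof -
  \<comment> \<open>The two parameters and their conjugates become four affine functions of a
    complex \<epsilon>, which agree with the original expressions for real \<epsilon>; the rules of
    complex differentiation then apply to their polynomial \<open>g\<close>.\<close>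
  define s1 where "s1 \<epsilon> = s + \<epsilon> * \<sigma>" for \<epsilon>
  define s2 where "s2 \<epsilon> = cnj s + \<epsilon> * cnj \<sigma>" for \<epsilon>
  define t1 where "t1 \<epsilon> = t + \<epsilon> * \<tau>" for \<epsilon>
  define t2 where "t2 \<epsilon> = cnj t + \<epsilon> * cnj \<tau>" for \<epsilon>
  define g where "g \<epsilon> = (s1 \<epsilon> * s2 \<epsilon> - of_real A) * (t1 \<epsilon> * t2 \<epsilon> - of_real B) * ((1 - s1 \<epsilon> * t2 \<epsilon>) * (1 - s2 \<epsilon> * t1 \<epsilon>))
     - (s1 \<epsilon> * t2 \<epsilon> - b) * (s2 \<epsilon> * t1 \<epsilon> - cnj b) * ((1 - s1 \<epsilon> * s2 \<epsilon>) * (1 - t1 \<epsilon> * t2 \<epsilon>))" for \<epsilon>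
  define X where "X = pick_det_deriv A B b s t * \<sigma> + pick_det_deriv B A (cnj b) t s * \<tau>"
  have real: "complex_of_real (pick_det A B b (s + of_real \<epsilon> * \<sigma>) (t + of_real \<epsilon> * \<tau>)) = g (of_real \<epsilon>)" for \<epsilon>
    unfolding pick_det_def of_real_diff of_real_mult complex_norm_square g_def s1_def s2_def t1_def t2_def by simp
  have d: "(s1 has_field_derivative \<sigma>) (at 0)" "(s2 has_field_derivative cnj \<sigma>) (at 0)"
    "(t1 has_field_derivative \<tau>) (at 0)" "(t2 has_field_derivative cnj \<tau>) (at 0)"
    unfolding s1_def s2_def t1_def t2_def by (auto intro!: derivative_eq_intros)
  have v: "s1 0 = s" "s2 0 = cnj s" "t1 0 = t" "t2 0 = cnj t"
    by (simp_all add: s1_def s2_def t1_def t2_def)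
  have "(g has_field_derivative X + cnj X) (at 0)"
    unfolding g_def
    by (rule derivative_eq_intros d refl | simp)+
      (simp add: v X_def pick_det_deriv_def algebra_simps)
  then have "((\<lambda>\<epsilon>. g (of_real \<epsilon>)) has_vector_derivative (X + cnj X)) (at (0::real))"
    by (intro has_vector_derivative_real_field) simp
  then have "((\<lambda>\<epsilon>. Re (g (of_real \<epsilon>))) has_vector_derivative Re (X + cnj X)) (at 0)"
    by (rule bounded_linear.has_vector_derivative[OF bounded_linear_Re])
  then show ?thesis
    unfolding has_real_derivative_iff_has_vector_derivative real[symmetric] X_def[symmetric] by simp
qed

text \<open>The hypotheses hold for the Gram values of a disc \<zeta> (p, q mob \<alpha> \<zeta>)
  with \<open>Q = q\<^sup>2 * (1 - nsq \<alpha>)\<close>. All four summands then share the factor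
  \<open>K\<close>, and what remains splits off a quadratic polynomial in \<open>s\<close>, the only
  place where the shape of the disc is still visible apart from a real factor.\<close>

lemma pick_det_deriv_factor:
  fixes Q :: real and A B b s t \<alpha> :: complex
  assumes n: "1 - cnj \<alpha> * s \<noteq> 0" "1 - cnj \<alpha> * t \<noteq> 0"
    and A: "s * cnj s - A = s * cnj s * Q * (1 - s * cnj s) / ((1 - cnj \<alpha> * s) * (1 - \<alpha> * cnj s))"
    and B: "t * cnj t - B = t * cnj t * Q * (1 - t * cnj t) / ((1 - cnj \<alpha> * t) * (1 - \<alpha> * cnj t))"
    and b: "s * cnj t - b = s * cnj t * Q * (1 - s * cnj t) / ((1 - cnj \<alpha> * s) * (1 - \<alpha> * cnj t))"
  shows "pick_det_deriv A B b s t = Q / of_real (nsq (1 - cnj \<alpha> * s) * nsq (1 - cnj \<alpha> * t)) *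
      (cnj s * (t * cnj t) * (1 - t * cnj t) * (1 - cnj s * t) * (cnj s - cnj t)) *
      ((s - \<alpha>) * (1 - cnj \<alpha> * s) + Q * s)"
proof -
  define a1 a2 b1 b2 where "a1 = 1 - cnj \<alpha> * s" and "a2 = 1 - \<alpha> * cnj s" and
    "b1 = 1 - cnj \<alpha> * t" and "b2 = 1 - \<alpha> * cnj t"
  have cn: "cnj a1 = a2" "cnj b1 = b2" by (simp_all add: a1_def a2_def b1_def b2_def)
  have nz: "a1 \<noteq> 0" "b1 \<noteq> 0" "a2 \<noteq> 0" "b2 \<noteq> 0"
    using n cn by (auto simp flip: a1_def b1_def cn)
  have b': "cnj s * t - cnj b = cnj s * t * Q * (1 - cnj s * t) / (a2 * b1)"
  proof -
    have "cnj (s * cnj t - b) = cnj (s * cnj t * Q * (1 - s * cnj t) / ((1 - cnj \<alpha> * s) * (1 - \<alpha> * cnj t)))"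
      using b by simp
    then show ?thesis by (simp add: a2_def b1_def)
  qed
  define K where "K = Q * cnj s * (t * cnj t) * (1 - t * cnj t) * (1 - cnj s * t) / (b1 * b2)"
  have t1: "cnj s * (t * cnj t - B) * (1 - s * cnj t) * (1 - cnj s * t) = K * (1 - s * cnj t)"
    unfolding B K_def b1_def b2_def by simp
  have t2: "(s * cnj s - A) * (t * cnj t - B) * cnj t * (1 - cnj s * t) = K * (s * cnj t * Q * (1 - s * cnj s) / (a1 * a2))"
    unfolding A B K_def a1_def a2_def b1_def b2_def by (simp add: mult_ac)
  have t3: "cnj t * (cnj s * t - cnj b) * (1 - s * cnj s) * (1 - t * cnj t) = K * ((1 - s * cnj s) * b2 / a2)"
    unfolding b' K_def using nz by (simp add: field_simps)
  have t4: "cnj s * (s * cnj t - b) * (cnj s * t - cnj b) * (1 - t * cnj t) = K * (s * cnj s * Q * (1 - s * cnj t) / (a1 * a2))"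
    unfolding b' b K_def a1_def[symmetric] b2_def[symmetric] by (simp add: mult_ac)
  have br: "(1 - s * cnj t) - s * cnj t * Q * (1 - s * cnj s) / (a1 * a2) - (1 - s * cnj s) * b2 / a2
      + s * cnj s * Q * (1 - s * cnj t) / (a1 * a2) = (cnj s - cnj t) * ((s - \<alpha>) * a1 + Q * s) / (a1 * a2)"
  proof -
    have "(1 - s * cnj t) * (a1 * a2) - s * cnj t * Q * (1 - s * cnj s) - (1 - s * cnj s) * b2 * a1
      + s * cnj s * Q * (1 - s * cnj t) = (cnj s - cnj t) * ((s - \<alpha>) * a1 + Q * s)"
      unfolding a1_def a2_def b2_def by (simp add: algebra_simps)
    moreover have "(1 - s * cnj s) * b2 / a2 = (1 - s * cnj s) * b2 * a1 / (a1 * a2)" using nz by simp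
    moreover have "1 - s * cnj t = (1 - s * cnj t) * (a1 * a2) / (a1 * a2)" using nz by simp
    ultimately show ?thesis by (metis (no_types) add_divide_distrib diff_divide_distrib)
  qed
  have "pick_det_deriv A B b s t = K * ((1 - s * cnj t) - s * cnj t * Q * (1 - s * cnj s) / (a1 * a2)
     - (1 - s * cnj s) * b2 / a2 + s * cnj s * Q * (1 - s * cnj t) / (a1 * a2))"
    unfolding pick_det_deriv_def t1 t2 t3 t4 by (simp only: right_diff_distrib distrib_left)
  moreover have N: "complex_of_real (nsq (1 - cnj \<alpha> * s) * nsq (1 - cnj \<alpha> * t)) = a1 * a2 * (b1 * b2)"
    unfolding of_real_mult complex_norm_square a1_def[symmetric] b1_def[symmetric] cn ..
  ultimately show ?thesis
    unfolding br K_def N a1_def[symmetric] by (simp add: mult_ac)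
qed

text \<open>Let \<open>v'\<close> be the part of \<open>v\<close> orthogonal to \<open>u\<close>.
  The direction \<open>\<eta> *\<^sub>R u - v'\<close> is admissible for every \<eta> > 0 and bounds
  |v'|^2 by a multiple of \<eta>, so \<open>v' = 0\<close>.\<close>

lemma Lagrange_multiplier:
  fixes u v :: "'a :: real_inner"
  assumes "u \<noteq> 0" "\<And>x. inner u x > 0 \<Longrightarrow> inner v x \<ge> 0"
  shows "\<exists>k. v = k *\<^sub>R u"
proof -
  define k where "k = inner u v / inner u u"
  define v' where "v' = v - k *\<^sub>R u"
  have uu: "inner u u > 0" using assms(1) by simp
  have ort: "inner u v' = 0" using uu by (simp add: v'_def k_def inner_diff_right)
  have vv: "inner v v' = inner v' v'"
    using ort by (simp add: v'_def inner_diff_left inner_diff_right inner_commute)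
  have "inner v' v' \<le> \<eta> * inner u v" if "\<eta> > 0" for \<eta>
  proof -
    have "inner u (\<eta> *\<^sub>R u - v') > 0" using ort uu that by (simp add: inner_diff_right)
    from assms(2)[OF this] show ?thesis using vv by (simp add: inner_diff_right inner_commute)
  qed
  then have "inner v' v' \<le> 0"
    by (intro tendsto_lowerbound[of "\<lambda>\<eta>. \<eta> * inner u v" 0 "at_right 0"] eventually_at_rightI[of 0 1])
      (auto intro!: tendsto_eq_intros)
  then have "v' = 0" by (metis inner_eq_zero_iff inner_ge_zero order_antisym)
  then show ?thesis by (auto simp: v'_def)
qed

text \<open>When such a quadratic has \<open>C \<noteq> 0\<close>, the product of its zeros has
  modulus 1, so two distinct zeros in the open disc are possible only if all coefficients
  vanish.\<close>

lemma self_reciprocal_roots: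
  fixes C s t :: complex and D :: real
  assumes "norm s < 1" "norm t < 1" "s \<noteq> t" "s \<noteq> 0"
    and s: "2 * D * s - cnj C * s\<^sup>2 - C = 0" and t: "2 * D * t - cnj C * t\<^sup>2 - C = 0"
  shows "C = 0 \<and> D = 0"
proof -
  have "(s - t) * (2 * D - cnj C * (s + t)) = (2 * D * s - cnj C * s\<^sup>2 - C) - (2 * D * t - cnj C * t\<^sup>2 - C)"
    by (simp add: algebra_simps power2_eq_square)
  then have "2 * D = cnj C * (s + t)" unfolding s t using \<open>s \<noteq> t\<close> by simp
  then have "C = cnj C * (s * t)" using s by (simp add: algebra_simps power2_eq_square)
  then have "norm C = norm C * (norm s * norm t)" by (metis complex_mod_cnj norm_mult)
  moreover have "norm s * norm t < 1" using assms(1,2)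
    by (metis mult.commute mult_left_le_one_le norm_ge_zero order_le_less_trans less_imp_le)
  ultimately have "C = 0" by auto
  then show ?thesis using s \<open>s \<noteq> 0\<close> by simp
qed

section \<open>An extremal function on the ball\<close>

lemma orthonormal_Bessel:
  assumes "cinner e1 e1 = 1" "cinner e2 e2 = 1" "cinner e1 e2 = 0"
  shows "nsq (cinner x e1) + nsq (cinner x e2) \<le> nsq x"
proof -
  define y where "y = x - cinner x e1 *s e1 - cinner x e2 *s e2"
  have e21: "cinner e2 e1 = 0" using assms(3) by (metis cnj_cinner complex_cnj_zero)
  have c: "cinner e1 x = cnj (cinner x e1)" "cinner e2 x = cnj (cinner x e2)" by (simp_all add: cnj_cinner)
  have "cinner y y = cinner x x - cinner x e1 * cnj (cinner x e1) - cinner x e2 * cnj (cinner x e2)"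
    unfolding y_def cinner_simps assms e21 c by (simp add: algebra_simps)
  then have "complex_of_real (nsq y) =
      of_real (nsq x - nsq (cinner x e1) - nsq (cinner x e2))"
    unfolding cinner_self complex_norm_square[symmetric] of_real_diff .
  then have "nsq y = nsq x - nsq (cinner x e1) - nsq (cinner x e2)"
    by (simp only: of_real_eq_iff)
  then show ?thesis by (smt (verit) zero_le_power2)
qed

text \<open>The expansion of the quadratic form defining the projective change of coordinates below,
  with reality expressed by conjugation equations. Terms are grouped so that in the application each
  mixed coefficient is one real expression that vanishes.\<close>

lemma Hermitian_form_expansion:
  fixes w x1 x2 p q h c r :: complex
  assumes "cnj p = p" "cnj q = q" "cnj h = h" "cnj c = c" "cnj r = r"
  shows "(1 - p * cnj w * x1 + q * h * (cnj w)\<^sup>2 * x2) * cnj (1 - p * cnj w * x1 + q * h * (cnj w)\<^sup>2 * x2)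
     - (1 - h) * ((- w + c * x1 + q * cnj w * x2) * cnj (- w + c * x1 + q * cnj w * x2))
     - h * ((w\<^sup>2 - p * w * x1 + r * x2) * cnj (w\<^sup>2 - p * w * x1 + r * x2)) =
     1 - (1 - h) * (w * cnj w) - h * (w * cnj w)\<^sup>2
     + x1 * cnj w * ((1 - h) * c - p + h * p * (w * cnj w)) + cnj x1 * w * ((1 - h) * c - p + h * p * (w * cnj w))
     + x2 * (cnj w)\<^sup>2 * (q * h + (1 - h) * q - h * r) + cnj x2 * w\<^sup>2 * (q * h + (1 - h) * q - h * r)
     + x1 * cnj x2 * w * (p * (h * r) - (1 - h) * c * q - h * p * q * (w * cnj w))
     + cnj x1 * x2 * cnj w * (p * (h * r) - (1 - h) * c * q - h * p * q * (w * cnj w))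
     + x1 * cnj x1 * (p\<^sup>2 * (w * cnj w) * (1 - h) - (1 - h) * c * c)
     + x2 * cnj x2 * (q\<^sup>2 * h\<^sup>2 * (w * cnj w)\<^sup>2 - (1 - h) * q\<^sup>2 * (w * cnj w) - h * r * r)"
  by (simp add: assms algebra_simps power2_eq_square)

text \<open>A ball automorphism (in homogeneous coordinates \<open>l\<^sub>0, \<surd>(1-h) l\<^sub>1, \<surd>h l\<^sub>2\<close>) moves the disc
  \<open>\<zeta> \<mapsto> \<zeta> (p, q mob \<alpha> \<zeta>)\<close> to \<open>\<xi> \<mapsto> (\<surd>(1-h) \<xi>, \<surd>h \<xi>\<^sup>2)\<close> with \<open>\<xi> = mob \<omega> \<zeta>\<close>, on which the function
  \<open>(x\<^sub>1\<^sup>2 + 2 \<surd>h x\<^sub>2) / (1 + h)\<close>, bounded by 1 on the ball, equals \<open>\<xi>\<^sup>2\<close>.\<close>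

lemma left_inverse_of_degree_2:
  fixes e1 e2 :: "complex ^ 'n" and p q h \<omega>s :: real and \<omega> \<alpha> \<beta> :: complex
  assumes h: "0 < h" "h < 1" and \<omega>: "norm \<omega> < 1" and o_def': "\<omega>s = nsq \<omega>"
    and R1: "q\<^sup>2 * (1 - h\<^sup>2 * \<omega>s) = h * (1 - \<omega>s)" and R2: "p\<^sup>2 * (1 - h\<^sup>2 * \<omega>s) = (1 - h) * (1 + h * \<omega>s)"
    and \<alpha>: "\<alpha> * (1 + h * \<omega>s) = \<omega> * (1 + h)" "norm \<alpha> < 1" and \<beta>: "\<beta> * (1 + \<omega>s) = 2 * \<omega>" 
    and e: "cinner e1 e1 = 1" "cinner e2 e2 = 1" "cinner e1 e2 = 0"
  obtains F where "F holomorphic_fun_on unit_ball" "F ` unit_ball \<subseteq> cball 0 1"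
    "\<And>\<zeta> :: complex. norm \<zeta> < 1 \<Longrightarrow> (\<zeta> * p) *s e1 + (\<zeta> * (q * mob \<alpha> \<zeta>)) *s e2 \<in> unit_ball \<Longrightarrow>
        F ((\<zeta> * p) *s e1 + (\<zeta> * (q * mob \<alpha> \<zeta>)) *s e2) = \<zeta> * mob \<beta> \<zeta>"
proof -
  define l0 where "l0 x1 x2 = 1 - p * cnj \<omega> * x1 + q * h * (cnj \<omega>)\<^sup>2 * x2" for x1 x2 :: complex
  define l1 where "l1 x1 x2 = - \<omega> + p * (1 - h * \<omega>s) / (1 - h) * x1 + q * cnj \<omega> * x2" for x1 x2 :: complex
  define l2 where "l2 x1 x2 = \<omega>\<^sup>2 - p * \<omega> * x1 + q / h * x2" for x1 x2 :: complex
  have os: "complex_of_real \<omega>s = \<omega> * cnj \<omega>" using complex_norm_square[of \<omega>] o_def' by simp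
  have o01: "0 \<le> \<omega>s" "\<omega>s < 1" using \<omega> o_def' by auto
  have ho: "1 + h * \<omega>s > 0" "1 - h\<^sup>2 * \<omega>s > 0"
  proof -
    show "1 + h * \<omega>s > 0" using h o01 by (simp add: add_pos_nonneg)
    have "h\<^sup>2 * \<omega>s \<le> 1 * \<omega>s" using h o01 by (intro mult_right_mono) (auto simp: power_le_one)
    then show "1 - h\<^sup>2 * \<omega>s > 0" using o01 by simp
  qed
  \<comment> \<open>The linear forms preserve the ball form up to a positive factor, so they
    describe an automorphism in homogeneous coordinates. The mixed coefficients cancel by the choice
    of \<open>l1\<close> and \<open>l2\<close>; \<open>R1\<close> and \<open>R2\<close> provide the
    diagonal ones.\<close>
  have form: "nsq (l0 x1 x2) - (1 - h) * nsq (l1 x1 x2) - h * nsq (l2 x1 x2)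
     = (1 - \<omega>s) * (1 + h * \<omega>s) * (1 - nsq x1 - nsq x2)" for x1 x2
  proof -
    define c r where "c = p * (1 - h * \<omega>s) / (1 - h)" and "r = q / h"
    have f1: "(1 - h) * c = p * (1 - h * \<omega>s)" and f2: "h * r = q" using h by (simp_all add: c_def r_def)
    have f3: "p\<^sup>2 * \<omega>s * (1 - h) - (1 - h) * c * c = - ((1 - \<omega>s) * (1 + h * \<omega>s))"
    proof -
      have "(1 - h) * (p\<^sup>2 * \<omega>s * (1 - h) - (1 - h) * c * c) = p\<^sup>2 * \<omega>s * (1 - h)\<^sup>2 - ((1 - h) * c)\<^sup>2"
        by (simp add: algebra_simps power2_eq_square)
      also have "\<dots> = - ((1 - \<omega>s) * (p\<^sup>2 * (1 - h\<^sup>2 * \<omega>s)))"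
        unfolding f1 by (simp add: algebra_simps power2_eq_square)
      also have "\<dots> = (1 - h) * (- ((1 - \<omega>s) * (1 + h * \<omega>s)))" unfolding R2 by (simp add: algebra_simps)
      finally show ?thesis using h by (simp only: mult_cancel_left) simp
    qed
    have f4: "q\<^sup>2 * h\<^sup>2 * \<omega>s\<^sup>2 - (1 - h) * q\<^sup>2 * \<omega>s - h * r * r = - ((1 - \<omega>s) * (1 + h * \<omega>s))"
    proof -
      have "h * (q\<^sup>2 * h\<^sup>2 * \<omega>s\<^sup>2 - (1 - h) * q\<^sup>2 * \<omega>s - h * r * r) = h * q\<^sup>2 * h\<^sup>2 * \<omega>s\<^sup>2 - h * (1 - h) * q\<^sup>2 * \<omega>s - (h * r)\<^sup>2"
        by (simp add: algebra_simps power2_eq_square)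
      also have "\<dots> = - ((1 + h * \<omega>s) * (q\<^sup>2 * (1 - h\<^sup>2 * \<omega>s)))"
        unfolding f2 by (simp add: algebra_simps power2_eq_square)
      also have "\<dots> = h * (- ((1 - \<omega>s) * (1 + h * \<omega>s)))" unfolding R1 by (simp add: algebra_simps)
      finally show ?thesis using h by (simp only: mult_cancel_left) simp
    qed
    have g: "(1 - h) * c - p + h * p * \<omega>s = 0" "q * h + (1 - h) * q - h * r = 0"
      "p * (h * r) - (1 - h) * c * q - h * p * q * \<omega>s = 0"
      unfolding f1 f2 by (simp_all add: algebra_simps)
    have l: "l0 x1 x2 = 1 - of_real p * cnj \<omega> * x1 + of_real q * of_real h * (cnj \<omega>)\<^sup>2 * x2"
      "l1 x1 x2 = - \<omega> + of_real c * x1 + of_real q * cnj \<omega> * x2"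
      "l2 x1 x2 = \<omega>\<^sup>2 - of_real p * \<omega> * x1 + of_real r * x2"
      unfolding l0_def l1_def l2_def c_def r_def by simp_all
    have "complex_of_real (nsq (l0 x1 x2) - (1 - h) * nsq (l1 x1 x2) - h * nsq (l2 x1 x2))
       = of_real (1 - (1 - h) * \<omega>s - h * \<omega>s\<^sup>2)
       + x1 * cnj \<omega> * of_real ((1 - h) * c - p + h * p * \<omega>s) + cnj x1 * \<omega> * of_real ((1 - h) * c - p + h * p * \<omega>s)
       + x2 * (cnj \<omega>)\<^sup>2 * of_real (q * h + (1 - h) * q - h * r) + cnj x2 * \<omega>\<^sup>2 * of_real (q * h + (1 - h) * q - h * r)
       + x1 * cnj x2 * \<omega> * of_real (p * (h * r) - (1 - h) * c * q - h * p * q * \<omega>s)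
       + cnj x1 * x2 * cnj \<omega> * of_real (p * (h * r) - (1 - h) * c * q - h * p * q * \<omega>s)
       + x1 * cnj x1 * of_real (p\<^sup>2 * \<omega>s * (1 - h) - (1 - h) * c * c)
       + x2 * cnj x2 * of_real (q\<^sup>2 * h\<^sup>2 * \<omega>s\<^sup>2 - (1 - h) * q\<^sup>2 * \<omega>s - h * r * r)"
      unfolding of_real_diff of_real_add of_real_mult complex_norm_square
      unfolding l of_real_power os of_real_1
      by (rule Hermitian_form_expansion) simp_all
    also have "\<dots> = of_real ((1 - \<omega>s) * (1 + h * \<omega>s) * (1 - nsq x1 - nsq x2))"
      unfolding g f3 f4 complex_norm_square[symmetric] of_real_add[symmetric] of_real_mult[symmetric] of_real_0 mult_zero_right
      by (simp add: algebra_simps power2_eq_square)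
    finally show ?thesis by (simp only: of_real_eq_iff)
  qed
  have nh: "norm (1 - complex_of_real h) = 1 - h" "norm (1 + complex_of_real h) = 1 + h"
  proof -
    have "norm (complex_of_real (1 - h)) = 1 - h" "norm (complex_of_real (1 + h)) = 1 + h"
      using h unfolding norm_of_real by auto
    then show "norm (1 - complex_of_real h) = 1 - h" "norm (1 + complex_of_real h) = 1 + h" by simp_all
  qed
  \<comment> \<open>The function x1^2 + 2 sqrt(h) x2, divided by 1 + h, in the coordinates sqrt(1 -
    h) l1 / l0 and sqrt(h) l2 / l0; all square roots cancel.\<close>
  define G where "G x1 x2 = ((1 - h) * (l1 x1 x2)\<^sup>2 + 2 * h * l2 x1 x2 * l0 x1 x2) / ((1 + h) * (l0 x1 x2)\<^sup>2)" for x1 x2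
  have G1: "l0 x1 x2 \<noteq> 0 \<and> norm (G x1 x2) \<le> 1" if x: "nsq x1 + nsq x2 < 1" for x1 x2
  proof -
    define a b c where "a = norm (l0 x1 x2)" and "b = norm (l1 x1 x2)" and "c = norm (l2 x1 x2)"
    have "(1 - \<omega>s) * (1 + h * \<omega>s) * (1 - nsq x1 - nsq x2) > 0" using x o01 ho by auto
    then have *: "a\<^sup>2 > (1 - h) * b\<^sup>2 + h * c\<^sup>2" using form[of x1 x2] unfolding a_def b_def c_def by linarith
    moreover have "(1 - h) * b\<^sup>2 + h * c\<^sup>2 \<ge> 0" using h by simp
    ultimately have "a\<^sup>2 > 0" by linarith
    then have a: "l0 x1 x2 \<noteq> 0" by (simp add: a_def)
    have "norm ((1 - h) * (l1 x1 x2)\<^sup>2 + 2 * h * l2 x1 x2 * l0 x1 x2) \<le> (1 - h) * b\<^sup>2 + 2 * h * c * a"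
      using h by (intro norm_triangle_le) (simp add: norm_mult norm_power nh a_def b_def c_def)
    \<comment> \<open>The inequality between arithmetic and geometric means; with the ball
      inequality above it produces the normalising constant 1 + h.\<close>
    also have "\<dots> \<le> (1 - h) * b\<^sup>2 + h * (c\<^sup>2 + a\<^sup>2)"
    proof -
      have "2 * c * a \<le> c\<^sup>2 + a\<^sup>2" by (rule sum_squares_bound)
      then have "h * (2 * c * a) \<le> h * (c\<^sup>2 + a\<^sup>2)" using h by (intro mult_left_mono) auto
      then show ?thesis by (simp add: mult_ac)
    qed
    also have "\<dots> \<le> (1 + h) * a\<^sup>2" using * by (simp add: algebra_simps)
    finally have "norm (G x1 x2) \<le> 1"
      using a h unfolding G_def norm_divide
      by (simp add: norm_mult norm_power divide_le_eq_1 nh a_def)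
    then show ?thesis using a by simp
  qed
  \<comment> \<open>Along the disc \<open>G\<close> equals the square of
    \<open>mob \<omega> \<zeta>\<close>, with value \<omega>^2 at \<zeta> = 0; the outer
    automorphism moves this value to 0.\<close>
  define F where "F x = mob (\<omega>\<^sup>2) (G (cinner x e1) (cinner x e2))" for x
  have bes: "nsq (cinner x e1) + nsq (cinner x e2) < 1" if "norm x < 1" for x
    using orthonormal_Bessel[OF e, of x] that by (smt (verit) norm_sq_less_1_iff)
  have w2: "norm (\<omega>\<^sup>2) < 1" using \<omega> by (simp add: norm_power)
  have hol: "F holomorphic_fun_on unit_ball"
  proof -
    have 1: "(\<lambda>x. l0 (cinner x e1) (cinner x e2)) holomorphic_fun_on unit_ball"
      "(\<lambda>x. l1 (cinner x e1) (cinner x e2)) holomorphic_fun_on unit_ball"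
      "(\<lambda>x. l2 (cinner x e1) (cinner x e2)) holomorphic_fun_on unit_ball"
      unfolding l0_def l1_def l2_def by (intro holomorphic_fun_intros)+
    have h1: "(1 + h :: complex) \<noteq> 0" using h by (auto simp: complex_eq_iff)
    have 2: "(\<lambda>x. G (cinner x e1) (cinner x e2)) holomorphic_fun_on unit_ball"
      unfolding G_def by (intro holomorphic_fun_intros 1) (use G1[OF bes] h1 in auto)
    show ?thesis unfolding F_def mob_def
      by (intro holomorphic_fun_intros 2) (use one_minus_cnj_mult_neq_0(1)[OF w2] G1[OF bes] in auto)
  qed
  have le: "F ` unit_ball \<subseteq> cball 0 1"
    using G1[OF bes] norm_mob_le_1[OF w2] by (auto simp: F_def)
  have val: "F ((\<zeta> * p) *s e1 + (\<zeta> * (q * mob \<alpha> \<zeta>)) *s e2) = \<zeta> * mob \<beta> \<zeta>"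
    if \<zeta>: "norm \<zeta> < 1" and inb: "(\<zeta> * p) *s e1 + (\<zeta> * (q * mob \<alpha> \<zeta>)) *s e2 \<in> unit_ball" for \<zeta> :: complex
  proof -
    have e21: "cinner e2 e1 = 0" using e(3) by (metis cnj_cinner complex_cnj_zero)
    define x1 where "x1 = \<zeta> * p"
    define d where "d = (1 + h * \<omega>s) - cnj \<omega> * (1 + h) * \<zeta>"
    define n where "n = (1 + h * \<omega>s) * \<zeta> - \<omega> * (1 + h)"
    define x2 where "x2 = \<zeta> * (q * mob \<alpha> \<zeta>)"
    have hoc: "(1 + h * \<omega>s :: complex) \<noteq> 0" using ho(1) by (metis less_irrefl of_real_1 of_real_add of_real_eq_0_iff of_real_mult)
    have ca: "cnj \<alpha> * (1 + h * \<omega>s) = cnj \<omega> * (1 + h)"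
      using arg_cong[OF \<alpha>(1), of cnj] by simp
    have "(1 - cnj \<alpha> * \<zeta>) * (1 + h * \<omega>s) = (1 + h * \<omega>s) - (cnj \<alpha> * (1 + h * \<omega>s)) * \<zeta>"
      by (simp add: algebra_simps)
    then have dd: "(1 - cnj \<alpha> * \<zeta>) * (1 + h * \<omega>s) = d" unfolding d_def ca .
    have "(\<zeta> - \<alpha>) * (1 + h * \<omega>s) = (1 + h * \<omega>s) * \<zeta> - \<alpha> * (1 + h * \<omega>s)" by (simp add: algebra_simps)
    then have nn: "(\<zeta> - \<alpha>) * (1 + h * \<omega>s) = n" unfolding n_def \<alpha>(1) .
    have a0: "1 - cnj \<alpha> * \<zeta> \<noteq> 0" using one_minus_cnj_mult_neq_0[OF \<alpha>(2)] \<zeta> by simp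
    have d0: "d \<noteq> 0" unfolding dd[symmetric] using a0 hoc by simp
    have x2: "x2 = q * \<zeta> * n / d" unfolding x2_def mob_def dd[symmetric] nn[symmetric] using hoc a0 by simp
    have w0: "1 - cnj \<omega> * \<zeta> \<noteq> 0" using one_minus_cnj_mult_neq_0[OF \<omega>] \<zeta> by simp
    \<comment> \<open>Along the disc \<open>p\<close> and \<open>q\<close> enter the linear forms
      only through their squares. Multiplication by \<open>E\<close> turns these into polynomials in
      \<open>h\<close> and \<omega> by \<open>R1\<close> and \<open>R2\<close>.\<close>
    define E where "E = (1 - h\<^sup>2 * (\<omega> * cnj \<omega>))"
    have E0: "E \<noteq> 0"
    proof -
      have "E = of_real (1 - h\<^sup>2 * \<omega>s)" by (simp add: E_def os)
      then show ?thesis using ho(2) by (simp only: of_real_eq_0_iff)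
    qed
    have pE: "p\<^sup>2 * E = (1 - h) * (1 + h * (\<omega> * cnj \<omega>))"
      using arg_cong[OF R2, of complex_of_real] by (simp add: E_def os)
    have qE: "q\<^sup>2 * E = h * (1 - \<omega> * cnj \<omega>)"
      using arg_cong[OF R1, of complex_of_real] by (simp add: E_def os)
    have dw: "d = (1 + h * (\<omega> * cnj \<omega>)) - cnj \<omega> * (1 + h) * \<zeta>"
      and nw: "n = (1 + h * (\<omega> * cnj \<omega>)) * \<zeta> - \<omega> * (1 + h)" by (simp_all add: d_def n_def os)
    have h1: "(1 - h :: complex) \<noteq> 0" "complex_of_real h \<noteq> 0" using h by (auto simp: complex_eq_iff)
    have L0: "l0 x1 x2 * d = (1 + h * \<omega>s) * (1 - cnj \<omega> * \<zeta>)\<^sup>2"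
    proof -
      have "E * (l0 x1 x2 * d) = E * d - (p\<^sup>2 * E) * (cnj \<omega> * \<zeta> * d) + (q\<^sup>2 * E) * (h * (cnj \<omega>)\<^sup>2 * \<zeta> * n)"
        unfolding l0_def x1_def x2 using d0 by (simp add: algebra_simps power2_eq_square)
      also have "\<dots> = E * ((1 + h * \<omega>s) * (1 - cnj \<omega> * \<zeta>)\<^sup>2)"
        unfolding pE qE unfolding E_def dw nw of_real_add of_real_mult of_real_1 os by (simp add: algebra_simps power2_eq_square)
      finally show ?thesis using E0 by simp
    qed
    have L1: "l1 x1 x2 * d = (1 + h * \<omega>s) * ((\<zeta> - \<omega>) * (1 - cnj \<omega> * \<zeta>))"
    proof -
      have "E * (l1 x1 x2 * d) = - E * \<omega> * d + (p\<^sup>2 * E) / (1 - h) * ((1 - h * (\<omega> * cnj \<omega>)) * \<zeta> * d) + (q\<^sup>2 * E) * (cnj \<omega> * \<zeta> * n)"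
        unfolding l1_def x1_def x2 of_real_divide of_real_mult of_real_diff of_real_1 os using d0 by (simp add: algebra_simps power2_eq_square diff_divide_distrib add_divide_distrib)
      also have "\<dots> = E * ((1 + h * \<omega>s) * ((\<zeta> - \<omega>) * (1 - cnj \<omega> * \<zeta>)))"
        unfolding pE qE using h1 apply simp unfolding E_def dw nw of_real_add of_real_mult of_real_1 os by (simp add: algebra_simps power2_eq_square)
      finally show ?thesis using E0 by simp
    qed
    have L2: "l2 x1 x2 * d = (1 + h * \<omega>s) * (\<zeta> - \<omega>)\<^sup>2"
    proof -
      have "E * (l2 x1 x2 * d) = E * \<omega>\<^sup>2 * d - (p\<^sup>2 * E) * (\<omega> * \<zeta> * d) + (q\<^sup>2 * E) / h * (\<zeta> * n)"
        unfolding l2_def x1_def x2 using d0 by (simp add: algebra_simps power2_eq_square)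
      also have "\<dots> = E * ((1 + h * \<omega>s) * (\<zeta> - \<omega>)\<^sup>2)"
        unfolding pE qE using h1 apply simp unfolding E_def dw nw of_real_add of_real_mult of_real_1 os by (simp add: algebra_simps power2_eq_square)
      finally show ?thesis using E0 by simp
    qed
    have "G x1 x2 = (mob \<omega> \<zeta>)\<^sup>2"
    proof -
      define k where "k = (1 + h * \<omega>s) / d"
      have l: "l0 x1 x2 = k * (1 - cnj \<omega> * \<zeta>)\<^sup>2" "l1 x1 x2 = k * ((\<zeta> - \<omega>) * (1 - cnj \<omega> * \<zeta>))"
        "l2 x1 x2 = k * (\<zeta> - \<omega>)\<^sup>2" and k: "k \<noteq> 0"
        using L0 L1 L2 d0 hoc by (auto simp: k_def field_simps)
      have h1: "(1 + h :: complex) \<noteq> 0" using h by (metis add_pos_pos less_irrefl of_real_1 of_real_add of_real_eq_0_iff zero_less_one)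
      have "(1 - h) * (l1 x1 x2)\<^sup>2 + 2 * h * l2 x1 x2 * l0 x1 x2 = (1 + h) * (k\<^sup>2 * ((\<zeta> - \<omega>)\<^sup>2 * (1 - cnj \<omega> * \<zeta>)\<^sup>2))"
        unfolding l by (simp add: algebra_simps power2_eq_square)
      moreover have "(l0 x1 x2)\<^sup>2 = k\<^sup>2 * ((1 - cnj \<omega> * \<zeta>)\<^sup>2 * (1 - cnj \<omega> * \<zeta>)\<^sup>2)"
        unfolding l by (simp add: power2_eq_square)
      ultimately show ?thesis unfolding G_def mob_def using h1 k w0 by (simp add: power_divide) (simp add: power2_eq_square power4_eq_xxxx)
    qed
    moreover have "mob (\<omega>\<^sup>2) ((mob \<omega> \<zeta>)\<^sup>2) = \<zeta> * mob \<beta> \<zeta>"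
    proof -
      have oc: "(1 + \<omega> * cnj \<omega>) \<noteq> 0" "(1 - \<omega> * cnj \<omega>) \<noteq> 0" 
        using o01 by (auto simp flip: os simp: complex_eq_iff)
      have b: "\<beta> * (1 + \<omega> * cnj \<omega>) = 2 * \<omega>" using \<beta> by (simp add: os)
      have b': "cnj \<beta> * (1 + \<omega> * cnj \<omega>) = 2 * cnj \<omega>" using arg_cong[OF b, of cnj] by (simp add: mult.commute)
      have 1: "(\<zeta> - \<omega>)\<^sup>2 - \<omega>\<^sup>2 * (1 - cnj \<omega> * \<zeta>)\<^sup>2 = ((1 - \<omega> * cnj \<omega>) * (1 + \<omega> * cnj \<omega>)) * (\<zeta> * (\<zeta> - \<beta>))"
      proof -
        have "((1 - \<omega> * cnj \<omega>) * (1 + \<omega> * cnj \<omega>)) * (\<zeta> * (\<zeta> - \<beta>)) =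
           (1 - \<omega> * cnj \<omega>) * \<zeta> * ((1 + \<omega> * cnj \<omega>) * \<zeta> - \<beta> * (1 + \<omega> * cnj \<omega>))" by (simp add: algebra_simps)
        also have "\<dots> = (\<zeta> - \<omega>)\<^sup>2 - \<omega>\<^sup>2 * (1 - cnj \<omega> * \<zeta>)\<^sup>2" unfolding b by (simp add: algebra_simps power2_eq_square)
        finally show ?thesis ..
      qed
      have 2: "(1 - cnj \<omega> * \<zeta>)\<^sup>2 - (cnj \<omega>)\<^sup>2 * (\<zeta> - \<omega>)\<^sup>2 = ((1 - \<omega> * cnj \<omega>) * (1 + \<omega> * cnj \<omega>)) * (1 - cnj \<beta> * \<zeta>)"
      proof -
        have "((1 - \<omega> * cnj \<omega>) * (1 + \<omega> * cnj \<omega>)) * (1 - cnj \<beta> * \<zeta>) =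
           (1 - \<omega> * cnj \<omega>) * ((1 + \<omega> * cnj \<omega>) - cnj \<beta> * (1 + \<omega> * cnj \<omega>) * \<zeta>)" by (simp add: algebra_simps)
        also have "\<dots> = (1 - cnj \<omega> * \<zeta>)\<^sup>2 - (cnj \<omega>)\<^sup>2 * (\<zeta> - \<omega>)\<^sup>2" unfolding b' by (simp add: algebra_simps power2_eq_square)
        finally show ?thesis ..
      qed
      have "mob (\<omega>\<^sup>2) ((mob \<omega> \<zeta>)\<^sup>2) = ((\<zeta> - \<omega>)\<^sup>2 - \<omega>\<^sup>2 * (1 - cnj \<omega> * \<zeta>)\<^sup>2) / ((1 - cnj \<omega> * \<zeta>)\<^sup>2 - (cnj \<omega>)\<^sup>2 * (\<zeta> - \<omega>)\<^sup>2)"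
      proof -
        have m2: "(mob \<omega> \<zeta>)\<^sup>2 = (\<zeta> - \<omega>)\<^sup>2 / (1 - cnj \<omega> * \<zeta>)\<^sup>2"
          by (simp add: mob_def power_divide)
        have 3: "(mob \<omega> \<zeta>)\<^sup>2 - \<omega>\<^sup>2 = ((\<zeta> - \<omega>)\<^sup>2 - \<omega>\<^sup>2 * (1 - cnj \<omega> * \<zeta>)\<^sup>2) / (1 - cnj \<omega> * \<zeta>)\<^sup>2"
          unfolding m2 using w0 by (simp add: diff_divide_distrib)
        have 4: "1 - cnj (\<omega>\<^sup>2) * (mob \<omega> \<zeta>)\<^sup>2 = ((1 - cnj \<omega> * \<zeta>)\<^sup>2 - (cnj \<omega>)\<^sup>2 * (\<zeta> - \<omega>)\<^sup>2) / (1 - cnj \<omega> * \<zeta>)\<^sup>2"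
          unfolding m2 using w0 by (simp add: diff_divide_distrib)
        show ?thesis unfolding mob_def[of "\<omega>\<^sup>2"] 3 4 using w0 by simp
      qed
      then show ?thesis unfolding 1 2 mob_def[of \<beta>] using oc by simp
    qed
    ultimately show ?thesis unfolding F_def by (simp add: e e21 x1_def x2_def)
  qed
  show ?thesis by (rule that[OF hol le val])
qed

text \<open>\<omega> has to be the critical point of \<zeta> mob \<beta> \<zeta> in the disc,
  because this product is an automorphism applied to the square of
  \<open>mob \<omega> \<zeta>\<close>. It is a real multiple \<rho> of \<alpha>, which leaves one
  real quadratic equation; \<open>h\<close> then follows linearly.\<close>

lemma left_inverse_exists:
  fixes e1 e2 :: "complex ^ 'n" and p q :: real and \<alpha> \<beta> :: complex
  assumes pq: "0 < p" "0 < q" "p\<^sup>2 + q\<^sup>2 = 1" and \<alpha>: "norm \<alpha> < 1"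
    and \<beta>: "\<beta> * (1 + nsq \<alpha> + q\<^sup>2 * (1 - nsq \<alpha>)) = 2 * \<alpha>"
    and e: "cinner e1 e1 = 1" "cinner e2 e2 = 1" "cinner e1 e2 = 0"
  obtains F where "F holomorphic_fun_on unit_ball" "F ` unit_ball \<subseteq> cball 0 1"
    "\<And>\<zeta> :: complex. norm \<zeta> < 1 \<Longrightarrow> (\<zeta> * p) *s e1 + (\<zeta> * (q * mob \<alpha> \<zeta>)) *s e2 \<in> unit_ball \<Longrightarrow>
        F ((\<zeta> * p) *s e1 + (\<zeta> * (q * mob \<alpha> \<zeta>)) *s e2) = \<zeta> * mob \<beta> \<zeta>"
proof -
  define a where "a = nsq \<alpha>"
  define Q where "Q = q\<^sup>2 * (1 - a)"
  define S where "S = 1 + a + Q"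
  have a: "0 \<le> a" "a < 1" using \<alpha> by (auto simp: a_def)
  have q1: "0 < q\<^sup>2" "q\<^sup>2 < 1" using pq by (auto, smt (verit) zero_less_power)
  have Q: "0 < Q" "Q < 1 - a" using q1 a by (auto simp: Q_def)
  \<comment> \<open>With \<open>\<omega> = \<rho> * \<alpha>\<close>, comparing
    \<open>\<beta> * S = 2 * \<alpha>\<close> and \<open>\<beta> * (1 + os) = 2 * \<omega>\<close>
    suggests this equation. Its left side is 1 at 0 and - Q at 1.\<close>
  have "\<exists>\<rho>\<ge>0. \<rho> \<le> 1 \<and> 1 - \<rho> * S + \<rho>\<^sup>2 * a = 0"
    by (rule IVT2'[of "\<lambda>\<rho>. 1 - \<rho> * S + \<rho>\<^sup>2 * a"]) (use Q in \<open>auto simp: S_def intro!: continuous_intros\<close>)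
  then obtain \<rho> where \<rho>': "0 \<le> \<rho>" "\<rho> \<le> 1" "1 - \<rho> * S + \<rho>\<^sup>2 * a = 0" by blast
  then have \<rho>: "0 < \<rho>" "\<rho> < 1" using Q by (auto simp: S_def less_le)
  have \<rho>a: "1 - \<rho> * a > 0" "1 - \<rho>\<^sup>2 * a > 0"
  proof -
    have "\<rho> * a \<le> 1 * a" using \<rho> a by (intro mult_right_mono) auto
    then show "1 - \<rho> * a > 0" using a by simp
    have "\<rho>\<^sup>2 * a \<le> 1 * a" using \<rho> a by (intro mult_right_mono) (auto simp: power_le_one)
    then show "1 - \<rho>\<^sup>2 * a > 0" using a by simp
  qed
  have \<rho>Q: "\<rho> * Q = (1 - \<rho>) * (1 - \<rho> * a)"
    using \<rho>'(3) by (simp add: S_def algebra_simps power2_eq_square)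
  \<comment> \<open>The solution of \<open>1 + h * os = \<rho> * (1 + h)\<close>, which is the
    required relation between \<alpha> and \<omega>.\<close>
  define h where "h = (1 - \<rho>) / (\<rho> * (1 - \<rho> * a))"
  have h: "h * (\<rho> * (1 - \<rho> * a)) = 1 - \<rho>" using \<rho> \<rho>a by (simp add: h_def)
  have h0: "0 < h" using \<rho> \<rho>a by (simp add: h_def)
  have h1: "h < 1"
  proof -
    have "\<rho> * Q < \<rho> * (1 - a)" using Q \<rho> by simp
    then have "1 - \<rho> < \<rho> * (1 - \<rho> * a)" unfolding \<rho>Q by (simp add: algebra_simps)
    then show ?thesis using \<rho> \<rho>a by (simp add: h_def divide_less_eq)
  qed
  define \<omega> where "\<omega> = of_real \<rho> * \<alpha>"
  define os where "os = nsq \<omega>"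
  have os: "os = \<rho>\<^sup>2 * a" using \<rho> by (simp add: os_def \<omega>_def norm_mult a_def power_mult_distrib)
  have hh: "(1 - \<rho> * a)\<^sup>2 * (1 - h\<^sup>2 * os) = (1 - a) * (1 - \<rho>\<^sup>2 * a)"
  proof -
    have "(1 - \<rho> * a)\<^sup>2 * (1 - h\<^sup>2 * os) = (1 - \<rho> * a)\<^sup>2 - (h * (\<rho> * (1 - \<rho> * a)))\<^sup>2 * a"
      unfolding os by (simp add: algebra_simps power2_eq_square)
    then show ?thesis unfolding h by (simp add: algebra_simps power2_eq_square)
  qed
  have h2: "h * (1 - \<rho> * a) * \<rho> = 1 - \<rho>" using h by (simp add: mult_ac)
  have R1: "q\<^sup>2 * (1 - h\<^sup>2 * os) = h * (1 - os)"
  proof -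
    have "(\<rho> * (1 - \<rho> * a)\<^sup>2) * (q\<^sup>2 * (1 - h\<^sup>2 * os)) = \<rho> * q\<^sup>2 * ((1 - \<rho> * a)\<^sup>2 * (1 - h\<^sup>2 * os))"
      by (simp add: mult_ac)
    also have "\<dots> = \<rho> * Q * (1 - \<rho>\<^sup>2 * a)" unfolding hh by (simp add: Q_def mult_ac)
    also have "\<dots> = (\<rho> * (1 - \<rho> * a)\<^sup>2) * (h * (1 - os))"
      unfolding \<rho>Q h2[symmetric] os by (simp add: power2_eq_square mult_ac)
    finally show ?thesis using \<rho> \<rho>a by (simp only: mult_cancel_left) auto
  qed
  have R2: "p\<^sup>2 * (1 - h\<^sup>2 * os) = (1 - h) * (1 + h * os)"
  proof -
    have p: "p\<^sup>2 = 1 - q\<^sup>2" using pq by simp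
    have "p\<^sup>2 * (1 - h\<^sup>2 * os) = (1 - h\<^sup>2 * os) - q\<^sup>2 * (1 - h\<^sup>2 * os)" unfolding p left_diff_distrib by simp
    then show ?thesis unfolding R1 by (simp add: algebra_simps power2_eq_square)
  qed
  have "(1 - \<rho> * a) * (1 + h * os) = (1 - \<rho> * a) * (\<rho> * (1 + h))"
  proof -
    have 1: "(1 - \<rho> * a) * (1 + h * os) = (1 - \<rho> * a) + (h * (1 - \<rho> * a) * \<rho>) * (\<rho> * a)"
      unfolding os by (simp add: algebra_simps power2_eq_square)
    have 2: "(1 - \<rho> * a) * (\<rho> * (1 + h)) = (1 - \<rho> * a) * \<rho> + h * (1 - \<rho> * a) * \<rho>" by (simp add: algebra_simps)
    show ?thesis unfolding 1 2 h2 by (simp add: algebra_simps)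
  qed
  then have "1 + h * os = \<rho> * (1 + h)" using \<rho>a by (simp only: mult_cancel_left) auto
  then have al: "\<alpha> * (1 + h * os) = \<omega> * (1 + h)"
    unfolding \<omega>_def by (simp add: mult_ac)
  have be: "\<beta> * (1 + os) = 2 * \<omega>"
  proof -
    have "1 + os = \<rho> * S" using \<rho>'(3) unfolding os by simp
    then have "\<beta> * (1 + os) = (\<beta> * S) * \<rho>" by (metis mult.assoc mult.commute of_real_mult)
    also have "\<beta> * S = 2 * \<alpha>" using \<beta> by (simp add: S_def Q_def a_def)
    finally show ?thesis by (simp add: \<omega>_def mult_ac)
  qed
  have \<omega>: "norm \<omega> < 1"
  proof -
    have "norm \<omega> \<le> 1 * norm \<alpha>" unfolding \<omega>_def norm_mult using \<rho> by (intro mult_right_mono) auto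
    then show ?thesis using \<alpha> by simp
  qed
  show ?thesis
    by (rule left_inverse_of_degree_2[OF h0 h1 \<omega> os_def R1 R2 al \<alpha> be e]) (rule that)
qed

text \<open>The inner product of the points with parameters \<open>s\<close> and \<open>t\<close> on
  the disc \<zeta> (p, q mob \<alpha> \<zeta>). For p = 0 and q = 1 it describes the scalar function
  \<zeta> mob \<alpha> \<zeta>, so one formula serves both determinants.\<close>

definition disc_gram :: "real \<Rightarrow> real \<Rightarrow> complex \<Rightarrow> complex \<Rightarrow> complex \<Rightarrow> complex" where
  "disc_gram p q \<alpha> s t = s * cnj t * (p\<^sup>2 + q\<^sup>2 * (mob \<alpha> s * cnj (mob \<alpha> t)))"

lemma cnj_disc_gram: "cnj (disc_gram p q \<alpha> s t) = disc_gram p q \<alpha> t s"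
  by (simp add: disc_gram_def mult_ac)

lemma disc_gram_diff:
  assumes pq: "p\<^sup>2 + q\<^sup>2 = 1" and \<alpha>: "norm \<alpha> < 1" and "norm s \<le> 1" "norm t \<le> 1"
  shows "s * cnj t - disc_gram p q \<alpha> s t = s * cnj t * of_real (q\<^sup>2 * (1 - nsq \<alpha>)) * (1 - s * cnj t)
      / ((1 - cnj \<alpha> * s) * (1 - \<alpha> * cnj t))"
proof -
  have p: "(complex_of_real p)\<^sup>2 = 1 - (of_real q)\<^sup>2"
    using pq by (simp add: eq_diff_eq flip: of_real_power of_real_add)
  have "s * cnj t - disc_gram p q \<alpha> s t = s * cnj t * of_real (q\<^sup>2) * (1 - mob \<alpha> s * cnj (mob \<alpha> t))"
    unfolding disc_gram_def of_real_power p by (simp add: algebra_simps)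
  also have "\<dots> = s * cnj t * of_real (q\<^sup>2) * (of_real (1 - nsq \<alpha>) * (1 - s * cnj t) / ((1 - cnj \<alpha> * s) * (1 - \<alpha> * cnj t)))"
    unfolding mob_kernel[OF \<alpha> assms(3,4)] ..
  finally show ?thesis by (simp add: mult_ac)
qed

text \<open>For \<open>Q = 1 - nsq \<alpha>\<close> this is the numerator of the derivative of
  \<zeta> mob \<alpha> \<zeta>. The factor 2 and the halved coefficient give it the shape used in
  \<open>self_reciprocal_roots\<close>.\<close>

definition crit_poly :: "complex \<Rightarrow> real \<Rightarrow> complex \<Rightarrow> complex" where
  "crit_poly \<alpha> Q s = 2 * of_real ((1 + nsq \<alpha> + Q) / 2) * s - cnj \<alpha> * s\<^sup>2 - \<alpha>"

lemma crit_poly_eq: "(s - \<alpha>) * (1 - cnj \<alpha> * s) + Q * s = crit_poly \<alpha> Q s"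
proof -
  have "2 * complex_of_real ((1 + nsq \<alpha> + Q) / 2) = of_real (1 + nsq \<alpha> + Q)"
    by (simp only: of_real_divide) simp
  then show ?thesis
    unfolding crit_poly_def of_real_add complex_norm_square by (simp add: algebra_simps power2_eq_square)
qed

text \<open>The part of the gradient that depends on the nodes alone. It is the same for both
  determinants and does not vanish, so it cancels when the gradients are compared.\<close>

definition deriv_factor :: "complex \<Rightarrow> complex \<Rightarrow> complex" where
  "deriv_factor s t = cnj s * (t * cnj t) * (1 - t * cnj t) * (1 - cnj s * t) * (cnj s - cnj t)"

lemma deriv_factor_neq_0:
  assumes "norm s < 1" "norm t < 1" "s \<noteq> 0" "t \<noteq> 0" "s \<noteq> t"
  shows "deriv_factor s t \<noteq> 0"
  using assms one_minus_cnj_mult_neq_0[of t t] one_minus_cnj_mult_neq_0[of s t] by (auto simp: deriv_factor_def)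

lemma pick_det_deriv_disc_gram:
  assumes pq: "p\<^sup>2 + q\<^sup>2 = 1" and \<alpha>: "norm \<alpha> < 1" and s: "norm s < 1" and t: "norm t < 1"
  shows "pick_det_deriv (disc_gram p q \<alpha> s s) (disc_gram p q \<alpha> t t) (disc_gram p q \<alpha> s t) s t =
     of_real (q\<^sup>2 * (1 - nsq \<alpha>) / (nsq (1 - cnj \<alpha> * s) * nsq (1 - cnj \<alpha> * t))) *
     deriv_factor s t * crit_poly \<alpha> (q\<^sup>2 * (1 - nsq \<alpha>)) s"
proof -
  have "1 - cnj \<alpha> * s \<noteq> 0" "1 - cnj \<alpha> * t \<noteq> 0" using one_minus_cnj_mult_neq_0(1)[OF \<alpha>] s t by auto
  from pick_det_deriv_factor[OF this disc_gram_diff[OF pq \<alpha>] disc_gram_diff[OF pq \<alpha>] disc_gram_diff[OF pq \<alpha>]]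
  show ?thesis using s t unfolding deriv_factor_def crit_poly_eq[symmetric] of_real_divide by auto
qed

text \<open>The difference of the two sides is again a self-reciprocal quadratic, and it vanishes at
  two nodes in the disc; hence the coefficients agree.\<close>

lemma crit_poly_roots:
  assumes "norm s < 1" "norm t < 1" "s \<noteq> t" "s \<noteq> 0"
    and "crit_poly \<beta> R s = k * crit_poly \<alpha> Q s" "crit_poly \<beta> R t = of_real k * crit_poly \<alpha> Q t"
  shows "\<beta> = k * \<alpha> \<and> 1 + nsq \<beta> + R = k * (1 + nsq \<alpha> + Q)"
proof -
  define D where "D = (1 + nsq \<beta> + R) / 2 - k * ((1 + nsq \<alpha> + Q) / 2)"
  have e: "2 * D * x - cnj (\<beta> - k * \<alpha>) * x\<^sup>2 - (\<beta> - k * \<alpha>) = crit_poly \<beta> R x - k * crit_poly \<alpha> Q x" for x :: complex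
    unfolding crit_poly_def D_def by (simp add: algebra_simps)
  have "\<beta> - k * \<alpha> = 0 \<and> D = 0"
    by (rule self_reciprocal_roots[OF assms(1-4)]) (simp_all only: e assms(5,6) diff_self)
  then show ?thesis by (auto simp: D_def field_simps)
qed

text \<open>A short move in a direction along which the first determinant increases stays in the
  region where it is nonnegative, as does any short move if it is already positive. There the second
  determinant cannot become negative, and it starts at 0.\<close>

lemma pick_det_directional:
  assumes open_cond: "norm s < 1" "norm t < 1" "nz < norm s" "nw < norm t" "s \<noteq> t"
    and E: "0 \<le> pick_det A B b s t" and H: "pick_det A' B' b' s t = 0"
    and ineq: "\<And>s t. norm s < 1 \<Longrightarrow> norm t < 1 \<Longrightarrow> nz < norm s \<Longrightarrow> nw < norm t \<Longrightarrow> s \<noteq> t \<Longrightarrow>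
       0 \<le> pick_det A B b s t \<Longrightarrow> 0 \<le> pick_det A' B' b' s t"
    and dir: "0 < pick_det A B b s t \<or> 0 < Re (pick_det_deriv A B b s t * \<sigma> + pick_det_deriv B A (cnj b) t s * \<tau>)"
  shows "0 \<le> Re (pick_det_deriv A' B' b' s t * \<sigma> + pick_det_deriv B' A' (cnj b') t s * \<tau>)"
proof (rule ccontr)
  define S T where "S \<epsilon> = s + complex_of_real \<epsilon> * \<sigma>" and "T \<epsilon> = t + complex_of_real \<epsilon> * \<tau>" for \<epsilon>
  note dE = pick_det_has_real_derivative[of A B b s \<sigma> t \<tau>, folded S_def T_def]
  note dH = pick_det_has_real_derivative[of A' B' b' s \<sigma> t \<tau>, folded S_def T_def]
  assume "\<not> ?thesis"
  then obtain d where d: "d > 0" "\<And>\<epsilon>. 0 < \<epsilon> \<Longrightarrow> \<epsilon> < d \<Longrightarrow> pick_det A' B' b' (S \<epsilon>) (T \<epsilon>) < pick_det A' B' b' (S 0) (T 0)"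
    using DERIV_neg_dec_right[OF dH] by auto
  have 0: "S 0 = s" "T 0 = t" by (simp_all add: S_def T_def)
  have evH: "\<forall>\<^sub>F \<epsilon> in at_right 0. pick_det A' B' b' (S \<epsilon>) (T \<epsilon>) < 0"
    by (rule eventually_at_rightI[of 0 d]) (use d H 0 in auto)
  have evE: "\<forall>\<^sub>F \<epsilon> in at_right 0. 0 \<le> pick_det A B b (S \<epsilon>) (T \<epsilon>)"
  proof (cases "0 < pick_det A B b s t")
    case True
    have "isCont (\<lambda>\<epsilon>. pick_det A B b (S \<epsilon>) (T \<epsilon>)) 0" using dE DERIV_isCont by blast
    then have "((\<lambda>\<epsilon>. pick_det A B b (S \<epsilon>) (T \<epsilon>)) \<longlongrightarrow> pick_det A B b s t) (at_right 0)"
      unfolding isCont_def 0 by (rule filterlim_mono) (auto simp: at_within_le_at)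
    then show ?thesis using order_tendstoD(1)[OF _ True] by (fastforce elim: eventually_mono)
  next
    case False
    then obtain d where d: "d > 0" "\<And>\<epsilon>. 0 < \<epsilon> \<Longrightarrow> \<epsilon> < d \<Longrightarrow> pick_det A B b (S 0) (T 0) < pick_det A B b (S \<epsilon>) (T \<epsilon>)"
      using DERIV_pos_inc_right[OF dE] dir by auto
    show ?thesis by (rule eventually_at_rightI[of 0 d]) (use d E 0 in \<open>auto intro: less_imp_le order.strict_trans1\<close>)
  qed
  have tS: "(S \<longlongrightarrow> s) (at_right 0)" "(T \<longlongrightarrow> t) (at_right 0)"
    unfolding S_def T_def by (auto intro!: tendsto_eq_intros)
  have "\<forall>\<^sub>F \<epsilon> in at_right 0. norm (S \<epsilon>) < 1" "\<forall>\<^sub>F \<epsilon> in at_right 0. norm (T \<epsilon>) < 1"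
    "\<forall>\<^sub>F \<epsilon> in at_right 0. nz < norm (S \<epsilon>)" "\<forall>\<^sub>F \<epsilon> in at_right 0. nw < norm (T \<epsilon>)"
    using order_tendstoD[OF tendsto_norm[OF tS(1)]] order_tendstoD[OF tendsto_norm[OF tS(2)]] open_cond by auto
  moreover have "\<forall>\<^sub>F \<epsilon> in at_right 0. S \<epsilon> \<noteq> T \<epsilon>"
  proof -
    have "((\<lambda>\<epsilon>. norm (S \<epsilon> - T \<epsilon>)) \<longlongrightarrow> norm (s - t)) (at_right 0)" by (intro tendsto_intros tS)
    from order_tendstoD(1)[OF this, of 0] show ?thesis using open_cond by (auto elim: eventually_mono)
  qed
  ultimately have "\<forall>\<^sub>F \<epsilon> in at_right (0::real). False"
    using evH evE
  proof eventually_elim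
    case (elim \<epsilon>)
    then show ?case using ineq[of "S \<epsilon>" "T \<epsilon>"] by linarith
  qed
  then show False by simp
qed

text \<open>At a point where the extremal problems in the disc and in the ball touch, the gradients of the
  two Pick determinants are proportional. This determines the Blaschke product (the relation between
  \<open>\<beta>\<close> and \<open>\<alpha>\<close>) and makes the function of the preceding lemma interpolate.\<close>

lemma interpolation_at_touching_point:
  fixes z w :: "complex ^ 'n" and s t l m :: complex
  assumes nc: "norm (cinner z w) < norm z * norm w" and zw1: "norm z < 1" "norm w < 1"
    and lm: "norm l < norm z" "norm m < norm w"
    and s: "norm s < 1" "norm z \<le> norm s" and t: "norm t < 1" "norm w \<le> norm t" and st: "s \<noteq> t"
    and E: "0 \<le> ball_det z w s t"
    and H: "scalar_det l m s t = 0"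
    and ineq: "\<And>s t. norm s < 1 \<Longrightarrow> norm t < 1 \<Longrightarrow> norm z < norm s \<Longrightarrow> norm w < norm t \<Longrightarrow> s \<noteq> t \<Longrightarrow>
       0 \<le> ball_det z w s t \<Longrightarrow>
       0 \<le> scalar_det l m s t"
  obtains F where "F holomorphic_fun_on unit_ball" "F ` unit_ball \<subseteq> cball 0 1" "F 0 = 0" "F z = l" "F w = m"
proof -
  have s0: "s \<noteq> 0" and t0: "t \<noteq> 0" using lm s t by auto
  let ?E = "ball_det z w"
  let ?H = "scalar_det l m"
  \<comment> \<open>Equality in either bound would give |s| |t| = |cinner z w| < |z| |w| \<le> |s|
    |t|. Strictness makes every small displacement of the nodes admissible.\<close>
  have strict: "norm z < norm s" "norm w < norm t"
  proof -
    have "s * cnj t = cinner z w" if "norm z = norm s \<or> norm w = norm t"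
    proof -
      have "disc_kernel s t * nsq (s * cnj t - cinner z w) \<le> 0"
        using E that unfolding pick_det_nonneg_iff[OF s(1) t(1)] by auto
      then have "nsq (s * cnj t - cinner z w) \<le> 0"
        using disc_kernel_pos[OF s(1) t(1)] by (simp add: mult_le_0_iff)
      then show ?thesis by simp
    qed
    then have "norm s * norm t = norm (cinner z w)" if "norm z = norm s \<or> norm w = norm t"
      using that by (metis complex_mod_cnj norm_mult)
    moreover have "norm z * norm w \<le> norm s * norm t" using s t by (intro mult_mono) auto
    ultimately show "norm z < norm s" "norm w < norm t" using nc s(2) t(2) by fastforce+
  qed
  obtain v \<beta> where v: "norm v = 1" "norm \<beta> < 1" "l = s * (v * mob \<beta> s)" "m = t * (v * mob \<beta> t)"
    using three_point_equality_disc[OF s(1) s0 t(1) t0 st _ _ H] lm strict by (metis less_trans)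
  have vv: "v * cnj v = 1" using complex_norm_square[of v] v(1) by simp
  define R where "R = 1 - nsq \<beta>"
  have R: "R > 0" using v(2) by (simp add: R_def)
  have ll: "complex_of_real (nsq l) = disc_gram 0 1 \<beta> s s" "complex_of_real (nsq m) = disc_gram 0 1 \<beta> t t"
    "l * cnj m = disc_gram 0 1 \<beta> s t"
    unfolding complex_norm_square disc_gram_def v(3,4) using vv
    by (simp_all add: mult_ac)
  define NB where "NB = nsq (1 - cnj \<beta> * s) * nsq (1 - cnj \<beta> * t)"
  have NB: "NB > 0" using one_minus_cnj_mult_neq_0(1)[OF v(2)] s t by (auto simp: NB_def)
  define Hs Ht where "Hs = pick_det_deriv (nsq l) (nsq m) (l * cnj m) s t"
    and "Ht = pick_det_deriv (nsq m) (nsq l) (cnj (l * cnj m)) t s"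
  have Hs: "Hs = of_real (R / NB) * deriv_factor s t * crit_poly \<beta> R s"
    unfolding Hs_def ll using pick_det_deriv_disc_gram[of 0 1 \<beta> s t] v(2) s t by (simp add: R_def NB_def)
  have Ht: "Ht = of_real (R / NB) * deriv_factor t s * crit_poly \<beta> R t"
    unfolding Ht_def ll cnj_disc_gram using pick_det_deriv_disc_gram[of 0 1 \<beta> t s] v(2) s t by (simp add: R_def NB_def mult_ac)
  have mst: "deriv_factor s t \<noteq> 0" "deriv_factor t s \<noteq> 0"
    using deriv_factor_neq_0 s t s0 t0 st by auto
  define Es Et where "Es = pick_det_deriv (nsq z) (nsq w) (cinner z w) s t"
    and "Et = pick_det_deriv (nsq w) (nsq z) (cnj (cinner z w)) t s"
  have dir: "0 \<le> Re (Hs * \<sigma> + Ht * \<tau>)" if "0 < ?E s t \<or> 0 < Re (Es * \<sigma> + Et * \<tau>)" for \<sigma> \<tau>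
    unfolding Hs_def Ht_def
    by (rule pick_det_directional[OF s(1) t(1) strict st E H ineq]) (use that in \<open>simp_all add: Es_def Et_def\<close>)
  \<comment> \<open>If the determinant of the ball were positive, all directions would be admissible
    and the gradient of the scalar one would vanish. Its critical polynomial would then have two
    zeros in the disc.\<close>
  have "?E s t = 0"
  proof (rule ccontr)
    assume "?E s t \<noteq> 0"
    then have pos: "0 \<le> Re (Hs * \<sigma> + Ht * \<tau>)" for \<sigma> \<tau> using dir E by auto
    have sq: "Re (x * - cnj x) = - nsq x" for x unfolding cmod_power2 by (simp add: power2_eq_square)
    have "0 \<le> - nsq Hs" "0 \<le> - nsq Ht"
      using pos[of "- cnj Hs" 0] pos[of 0 "- cnj Ht"] unfolding mult_zero_right add_0_right add_0_left sq .
    then have "Hs = 0" "Ht = 0" by simp_all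
    then have "crit_poly \<beta> R s = 0" "crit_poly \<beta> R t = 0" using Hs Ht R NB mst by auto
    then have "1 + nsq \<beta> + R = 0"
      using crit_poly_roots[OF s(1) t(1) st s0, of \<beta> R 0 0 0] by auto
    then show False by (simp add: R_def)
  qed
  then obtain p q :: real and \<alpha> e1 e2 where pq: "0 < p" "0 < q" "p\<^sup>2 + q\<^sup>2 = 1" "norm \<alpha> < 1"
    "cinner e1 e1 = 1" "cinner e2 e2 = 1" "cinner e1 e2 = 0"
    "z = (s * p) *s e1 + (s * (q * mob \<alpha> s)) *s e2" "w = (t * p) *s e1 + (t * (q * mob \<alpha> t)) *s e2"
    using three_point_equality_ball[OF s(1) s0 t(1) t0 st strict _ nc] by metis
  define Q where "Q = q\<^sup>2 * (1 - nsq \<alpha>)"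
  have Q: "Q > 0" using pq by (simp add: Q_def)
  have e21: "cinner e2 e1 = 0" using pq(7) by (metis cnj_cinner complex_cnj_zero)
  have gr: "cinner ((x * p) *s e1 + (x * (q * mob \<alpha> x)) *s e2) ((y * p) *s e1 + (y * (q * mob \<alpha> y)) *s e2) = disc_gram p q \<alpha> x y" for x y :: complex
    unfolding cinner_simps pq(5-7) e21 disc_gram_def by (simp add: algebra_simps power2_eq_square)
  have zz: "complex_of_real (nsq z) = disc_gram p q \<alpha> s s" "complex_of_real (nsq w) = disc_gram p q \<alpha> t t"
    "cinner z w = disc_gram p q \<alpha> s t"
    unfolding cinner_self[symmetric] pq(8,9) gr by simp_all
  define NA where "NA = nsq (1 - cnj \<alpha> * s) * nsq (1 - cnj \<alpha> * t)"
  have NA: "NA > 0" using one_minus_cnj_mult_neq_0(1)[OF pq(4)] s t by (auto simp: NA_def)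
  have Es: "Es = of_real (Q / NA) * deriv_factor s t * crit_poly \<alpha> Q s"
    unfolding Es_def zz using pick_det_deriv_disc_gram[OF pq(3,4), of s t] s t by (simp add: Q_def NA_def)
  have Et: "Et = of_real (Q / NA) * deriv_factor t s * crit_poly \<alpha> Q t"
    unfolding Et_def zz cnj_disc_gram using pick_det_deriv_disc_gram[OF pq(3,4), of t s] s t by (simp add: Q_def NA_def mult_ac)
  have "(cnj Es, cnj Et) \<noteq> 0"
  proof
    assume "(cnj Es, cnj Et) = 0"
    then have "crit_poly \<alpha> Q s = 0" "crit_poly \<alpha> Q t = 0" using Es Et Q NA mst by (auto simp: zero_prod_def)
    then have "1 + nsq \<alpha> + Q = 0"
      using crit_poly_roots[OF s(1) t(1) st s0, of \<alpha> Q 0 0 0] by auto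
    then show False using Q by (smt (verit) zero_le_power2)
  qed
  moreover have "inner (cnj Hs, cnj Ht) x \<ge> 0" if "inner (cnj Es, cnj Et) x > 0" for x
    using dir[of "fst x" "snd x"] that by (cases x) (simp add: inner_complex_def)
  ultimately obtain k where "(cnj Hs, cnj Ht) = k *\<^sub>R (cnj Es, cnj Et)"
    using Lagrange_multiplier[of "(cnj Es, cnj Et)" "(cnj Hs, cnj Ht)"] by blast
  then have "cnj (cnj Hs) = cnj (of_real k * cnj Es)" "cnj (cnj Ht) = cnj (of_real k * cnj Et)"
    by (simp_all only: scaleR_prod_def fst_conv snd_conv prod.inject scaleR_conv_of_real)
  then have k: "Hs = of_real k * Es" "Ht = of_real k * Et" by simp_all
  \<comment> \<open>The Lagrange multiplier after the node factors are cancelled and the real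
    coefficients of both gradients are collected.\<close>
  define k' where "k' = k * (Q / NA) * (NB / R)"
  have canc: "x = of_real k' * y" if "of_real (R / NB) * M * x = of_real k * (of_real (Q / NA) * M * y)" "M \<noteq> 0"
    for x y M :: complex
  proof -
    have "M * (complex_of_real (R / NB) * x) = M * (of_real (k * (Q / NA)) * y)"
      using that(1) by (simp add: mult_ac)
    then have "complex_of_real (R / NB) * x = of_real (k * (Q / NA)) * y"
      using that(2) by (simp only: mult_cancel_left) simp
    then have "complex_of_real (NB / R) * (of_real (R / NB) * x) = of_real (NB / R) * (of_real (k * (Q / NA)) * y)" by simp
    then show ?thesis using R NB by (simp add: k'_def mult_ac)
  qed
  have "crit_poly \<beta> R s = of_real k' * crit_poly \<alpha> Q s" "crit_poly \<beta> R t = of_real k' * crit_poly \<alpha> Q t"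
    using canc[OF _ mst(1)] canc[OF _ mst(2)] k unfolding Hs Ht Es Et by blast+
  then have \<beta>: "\<beta> = k' * \<alpha>" and "1 + nsq \<beta> + R = k' * (1 + nsq \<alpha> + Q)"
    using crit_poly_roots[OF s(1) t(1) st s0, of \<beta> R k' \<alpha> Q] by blast+
  \<comment> \<open>In the scalar case \<open>R\<close> is 1 - |\<beta>|^2, so the left side of the
    coefficient equation is 2. This determines the multiplier and yields the relation needed for the
    left inverse.\<close>
  then have "k' * (1 + nsq \<alpha> + Q) = 2" by (simp add: R_def)
  then have k'2: "complex_of_real (k' * (1 + nsq \<alpha> + Q)) = 2" by simp
  have be: "\<beta> * (1 + nsq \<alpha> + q\<^sup>2 * (1 - nsq \<alpha>)) = 2 * \<alpha>"
    unfolding k'2[symmetric] \<beta> Q_def by (simp add: mult_ac)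
  obtain F where F: "F holomorphic_fun_on unit_ball" "F ` unit_ball \<subseteq> cball 0 1"
    "\<And>\<zeta> :: complex. norm \<zeta> < 1 \<Longrightarrow> (\<zeta> * p) *s e1 + (\<zeta> * (q * mob \<alpha> \<zeta>)) *s e2 \<in> unit_ball \<Longrightarrow>
        F ((\<zeta> * p) *s e1 + (\<zeta> * (q * mob \<alpha> \<zeta>)) *s e2) = \<zeta> * mob \<beta> \<zeta>"
    by (rule left_inverse_exists[OF pq(1-4) be pq(5-7)]) blast
  show ?thesis
  proof (rule that[of "\<lambda>x. v * F x"])
    show "(\<lambda>x. v * F x) holomorphic_fun_on unit_ball" by (intro holomorphic_fun_intros F)
    show "(\<lambda>x. v * F x) ` unit_ball \<subseteq> cball 0 1" using F(2) v(1) by (auto simp: image_subset_iff norm_mult)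
    show "v * F 0 = 0" using F(3)[of 0] by simp
    show "v * F z = l" using F(3)[OF s(1)] zw1 unfolding pq(8)[symmetric] v(3) by simp
    show "v * F w = m" using F(3)[OF t(1)] zw1 unfolding pq(9)[symmetric] v(4) by simp
  qed
qed

section \<open>Reduction to analytic discs\<close>

definition pick_solvable :: "(3 \<Rightarrow> complex ^ 'n) \<Rightarrow> (3 \<Rightarrow> complex) \<Rightarrow> bool" where
  "pick_solvable z q \<longleftrightarrow> (\<exists>F. F holomorphic_fun_on unit_ball \<and> F ` unit_ball \<subseteq> cball 0 1 \<and> (\<forall>j. F (z j) = q j))"

text \<open>Solvability of all problems obtained by restricting to analytic discs; a disc need not pass through
  all three points.\<close>

definition disc_solvable :: "(3 \<Rightarrow> complex ^ 'n) \<Rightarrow> (3 \<Rightarrow> complex) \<Rightarrow> bool" where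
  "disc_solvable z q \<longleftrightarrow> (\<forall>f t. f holomorphic_curve_on unit_disc \<longrightarrow> f ` unit_disc \<subseteq> unit_ball \<longrightarrow>
     (\<forall>j. norm (t j) < 1) \<longrightarrow>
     (\<exists>h. h holomorphic_on unit_disc \<and> h ` unit_disc \<subseteq> cball 0 1 \<and> (\<forall>j. f (t j) = z j \<longrightarrow> h (t j) = q j)))"

text \<open>The strict Schwarz-Pick inequality, saying for values in the open disc that the
  two-point subproblem is not extremal. Without division it also makes sense for values on the
  circle.\<close>

definition strict_pair :: "('k \<Rightarrow> complex ^ 'n) \<Rightarrow> ('k \<Rightarrow> complex) \<Rightarrow> 'k \<Rightarrow> 'k \<Rightarrow> bool" where
  "strict_pair z q i j \<longleftrightarrow> (1 - nsq (z i)) * (1 - nsq (z j)) * nsq (1 - q i * cnj (q j))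
     < (1 - nsq (q i)) * (1 - nsq (q j)) * nsq (1 - cinner (z i) (z j))"

lemma strict_pair_commute: "strict_pair z q i j \<longleftrightarrow> strict_pair z q j i"
  unfolding strict_pair_def norm_one_minus_cinner_commute[of "z i" "z j"] norm_one_minus_mult_cnj_commute[of "q i" "q j"]
  by (simp add: mult_ac)

lemma disc_solvableE:
  assumes "disc_solvable z q" "f holomorphic_curve_on unit_disc" "f ` unit_disc \<subseteq> unit_ball" "\<And>j. norm (t j) < 1"
  obtains h where "h holomorphic_on unit_disc" "h ` unit_disc \<subseteq> cball 0 1" "\<And>j. f (t j) = z j \<Longrightarrow> h (t j) = q j"
  using assms unfolding disc_solvable_def by metis

lemma pick_solvable_imp_disc_solvable:
  assumes "pick_solvable z q"
  shows "disc_solvable z q"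
proof -
  obtain F where F: "F holomorphic_fun_on unit_ball" "F ` unit_ball \<subseteq> cball 0 1" "\<And>j. F (z j) = q j"
    using assms unfolding pick_solvable_def by blast
  show ?thesis unfolding disc_solvable_def
  proof (intro allI impI)
    fix f :: "complex \<Rightarrow> complex ^ 'a" and t :: "3 \<Rightarrow> complex"
    assume f: "f holomorphic_curve_on unit_disc" "f ` unit_disc \<subseteq> unit_ball" and "\<forall>j. norm (t j) < 1"
    show "\<exists>h. h holomorphic_on unit_disc \<and> h ` unit_disc \<subseteq> cball 0 1 \<and> (\<forall>j. f (t j) = z j \<longrightarrow> h (t j) = q j)"
      by (rule exI[of _ "\<lambda>t. F (f t)"])
        (use holomorphic_fun_o_curve[OF F(1) f] F(2,3) f(2) in \<open>auto simp: image_subset_iff\<close>)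
  qed
qed

lemma disc_solvable_norm_le:
  assumes "disc_solvable z q" "norm (z j) < 1"
  shows "norm (q j) \<le> 1"
proof -
  have "(\<lambda>_::complex. z j) holomorphic_curve_on unit_disc" by (simp add: holomorphic_curve_on_def)
  then obtain h where "h ` unit_disc \<subseteq> cball 0 1" "h 0 = q j"
    by (rule disc_solvableE[OF assms(1), of "\<lambda>_. z j" "\<lambda>_. 0"]) (use assms(2) in auto)
  then show ?thesis by (metis (no_types) centre_in_ball dist_0_norm image_subset_iff mem_cball zero_less_one)
qed

section \<open>Invariance under automorphisms of the ball and the disc\<close>

lemma disc_solvable_normalise:
  assumes Q: "disc_solvable z q" and a: "norm a < 1" and c: "norm c < 1" and z: "\<And>j. norm (z j) < 1"
  shows "disc_solvable (\<lambda>j. ball_auto a (z j)) (\<lambda>j. mob c (q j))"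
  unfolding disc_solvable_def
proof (intro allI impI)
  fix f :: "complex \<Rightarrow> complex ^ 'a" and t :: "3 \<Rightarrow> complex"
  assume f: "f holomorphic_curve_on unit_disc" "f ` unit_disc \<subseteq> unit_ball" and t: "\<forall>j. norm (t j) < 1"
  obtain h where h: "h holomorphic_on unit_disc" "h ` unit_disc \<subseteq> cball 0 1"
     "\<And>j. ball_auto a (f (t j)) = z j \<Longrightarrow> h (t j) = q j"
  proof (rule disc_solvableE[OF Q, of "\<lambda>x. ball_auto a (f x)" t])
    show "(\<lambda>x. ball_auto a (f x)) holomorphic_curve_on unit_disc" by (rule holomorphic_curve_ball_auto[OF a f])
    show "(\<lambda>x. ball_auto a (f x)) ` unit_disc \<subseteq> unit_ball"
      using f(2) ball_auto_in_ball[OF a refl] by (auto simp: image_subset_iff)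
  qed (use t in auto)
  have "mob c (h (t j)) = mob c (q j)" if "f (t j) = ball_auto a (z j)" for j
    using h(3)[of j] that ball_auto_involution[OF a refl, of "z j"] z[of j] by simp
  then show "\<exists>h. h holomorphic_on unit_disc \<and> h ` unit_disc \<subseteq> cball 0 1 \<and>
     (\<forall>j. f (t j) = ball_auto a (z j) \<longrightarrow> h (t j) = mob c (q j))"
    using holomorphic_mob[OF c h(1,2)] norm_mob_le_1[OF c] h(2)
    by (intro exI[of _ "\<lambda>x. mob c (h x)"]) (auto simp: image_subset_iff)
qed

lemma disc_solvable_normalise_iff:
  assumes a: "norm a < 1" and c: "norm c < 1" and z: "\<And>j. norm (z j) < 1" and q: "\<And>j. norm (q j) \<le> 1"
  shows "disc_solvable (\<lambda>j. ball_auto a (z j)) (\<lambda>j. mob c (q j)) \<longleftrightarrow> disc_solvable z q"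
proof
  assume "disc_solvable (\<lambda>j. ball_auto a (z j)) (\<lambda>j. mob c (q j))"
  then have "disc_solvable (\<lambda>j. ball_auto a (ball_auto a (z j))) (\<lambda>j. mob (- c) (mob c (q j)))"
    using disc_solvable_normalise[of "\<lambda>j. ball_auto a (z j)" "\<lambda>j. mob c (q j)" a "-c"]
      a c ball_auto_in_ball[OF a refl z] by simp
  moreover have "ball_auto a (ball_auto a (z j)) = z j" "mob (- c) (mob c (q j)) = q j" for j
    using ball_auto_involution[OF a refl, of "z j"] z[of j] mob_inverse[OF c q] by auto
  ultimately show "disc_solvable z q" by simp
qed (rule disc_solvable_normalise[OF _ a c z])

lemma pick_solvable_normalise:
  assumes P: "pick_solvable (\<lambda>j. ball_auto a (z j)) (\<lambda>j. mob c (q j))"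
    and a: "norm a < 1" and c: "norm c < 1" and z: "\<And>j. norm (z j) < 1" and q: "\<And>j. norm (q j) \<le> 1"
  shows "pick_solvable z q"
proof -
  obtain F where F: "F holomorphic_fun_on unit_ball" "F ` unit_ball \<subseteq> cball 0 1" "\<And>j. F (ball_auto a (z j)) = mob c (q j)"
    using P unfolding pick_solvable_def by blast
  have c': "norm (- c) < 1" using c by simp
  have sub: "ball_auto a ` unit_ball \<subseteq> unit_ball" using ball_auto_in_ball[OF a refl] by auto
  have "(\<lambda>x. F (ball_auto a x)) holomorphic_fun_on unit_ball"
    by (rule holomorphic_fun_o[OF F(1) holomorphic_fun_ball_auto[OF a] sub])
  then have "(\<lambda>x. mob (- c) (F (ball_auto a x))) holomorphic_fun_on unit_ball"
    unfolding mob_def using one_minus_cnj_mult_neq_0(1)[OF c'] F(2) sub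
    by (intro holomorphic_fun_intros) (auto simp: image_subset_iff)
  moreover have "(\<lambda>x. mob (- c) (F (ball_auto a x))) ` unit_ball \<subseteq> cball 0 1"
    using norm_mob_le_1[OF c'] F(2) sub by (auto simp: image_subset_iff)
  moreover have "mob (- c) (F (ball_auto a (z j))) = q j" for j
    using F(3) mob_inverse[OF c q] by simp
  ultimately show ?thesis unfolding pick_solvable_def by blast
qed

lemma strict_pair_normalise:
  assumes a: "norm a < 1" and c: "norm c < 1" and z: "\<And>j. norm (z j) < 1" and q: "\<And>j. norm (q j) \<le> 1"
  shows "strict_pair (\<lambda>j. ball_auto a (z j)) (\<lambda>j. mob c (q j)) i j \<longleftrightarrow> strict_pair z q i j"
proof -
  define N where "N j = nsq (1 - cinner (z j) a)" for j
  define M where "M j = nsq (1 - cnj c * q j)" for j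
  define A C where "A = 1 - nsq a" and "C = 1 - nsq c"
  have pos: "N j > 0" "M j > 0" "A > 0" "C > 0" for j
    using one_minus_cinner_neq_0[of "z j" a] one_minus_cnj_mult_neq_0[of c "q j"] a c z[of j] q[of j]
    by (auto simp: N_def M_def A_def C_def)
  have 1: "1 - nsq (ball_auto a (z j)) = A * (1 - nsq (z j)) / N j" for j
    using norm_ball_auto[OF a refl, of "z j"] z[of j] by (simp add: A_def N_def)
  have 2: "1 - nsq (mob c (q j)) = C * (1 - nsq (q j)) / M j" for j
    using mob_norm[OF c q] by (simp add: C_def M_def)
  have 3: "nsq (1 - cinner (ball_auto a (z i)) (ball_auto a (z j))) = A\<^sup>2 * nsq (1 - cinner (z i) (z j)) / (N i * N j)"
  proof -
    have "1 - cinner a a = complex_of_real A" by (simp add: A_def cinner_self)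
    then have "norm (1 - cinner a a) = A" using pos(3) by simp
    then have "norm (1 - cinner (ball_auto a (z i)) (ball_auto a (z j))) =
      A * norm (1 - cinner (z i) (z j)) / (norm (1 - cinner (z i) a) * norm (1 - cinner (z j) a))"
      using ball_auto_cinner[OF a refl, of "z i" "z j"] z[of i] z[of j]
      by (simp add: norm_mult norm_divide norm_one_minus_cinner_commute[of a "z j"])
    then show ?thesis by (simp add: N_def power_divide power_mult_distrib)
  qed
  have 4: "nsq (1 - mob c (q i) * cnj (mob c (q j))) = C\<^sup>2 * nsq (1 - q i * cnj (q j)) / (M i * M j)"
  proof -
    have "norm (complex_of_real (1 - nsq c)) = C" using pos(4) unfolding C_def norm_of_real by simp
    moreover have "norm (1 - c * cnj (q j)) = norm (1 - cnj c * q j)"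
      by (simp add: norm_one_minus_mult_cnj_commute[of c "q j"] mult.commute)
    ultimately have "norm (1 - mob c (q i) * cnj (mob c (q j))) =
      C * norm (1 - q i * cnj (q j)) / (norm (1 - cnj c * q i) * norm (1 - cnj c * q j))"
      using mob_kernel[OF c q q] by (simp only: norm_mult norm_divide)
    then show ?thesis by (simp add: M_def power_divide power_mult_distrib)
  qed
  define K where "K = A\<^sup>2 * C\<^sup>2 / (N i * N j * (M i * M j))"
  have K: "K > 0" using pos by (simp add: K_def)
  have gen: "A * x / n * (A * y / n') * (C\<^sup>2 * u / (m * m')) = A\<^sup>2 * C\<^sup>2 / (n * n' * (m * m')) * (x * y * u)"
    "C * x / m * (C * y / m') * (A\<^sup>2 * u / (n * n')) = A\<^sup>2 * C\<^sup>2 / (n * n' * (m * m')) * (x * y * u)"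
    for x y u n n' m m' :: real
    by (simp_all add: power2_eq_square mult_ac)
  show ?thesis
    unfolding strict_pair_def 1 2 3 4 gen K_def[symmetric] using K by (simp add: mult.assoc)
qed

text \<open>The modulus of \<open>r\<close> is chosen as the distance from 0 of the image of
  \<open>y\<close> under the automorphism taking \<open>x\<close> to 0. Then the two-point condition
  holds with equality, and the disc is a complex geodesic.\<close>

lemma pair_geodesic:
  fixes x y :: "complex ^ 'n"
  assumes x: "norm x < 1" and y: "norm y < 1" and "x \<noteq> y"
  obtains f r where "f holomorphic_curve_on unit_disc" "f ` unit_disc \<subseteq> unit_ball" "norm r < 1" "r \<noteq> 0"
    "f 0 = x" "f r = y" "disc_kernel 0 r * nsq (1 - cinner x y) = (1 - nsq x) * (1 - nsq y)"
proof -
  define r where "r = complex_of_real (norm (ball_auto x y))"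
  have r: "norm r < 1" using ball_auto_in_ball[OF x refl y] by (simp add: r_def)
  have "ball_auto x y \<noteq> 0"
    using ball_auto_involution[OF x refl, of y] y \<open>x \<noteq> y\<close> by (metis ball_auto_0 less_imp_le)
  then have r0: "r \<noteq> 0" by (simp add: r_def)
  have "disc_kernel 0 r = (1 - nsq x) * (1 - nsq y) / nsq (1 - cinner y x)"
    using norm_ball_auto[OF x refl, of y] y by (simp add: disc_kernel_def r_def)
  then have eq: "disc_kernel 0 r * nsq (1 - cinner x y) = (1 - nsq x) * (1 - nsq y)"
    using one_minus_cinner_neq_0[of y x] x y by (simp add: norm_one_minus_cinner_commute[of x y])
  obtain f where "f holomorphic_curve_on unit_disc" "f ` unit_disc \<subseteq> unit_ball" "f 0 = x" "f r = y"
    using two_point_Pick_ball[OF x y _ r, of 0] eq r0 by auto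
  then show ?thesis using that r r0 eq by blast
qed

text \<open>On the geodesic through the two points the kernel of the disc is exactly that of the
  ball, so the Schwarz-Pick inequality for the interpolant there is the one claimed.\<close>

lemma disc_solvable_weak_pair:
  assumes Q: "disc_solvable z q" and z: "\<And>j. norm (z j) < 1" "z i \<noteq> z j"
  shows "(1 - nsq (z i)) * (1 - nsq (z j)) * nsq (1 - q i * cnj (q j))
     \<le> (1 - nsq (q i)) * (1 - nsq (q j)) * nsq (1 - cinner (z i) (z j))"
proof -
  obtain f r where f: "f holomorphic_curve_on unit_disc" "f ` unit_disc \<subseteq> unit_ball" "norm r < 1" "r \<noteq> 0"
    "f 0 = z i" "f r = z j" "disc_kernel 0 r * nsq (1 - cinner (z i) (z j)) = (1 - nsq (z i)) * (1 - nsq (z j))"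
    using pair_geodesic[OF z(1) z(1) z(2)] by blast
  define t where "t k = (if k = j then r else 0)" for k
  have ij: "i \<noteq> j" using z(2) by auto
  obtain h where h: "h holomorphic_on unit_disc" "h ` unit_disc \<subseteq> cball 0 1" "\<And>k. f (t k) = z k \<Longrightarrow> h (t k) = q k"
    by (rule disc_solvableE[OF Q f(1,2), of t]) (use f(3) in \<open>auto simp: t_def\<close>)
  have "h 0 = q i" "h r = q j" using h(3)[of i] h(3)[of j] ij f(5,6) by (auto simp: t_def)
  then have "disc_kernel 0 r * nsq (1 - q i * cnj (q j)) \<le> (1 - nsq (q i)) * (1 - nsq (q j))"
    using Schwarz_Pick_disc[OF h(1,2) _ f(3), of 0] by simp
  then have "disc_kernel 0 r * nsq (1 - q i * cnj (q j)) * nsq (1 - cinner (z i) (z j))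
     \<le> (1 - nsq (q i)) * (1 - nsq (q j)) * nsq (1 - cinner (z i) (z j))"
    by (rule mult_right_mono) simp
  then show ?thesis unfolding f(7)[symmetric] by (simp add: mult_ac)
qed

lemma strict_pair_less_1:
  assumes "strict_pair z q i j" "norm (q i) \<le> 1" "norm (q j) \<le> 1" "\<And>j. norm (z j) < 1"
  shows "norm (q i) < 1"
proof (rule ccontr)
  assume "\<not> ?thesis"
  then have 1: "norm (q i) = 1" using assms(2) by simp
  have "0 \<le> (1 - nsq (z i)) * (1 - nsq (z j)) * nsq (1 - q i * cnj (q j))"
    using assms(4)[of i] assms(4)[of j] by (intro mult_nonneg_nonneg) auto
  then show False using assms(1) 1 unfolding strict_pair_def by simp
qed

lemma kernel_identity: "(1 - nsq a) * (1 - nsq b) = nsq (1 - a * cnj b) - nsq (a - b)" for a b :: complex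
proof -
  have "complex_of_real ((1 - nsq a) * (1 - nsq b)) = of_real (nsq (1 - a * cnj b) - nsq (a - b))"
    unfolding of_real_mult of_real_diff complex_norm_square by (simp add: algebra_simps)
  then show ?thesis by (simp only: of_real_eq_iff)
qed

text \<open>Multiplication by \<open>r < 1\<close> strictly contracts the pseudohyperbolic metric
  between distinct points: r^2 |1 - c|^2 < |1 - r^2 c|^2 for |c| < 1. If the values coincide,
  strictness comes from \<open>z i \<noteq> z j\<close>, that is from \<open>G > 0\<close>.\<close>

lemma strict_pair_scale:
  assumes weak: "(1 - nsq (z i)) * (1 - nsq (z j)) * nsq (1 - q i * cnj (q j))
     \<le> (1 - nsq (q i)) * (1 - nsq (q j)) * nsq (1 - cinner (z i) (z j))"
    and q: "norm (q i) < 1" "norm (q j) < 1" and z: "\<And>j. norm (z j) < 1" "z i \<noteq> z j"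
    and r: "0 \<le> r" "r < 1"
  shows "strict_pair z (\<lambda>j. of_real r * q j) i j"
proof -
  define N where "N = nsq (1 - cinner (z i) (z j))"
  define G where "G = N - (1 - nsq (z i)) * (1 - nsq (z j))"
  obtain r' where r': "norm r' < 1" "r' \<noteq> 0" "disc_kernel 0 r' * N = (1 - nsq (z i)) * (1 - nsq (z j))"
    using pair_geodesic[OF z(1) z(1) z(2)] unfolding N_def by metis
  have N: "N > 0" using one_minus_cinner_neq_0[of "z i" "z j"] z(1)[of i] z(1)[of j] by (simp add: N_def)
  have "disc_kernel 0 r' < 1" using r' by (simp add: disc_kernel_def)
  then have "disc_kernel 0 r' * N < 1 * N" using N by (intro mult_strict_right_mono)
  then have G: "G > 0" using r'(3) by (simp add: G_def)
  have zz: "(1 - nsq (z i)) * (1 - nsq (z j)) = N - G" by (simp add: G_def)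
  define c where "c = q i * cnj (q j)"
  have "(N - G) * nsq (1 - c) \<le> (nsq (1 - c) - nsq (q i - q j)) * N"
    using weak unfolding zz kernel_identity N_def[symmetric] c_def[symmetric] .
  then have 1: "N * nsq (q i - q j) \<le> G * nsq (1 - c)" by (simp add: algebra_simps)
  have 2: "r\<^sup>2 * nsq (1 - c) < nsq (1 - of_real (r\<^sup>2) * c)"
  proof -
    have "nsq (1 - of_real (r\<^sup>2) * c) - r\<^sup>2 * nsq (1 - c) = (1 - r\<^sup>2) * (1 - r\<^sup>2 * nsq c)"
      unfolding cmod_power2 by (simp add: algebra_simps power2_eq_square)
    moreover have "r\<^sup>2 < 1" using r by (simp add: abs_square_less_1)
    moreover have "norm c < 1" unfolding c_def norm_mult complex_mod_cnj using q
      by (metis mult.commute mult_left_le_one_le norm_ge_zero order_le_less_trans less_imp_le)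
    then have "r\<^sup>2 * nsq c < 1"
      using \<open>r\<^sup>2 < 1\<close> by (metis mult_le_cancel_right2 norm_sq_less_1_iff order_le_less_trans zero_le_power2 not_less less_imp_le)
    ultimately show ?thesis by (smt (verit) mult_pos_pos)
  qed
  have "N * nsq (of_real r * q i - of_real r * q j) = r\<^sup>2 * (N * nsq (q i - q j))"
    using r by (simp add: norm_mult power_mult_distrib flip: right_diff_distrib)
  also have "\<dots> \<le> r\<^sup>2 * (G * nsq (1 - c))" using 1 by (intro mult_left_mono) auto
  also have "\<dots> = G * (r\<^sup>2 * nsq (1 - c))" by simp
  also have "\<dots> < G * nsq (1 - of_real (r\<^sup>2) * c)" using 2 G by simp
  also have "of_real (r\<^sup>2) * c = (of_real r * q i) * cnj (of_real r * q j)"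
    by (simp add: c_def power2_eq_square mult_ac)
  finally show ?thesis unfolding strict_pair_def kernel_identity[of "of_real r * q i"] zz N_def[symmetric]
    by (simp only: left_diff_distrib) (simp add: mult.commute)
qed

text \<open>A disc cannot take two values at one node. This determinant form of the fact excludes
  that the two nodes collide in a limit.\<close>

lemma pick_det_diagonal_neg:
  fixes z w :: "complex ^ 'n"
  assumes "norm z \<le> norm s" "norm w \<le> norm s" "z \<noteq> w" "norm s < 1"
  shows "ball_det z w s s < 0"
proof -
  define x y d where "x = nsq s - nsq z" and "y = nsq s - nsq w" and "d = nsq (z - w)"
  have xy: "x \<ge> 0" "y \<ge> 0" "d > 0" using assms by (auto simp: x_def y_def d_def power_mono)
  have "d = nsq z + nsq w - 2 * Re (cinner z w)"
  proof -
    have "Re (cinner w z) = Re (cinner z w)" by (metis cnj_cinner complex_cnj(1) complex.sel(1) cnj.simps(1))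
    then show ?thesis unfolding d_def norm_eq_cinner by simp
  qed
  then have Re: "Re (s * cnj s - cinner z w) = (x + y + d) / 2"
    unfolding x_def y_def complex_norm_square[symmetric] by (simp add: field_simps)
  have "x * y < ((x + y + d) / 2)\<^sup>2"
  proof -
    have "((x + y + d) / 2)\<^sup>2 - x * y = ((x - y) / 2)\<^sup>2 + d * (2 * (x + y) + d) / 4"
      by (simp add: field_simps power2_eq_square)
    moreover have "d * (2 * (x + y) + d) / 4 > 0" using xy by simp
    ultimately show ?thesis by (smt (verit) zero_le_power2)
  qed
  also have "\<dots> \<le> nsq (s * cnj s - cinner z w)"
    unfolding Re[symmetric] cmod_power2 by simp
  finally have "x * y < nsq (s * cnj s - cinner z w)" .
  moreover have "disc_kernel s s = 1"
    using disc_kernel_mob[OF assms(4,4)] by simp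
  ultimately have "\<not> 0 \<le> ball_det z w s s"
    unfolding pick_det_nonneg_iff[OF assms(4,4)] x_def y_def by simp
  then show ?thesis by simp
qed

lemma exhaust_3_other: "\<exists>i j. i \<noteq> j \<and> i \<noteq> k \<and> j \<noteq> k \<and> (\<forall>x. x = i \<or> x = j \<or> x = (k::3))"
proof -
  have d: "(1::3) \<noteq> 2" "(1::3) \<noteq> 3" "(2::3) \<noteq> 3" by simp_all
  show ?thesis using exhaust_3[of k] d exhaust_3 by metis
qed

text \<open>A nonnegative determinant for the ball provides a disc through 0 and the two other
  points, and the interpolant on this disc makes the scalar determinant nonnegative.\<close>

lemma disc_solvable_pick_det:
  assumes Q: "disc_solvable z q" and j: "z j = 0" "q j = 0" and d: "i \<noteq> j" "l \<noteq> j" "i \<noteq> l" and z0: "z i \<noteq> 0" "z l \<noteq> 0"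
    and s: "norm s < 1" "norm (z i) \<le> norm s" and t: "norm t < 1" "norm (z l) \<le> norm t" and st: "s \<noteq> t"
    and E: "0 \<le> ball_det (z i) (z l) s t"
  shows "0 \<le> scalar_det (q i) (q l) s t"
proof -
  have s0: "s \<noteq> 0" "t \<noteq> 0" using z0 s t by auto
  obtain f where f: "f holomorphic_curve_on unit_disc" "f ` unit_disc \<subseteq> unit_ball" "f 0 = 0" "f s = z i" "f t = z l"
    using three_point_sufficient_ball[OF s(1) s0(1) t(1) s0(2) st s(2) t(2) E] by blast
  define u where "u k = (if k = i then s else if k = l then t else 0)" for k
  obtain h where h: "h holomorphic_on unit_disc" "h ` unit_disc \<subseteq> cball 0 1" "\<And>k. f (u k) = z k \<Longrightarrow> h (u k) = q k"
    by (rule disc_solvableE[OF Q f(1,2), of u]) (use s t in \<open>auto simp: u_def\<close>)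
  have "h 0 = 0" "h s = q i" "h t = q l"
    using h(3)[of j] h(3)[of i] h(3)[of l] f(3-5) j d by (auto simp: u_def)
  then show ?thesis using three_point_necessary_disc[OF h(1,2) _ s(1) s0(1) t(1) s0(2)] by simp
qed

lemma strict_pair_interpolation:
  assumes sp: "strict_pair z q i j" and z: "\<And>j. norm (z j) < 1" "z i \<noteq> z j" and q: "\<And>j. norm (q j) < 1"
    and f: "f holomorphic_curve_on unit_disc" "f ` unit_disc \<subseteq> unit_ball" and t: "norm s < 1" "norm t < 1" "f s = z i" "f t = z j"
  obtains h where "h holomorphic_on unit_disc" "h ` unit_disc \<subseteq> cball 0 1" "h s = q i" "h t = q j"
proof -
  define N where "N = nsq (1 - cinner (z i) (z j))"
  define M where "M = nsq (1 - q i * cnj (q j))"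
  have N: "N > 0" using one_minus_cinner_neq_0[of "z i" "z j"] z(1)[of i] z(1)[of j] by (simp add: N_def)
  have "disc_kernel s t * N \<le> (1 - nsq (z i)) * (1 - nsq (z j))"
    using Schwarz_Pick_open_ball[OF f t(1,2)] t(3,4) by (simp add: N_def)
  then have "disc_kernel s t * N * M \<le> (1 - nsq (z i)) * (1 - nsq (z j)) * M"
    by (rule mult_right_mono) (simp add: M_def)
  also have "\<dots> < (1 - nsq (q i)) * (1 - nsq (q j)) * N"
    using sp unfolding strict_pair_def N_def M_def .
  finally have "N * (disc_kernel s t * M) \<le> N * ((1 - nsq (q i)) * (1 - nsq (q j)))" by (simp add: mult_ac)
  then have "disc_kernel s t * M \<le> (1 - nsq (q i)) * (1 - nsq (q j))" using N by simp
  moreover have "s \<noteq> t" using t z(2) by auto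
  ultimately obtain g where "g holomorphic_on unit_disc" "g ` unit_disc \<subseteq> ball 0 1" "g s = q i" "g t = q j"
    using two_point_Pick_disc[OF q[of i] q[of j] t(1,2)] unfolding M_def by blast
  then show ?thesis using that[of g] order_trans[OF _ ball_subset_cball] by blast
qed

text \<open>Constants and, by strictness of the pairs, two-point interpolants handle every disc that
  meets at most two of the conditions. A failing disc therefore passes through all three points, and
  with its first node moved to 0 both determinant criteria apply.\<close>

lemma not_disc_solvable_pick_det:
  assumes nQ: "\<not> disc_solvable z q" and z: "\<And>j. norm (z j) < 1" "inj z" and one: "z 1 = 0" "q 1 = 0"
    and sp: "\<And>i j. i \<noteq> j \<Longrightarrow> strict_pair z q i j" and q: "\<And>j. norm (q j) < 1"
  obtains s t where "norm s < 1" "norm t < 1" "norm (z 2) \<le> norm s" "norm (z 3) \<le> norm t" "s \<noteq> t"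
    "0 \<le> ball_det (z 2) (z 3) s t"
    "scalar_det (q 2) (q 3) s t < 0"
proof -
  obtain f :: "complex \<Rightarrow> complex ^ 'a" and u where f': "f holomorphic_curve_on unit_disc" "f ` unit_disc \<subseteq> unit_ball" "\<forall>j. norm (u j) < 1"
    and no': "\<not> (\<exists>h. h holomorphic_on unit_disc \<and> h ` unit_disc \<subseteq> cball 0 1 \<and> (\<forall>j. f (u j) = z j \<longrightarrow> h (u j) = q j))"
    using nQ unfolding disc_solvable_def not_all not_imp by (elim exE conjE) (rule that)
  have f: "f holomorphic_curve_on unit_disc" "f ` unit_disc \<subseteq> unit_ball" "\<And>j. norm (u j) < 1" using f' by auto
  have no: "\<exists>j. f (u j) = z j \<and> h (u j) \<noteq> q j" if "h holomorphic_on unit_disc" "h ` unit_disc \<subseteq> cball 0 1" for h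
    using no' that by auto
  have all: "f (u k) = z k" for k
  proof (rule ccontr)
    assume k: "f (u k) \<noteq> z k"
    obtain i j where ij: "i \<noteq> j" "\<And>x. x = i \<or> x = j \<or> x = k" using exhaust_3_other[of k] by blast
    have "f (u i) = z i"
    proof (rule ccontr)
      assume "f (u i) \<noteq> z i"
      then show False using no[of "\<lambda>_. q j"] k ij(2) q[of j] by (simp add: image_subset_iff) (metis less_imp_le)
    qed
    moreover have "f (u j) = z j"
    proof (rule ccontr)
      assume "f (u j) \<noteq> z j"
      then show False using no[of "\<lambda>_. q i"] k ij(2) q[of i] by (simp add: image_subset_iff) (metis less_imp_le)
    qed
    moreover have "z i \<noteq> z j" using z(2) ij(1) by (auto dest: injD)
    ultimately obtain h where "h holomorphic_on unit_disc" "h ` unit_disc \<subseteq> cball 0 1" "h (u i) = q i" "h (u j) = q j"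
      using strict_pair_interpolation[OF sp[OF ij(1)] z(1) _ q f(1,2) f(3)[of i] f(3)[of j]] by blast
    then show False using no[of h] k ij(2) by metis
  qed
  define c where "c = u 1"
  have c: "norm c < 1" "norm (- c) < 1" using f(3) by (auto simp: c_def)
  define g where "g \<zeta> = f (mob (- c) \<zeta>)" for \<zeta>
  define s t where "s = mob c (u 2)" and "t = mob c (u 3)"
  have st: "norm s < 1" "norm t < 1" using norm_mob_less_1[OF c(1) f(3)] by (auto simp: s_def t_def)
  have hm: "(\<lambda>\<zeta>. mob (- c) \<zeta>) holomorphic_on unit_disc" "(\<lambda>\<zeta>. mob (- c) \<zeta>) ` unit_disc \<subseteq> unit_disc"
    using holomorphic_mob[OF c(2), of "\<lambda>x. x" unit_disc] norm_mob_less_1[OF c(2)] by (auto intro: holomorphic_intros)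
  have g: "g holomorphic_curve_on unit_disc" "g ` unit_disc \<subseteq> unit_ball"
    using curve_o_holomorphic[OF f(1) hm] f(2) hm(2) unfolding g_def by (auto simp: image_subset_iff)
  have gv: "g 0 = 0" "g s = z 2" "g t = z 3"
    using all[of 1] all[of 2] all[of 3] one(1) mob_inverse[OF c(1), of "u 2"] mob_inverse[OF c(1), of "u 3"] f(3)[of 2] f(3)[of 3]
    by (auto simp: g_def s_def t_def c_def)
  have gc: "g ` unit_disc \<subseteq> cball 0 1" using g(2) ball_subset_cball by blast
  have d: "(1::3) \<noteq> 2" "(1::3) \<noteq> 3" "(2::3) \<noteq> 3" by simp_all
  have zd: "z 2 \<noteq> 0" "z 3 \<noteq> 0" "z 2 \<noteq> z 3" using z(2) one(1) d by (metis injD)+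
  have s0: "s \<noteq> 0" "t \<noteq> 0" "s \<noteq> t" using gv zd by auto
  have le: "norm (z 2) \<le> norm s" "norm (z 3) \<le> norm t"
    using Schwarz_ball[OF g(1) gc gv(1) st(1)] Schwarz_ball[OF g(1) gc gv(1) st(2)] gv by auto
  have E: "0 \<le> ball_det (z 2) (z 3) s t"
    using three_point_necessary_ball[OF g(1) gc gv(1) st(1) s0(1) st(2) s0(2)] gv by simp
  have ql: "norm (q 2) \<le> norm s" "norm (q 3) \<le> norm t"
  proof -
    have "nsq (q 2) < nsq (z 2)" "nsq (q 3) < nsq (z 3)"
      using sp[of 1 2] sp[of 1 3] d one unfolding strict_pair_def by simp_all
    then have "norm (q 2) \<le> norm (z 2)" "norm (q 3) \<le> norm (z 3)" by (meson less_imp_le norm_ge_zero power2_le_imp_le)+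
    then show "norm (q 2) \<le> norm s" "norm (q 3) \<le> norm t" using le by auto
  qed
  have "\<not> 0 \<le> scalar_det (q 2) (q 3) s t"
  proof
    assume "0 \<le> scalar_det (q 2) (q 3) s t"
    then obtain h where h: "h holomorphic_on unit_disc" "h ` unit_disc \<subseteq> ball 0 1" "h 0 = 0" "h s = q 2" "h t = q 3"
      using three_point_sufficient_disc[OF st(1) s0(1) st(2) s0(2) s0(3) ql] by blast
    have hm': "(\<lambda>\<zeta>. mob c \<zeta>) holomorphic_on unit_disc" "(\<lambda>\<zeta>. mob c \<zeta>) ` unit_disc \<subseteq> unit_disc"
      using holomorphic_mob[OF c(1), of "\<lambda>x. x" unit_disc] norm_mob_less_1[OF c(1)] by (auto intro: holomorphic_intros)
    have "(\<lambda>\<zeta>. h (mob c \<zeta>)) holomorphic_on unit_disc"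
      using holomorphic_on_compose_gen[OF hm'(1) h(1) hm'(2)] by (simp add: o_def)
    moreover have "(\<lambda>\<zeta>. h (mob c \<zeta>)) ` unit_disc \<subseteq> cball 0 1"
      using h(2) hm'(2) by (auto simp: image_subset_iff less_imp_le)
    ultimately obtain j where "h (mob c (u j)) \<noteq> q j" using no[of "\<lambda>\<zeta>. h (mob c \<zeta>)"] by blast
    moreover have "h (mob c (u j)) = q j"
      using exhaust_3[of j] h(3-5) one(2) by (auto simp: s_def t_def c_def)
    ultimately show False by simp
  qed
  then show ?thesis using that[OF st le s0(3) E] by simp
qed

section \<open>Limits of discs on which interpolation fails\<close>

lemma disc_kernel_tendsto_0:
  assumes "(\<lambda>k. s k) \<longlonglongrightarrow> s0" "(\<lambda>k. t k) \<longlonglongrightarrow> t0" "s0 * cnj t0 \<noteq> 1" "norm s0 = 1 \<or> norm t0 = 1"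
  shows "(\<lambda>k. disc_kernel (s k) (t k)) \<longlonglongrightarrow> 0"
proof -
  have "(\<lambda>k. disc_kernel (s k) (t k)) \<longlonglongrightarrow> (1 - nsq s0) * (1 - nsq t0) / nsq (1 - s0 * cnj t0)"
    unfolding disc_kernel_def using assms(3) by (intro tendsto_intros assms) auto
  then show ?thesis using assms(4) by auto
qed

text \<open>The pair inequalities exclude that the nodes of the approximating discs escape to the circle.\<close>

lemma touching_limit:
  fixes z w :: "complex ^ 'n" and lk mk sk tk :: "nat \<Rightarrow> complex"
  assumes zw: "norm z < 1" "norm w < 1" "z \<noteq> w" 
    and lim: "lk \<longlonglongrightarrow> l" "mk \<longlonglongrightarrow> m" and lm: "norm l < norm z" "norm m < norm w"
    and third: "(1 - nsq z) * (1 - nsq w) * nsq (1 - l * cnj m)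
      < (1 - nsq l) * (1 - nsq m) * nsq (1 - cinner z w)"
    and st: "\<And>k. norm (sk k) < 1" "\<And>k. norm (tk k) < 1" "\<And>k. norm z \<le> norm (sk k)" "\<And>k. norm w \<le> norm (tk k)"
    and E: "\<And>k. 0 \<le> ball_det z w (sk k) (tk k)"
    and H: "\<And>k. scalar_det (lk k) (mk k) (sk k) (tk k) < 0"
  obtains s t where "norm s < 1" "norm t < 1" "norm z \<le> norm s" "norm w \<le> norm t" "s \<noteq> t"
    "0 \<le> ball_det z w s t"
    "scalar_det l m s t \<le> 0"
proof -
  \<comment> \<open>The kernel value is carried along as a third coordinate, because it need not
    converge when both nodes approach the same point of the circle.\<close>
  define K where "K = cball (0::complex) 1 \<times> cball (0::complex) 1 \<times> {0..1::real}"
  have "compact K" unfolding K_def by (intro compact_Times compact_cball compact_Icc)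
  moreover have "(sk k, tk k, disc_kernel (sk k) (tk k)) \<in> K" for k
    using st(1,2)[of k] disc_kernel_pos[OF st(1)[of k] st(2)[of k]] disc_kernel_le_1[OF st(1)[of k] st(2)[of k]]
    by (auto simp: K_def)
  ultimately obtain x r where x: "x \<in> K" "strict_mono (r :: nat \<Rightarrow> nat)"
    "((\<lambda>k. (sk k, tk k, disc_kernel (sk k) (tk k))) \<circ> r) \<longlonglongrightarrow> x"
    unfolding compact_def by meson
  obtain s t n where xe: "x = (s, t, n)" by (cases x) auto
  have S: "(\<lambda>k. sk (r k)) \<longlonglongrightarrow> s" and T: "(\<lambda>k. tk (r k)) \<longlonglongrightarrow> t"
    and N: "(\<lambda>k. disc_kernel (sk (r k)) (tk (r k))) \<longlonglongrightarrow> n"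
    using tendsto_fst[OF x(3)] tendsto_fst[OF tendsto_snd[OF x(3)]] tendsto_snd[OF tendsto_snd[OF x(3)]]
    by (simp_all add: xe o_def)
  have L: "(\<lambda>k. lk (r k)) \<longlonglongrightarrow> l" and M: "(\<lambda>k. mk (r k)) \<longlonglongrightarrow> m"
    using LIMSEQ_subseq_LIMSEQ[OF lim(1) x(2)] LIMSEQ_subseq_LIMSEQ[OF lim(2) x(2)] by (simp_all add: o_def)
  have st1: "norm s \<le> 1" "norm t \<le> 1" using x(1) by (auto simp: K_def xe)
  have zs: "norm z \<le> norm s" by (rule LIMSEQ_le_const[OF tendsto_norm[OF S]]) (use st(3) in auto)
  have wt: "norm w \<le> norm t" by (rule LIMSEQ_le_const[OF tendsto_norm[OF T]]) (use st(4) in auto)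
  have E': "n * nsq (s * cnj t - cinner z w) \<le> (nsq s - nsq z) * (nsq t - nsq w)"
  proof (rule LIMSEQ_le)
    show "(\<lambda>k. disc_kernel (sk (r k)) (tk (r k)) * nsq (sk (r k) * cnj (tk (r k)) - cinner z w))
      \<longlonglongrightarrow> n * nsq (s * cnj t - cinner z w)" by (intro tendsto_intros S T N)
    show "(\<lambda>k. (nsq (sk (r k)) - nsq z) * (nsq (tk (r k)) - nsq w))
      \<longlonglongrightarrow> (nsq s - nsq z) * (nsq t - nsq w)" by (intro tendsto_intros S T)
    show "\<exists>N. \<forall>k\<ge>N. disc_kernel (sk (r k)) (tk (r k)) * nsq (sk (r k) * cnj (tk (r k)) - cinner z w)
       \<le> (nsq (sk (r k)) - nsq z) * (nsq (tk (r k)) - nsq w)"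
      using E pick_det_nonneg_iff[OF st(1) st(2)] by blast
  qed
  have H': "(nsq s - nsq l) * (nsq t - nsq m) \<le> n * nsq (s * cnj t - l * cnj m)"
  proof (rule LIMSEQ_le)
    show "(\<lambda>k. disc_kernel (sk (r k)) (tk (r k)) * nsq (sk (r k) * cnj (tk (r k)) - lk (r k) * cnj (mk (r k))))
      \<longlonglongrightarrow> n * nsq (s * cnj t - l * cnj m)" by (intro tendsto_intros S T N L M)
    show "(\<lambda>k. (nsq (sk (r k)) - nsq (lk (r k))) * (nsq (tk (r k)) - nsq (mk (r k))))
      \<longlonglongrightarrow> (nsq s - nsq l) * (nsq t - nsq m)" by (intro tendsto_intros S T L M)
    have "\<not> 0 \<le> scalar_det (lk k) (mk k) (sk k) (tk k)" for k
      using H[of k] by simp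
    then show "\<exists>N. \<forall>k\<ge>N. (nsq (sk (r k)) - nsq (lk (r k))) * (nsq (tk (r k)) - nsq (mk (r k)))
      \<le> disc_kernel (sk (r k)) (tk (r k)) * nsq (sk (r k) * cnj (tk (r k)) - lk (r k) * cnj (mk (r k)))"
      unfolding pick_det_nonneg_iff[OF st(1) st(2)] by (meson not_le less_imp_le)
  qed
  have lm2: "nsq l < nsq s" "nsq m < nsq t"
    using lm zs wt by (auto intro!: power_strict_mono)
  have pos: "(nsq s - nsq l) * (nsq t - nsq m) > 0" using lm2 by simp
  then have n0: "n \<noteq> 0" using H' by auto
  \<comment> \<open>A limit node on the circle sends the kernel to 0 unless the two nodes approach
    the same boundary point, while \<open>n = 0\<close> contradicts the strict bounds on
    \<open>l\<close> and \<open>m\<close>.\<close>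
  have stn: "s * cnj t = 1" if "norm s = 1 \<or> norm t = 1"
  proof (rule ccontr)
    assume "s * cnj t \<noteq> 1"
    then have "n = 0" using disc_kernel_tendsto_0[OF S T _ that] N LIMSEQ_unique by blast
    then show False using n0 by simp
  qed
  have inner: "norm s < 1 \<and> norm t < 1"
  proof (rule ccontr)
    assume "\<not> ?thesis"
    then have or: "norm s = 1 \<or> norm t = 1" using st1 by auto
    then have e: "s * cnj t = 1" by (rule stn)
    then have "norm s * norm t = 1" by (metis complex_mod_cnj norm_mult norm_one)
    then have b: "norm s = 1" "norm t = 1" using or by auto
    \<comment> \<open>At a common boundary point both limit inequalities involve the same number
      \<open>n\<close>; eliminating it reverses \<open>third\<close>.\<close>
    have "(1 - nsq l) * (1 - nsq m) * nsq (1 - cinner z w)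
       \<le> n * nsq (1 - l * cnj m) * nsq (1 - cinner z w)"
      using H' unfolding e b by (intro mult_right_mono) auto
    also have "\<dots> = n * nsq (1 - cinner z w) * nsq (1 - l * cnj m)" by simp
    also have "\<dots> \<le> (1 - nsq z) * (1 - nsq w) * nsq (1 - l * cnj m)"
      using E' unfolding e b by (intro mult_right_mono) auto
    finally show False using third by simp
  qed
  then have i: "norm s < 1" "norm t < 1" by auto
  have nst: "n = disc_kernel s t"
  proof -
    have "1 - s * cnj t \<noteq> 0" using one_minus_cnj_mult_neq_0[OF i(2), of s] i by auto
    then have "(\<lambda>k. disc_kernel (sk (r k)) (tk (r k))) \<longlonglongrightarrow> disc_kernel s t"
      unfolding disc_kernel_def by (intro tendsto_intros S T) auto
    then show ?thesis using N LIMSEQ_unique by blast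
  qed
  have E2: "0 \<le> ball_det z w s t"
    using E' unfolding pick_det_nonneg_iff[OF i] nst .
  have H2: "scalar_det l m s t \<le> 0"
    using H' unfolding pick_det_kernel[OF i] nst by (intro mult_nonneg_nonpos) auto
  have "s \<noteq> t" using pick_det_diagonal_neg[of z s w] zs wt zw(3) i E2 by auto
  then show ?thesis using that[OF i zs wt _ E2 H2] by blast
qed

text \<open>The numerator is a quadratic whose zeros lie in the disc: a zero with |x| \<ge> 1 would
  satisfy |x| |x - \<beta>| = |c| |1 - cnj \<beta> x|, although |1 - cnj \<beta> x| \<le> |x -
  \<beta>| and |c| < 1. The denominator is its reciprocal polynomial.\<close>

lemma blaschke_product_mob:
  assumes v: "norm v = 1" and \<beta>: "norm \<beta> < 1" and c: "norm c < 1"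
  shows "blaschke_product 2 (\<lambda>\<zeta>. mob (- c) (\<zeta> * (v * mob \<beta> \<zeta>)))"
proof -
  \<comment> \<open>Sum of the zeros, after the numerator is divided by its leading coefficient
    \<open>v\<close>; their product is \<open>c * cnj v\<close>, and \<open>r\<close> is a square
    root of the discriminant.\<close>
  define S where "S = \<beta> + c * cnj v * cnj \<beta>"
  define r where "r = csqrt (S\<^sup>2 - 4 * (c * cnj v))"
  have r: "r * r = S\<^sup>2 - 4 * (c * cnj v)" unfolding r_def by (metis power2_csqrt power2_eq_square)
  define a where "a k = (if k = 0 then (S + r) / 2 else (S - r) / 2)" for k :: nat
  have vv: "v * cnj v = 1" using complex_norm_square[of v] v by simp
  have v0: "v \<noteq> 0" using v by auto
  have sum: "a 0 + a 1 = S" by (simp add: a_def field_simps)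
  have prod: "a 0 * a 1 = c * cnj v"
  proof -
    have "a 0 * a 1 = (S\<^sup>2 - r * r) / 4" by (simp add: a_def field_simps power2_eq_square)
    then show ?thesis unfolding r by simp
  qed
  have fac: "v * ((\<zeta> - a 0) * (\<zeta> - a 1)) = v * \<zeta> * (\<zeta> - \<beta>) + c * (1 - cnj \<beta> * \<zeta>)" for \<zeta>
  proof -
    have "v * ((\<zeta> - a 0) * (\<zeta> - a 1)) = v * (\<zeta>\<^sup>2 - (a 0 + a 1) * \<zeta> + a 0 * a 1)"
      by (simp add: algebra_simps power2_eq_square)
    also have "\<dots> = v * \<zeta> * (\<zeta> - \<beta>) + (v * cnj v) * c * (1 - cnj \<beta> * \<zeta>)"
      unfolding sum prod S_def by (simp add: algebra_simps power2_eq_square)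
    finally show ?thesis unfolding vv by simp
  qed
  have fac': "(1 - cnj (a 0) * \<zeta>) * (1 - cnj (a 1) * \<zeta>) = (1 - cnj \<beta> * \<zeta>) + cnj c * (v * \<zeta> * (\<zeta> - \<beta>))" for \<zeta>
  proof -
    have "(1 - cnj (a 0) * \<zeta>) * (1 - cnj (a 1) * \<zeta>) = 1 - cnj (a 0 + a 1) * \<zeta> + cnj (a 0 * a 1) * \<zeta>\<^sup>2"
      by (simp add: algebra_simps power2_eq_square)
    then show ?thesis unfolding sum prod S_def by (simp add: algebra_simps power2_eq_square)
  qed
  have root: "norm x < 1" if "v * x * (x - \<beta>) + c * (1 - cnj \<beta> * x) = 0" for x
  proof (rule ccontr)
    assume "\<not> norm x < 1"
    then have x: "norm x \<ge> 1" by simp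
    have "v * x * (x - \<beta>) = - (c * (1 - cnj \<beta> * x))" using that by (simp add: eq_neg_iff_add_eq_0)
    then have "norm (v * x * (x - \<beta>)) = norm (c * (1 - cnj \<beta> * x))" by (metis norm_minus_cancel)
    then have n: "norm x * norm (x - \<beta>) = norm c * norm (1 - cnj \<beta> * x)" by (simp add: norm_mult v)
    have "nsq (1 - cnj \<beta> * x) - nsq (x - \<beta>) = (1 - nsq x) * (1 - nsq \<beta>)"
      using kernel_identity[of x \<beta>] by (simp add: mult.commute)
    also have "\<dots> \<le> 0" using x \<beta> by (intro mult_nonpos_nonneg) (auto simp: less_imp_le)
    finally have "nsq (1 - cnj \<beta> * x) \<le> nsq (x - \<beta>)" by linarith
    then have le: "norm (1 - cnj \<beta> * x) \<le> norm (x - \<beta>)" by (rule power2_le_imp_le) simp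
    have "norm (x - \<beta>) > 0" using x \<beta> by auto
    moreover have "norm c * norm (1 - cnj \<beta> * x) \<le> norm c * norm (x - \<beta>)" using le by (intro mult_left_mono) auto
    moreover have "1 * norm (x - \<beta>) \<le> norm x * norm (x - \<beta>)" using x by (intro mult_right_mono) auto
    ultimately have "norm (x - \<beta>) \<le> norm c * norm (x - \<beta>)" using n by linarith
    then show False using c \<open>norm (x - \<beta>) > 0\<close> by simp
  qed
  have an: "norm (a k) < 1" if "k < 2" for k
  proof -
    have "k = 0 \<or> k = 1" using that by auto
    then have "v * a k * (a k - \<beta>) + c * (1 - cnj \<beta> * a k) = 0" using fac[of "a k"] by auto
    then show ?thesis by (rule root)
  qed
  have "mob (- c) (\<zeta> * (v * mob \<beta> \<zeta>)) = v * (\<Prod>k<2. (\<zeta> - a k) / (1 - cnj (a k) * \<zeta>))" if \<zeta>: "norm \<zeta> < 1" for \<zeta>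
  proof -
    have n: "1 - cnj \<beta> * \<zeta> \<noteq> 0" using one_minus_cnj_mult_neq_0(1)[OF \<beta>] \<zeta> by simp
    have "\<zeta> * (v * mob \<beta> \<zeta>) = v * \<zeta> * (\<zeta> - \<beta>) / (1 - cnj \<beta> * \<zeta>)" by (simp add: mob_def)
    then have "mob (- c) (\<zeta> * (v * mob \<beta> \<zeta>)) = (v * \<zeta> * (\<zeta> - \<beta>) / (1 - cnj \<beta> * \<zeta>) + c) / (1 + cnj c * (v * \<zeta> * (\<zeta> - \<beta>) / (1 - cnj \<beta> * \<zeta>)))"
      by (simp add: mob_def[of "- c"])
    also have "v * \<zeta> * (\<zeta> - \<beta>) / (1 - cnj \<beta> * \<zeta>) + c = (v * ((\<zeta> - a 0) * (\<zeta> - a 1))) / (1 - cnj \<beta> * \<zeta>)"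
      unfolding fac using n by (simp add: add_divide_distrib)
    also have "1 + cnj c * (v * \<zeta> * (\<zeta> - \<beta>) / (1 - cnj \<beta> * \<zeta>)) = ((1 - cnj (a 0) * \<zeta>) * (1 - cnj (a 1) * \<zeta>)) / (1 - cnj \<beta> * \<zeta>)"
      unfolding fac' using n by (simp add: add_divide_distrib)
    finally show ?thesis using n by (simp add: numeral_2_eq_2)
  qed
  then show ?thesis unfolding blaschke_product_def using v an by (intro exI[of _ v] exI[of _ a]) auto
qed

text \<open>The degenerate position of the points. \<open>P\<close> inverts \<open>f\<close> at the
  three points, so a solution on the disc followed after \<open>P\<close> solves the problem on the
  ball.\<close>

definition on_geodesic :: "(3 \<Rightarrow> complex ^ 'n) \<Rightarrow> bool" where
  "on_geodesic z \<longleftrightarrow> (\<exists>f P t. f holomorphic_curve_on unit_disc \<and> f ` unit_disc \<subseteq> unit_ball \<and>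
     P holomorphic_fun_on unit_ball \<and> P ` unit_ball \<subseteq> unit_disc \<and>
     (\<forall>j. norm (t j) < 1 \<and> f (t j) = z j \<and> P (z j) = t j))"

lemma on_geodesic_pick_solvable:
  assumes "on_geodesic z" "disc_solvable z q"
  shows "pick_solvable z q"
proof -
  obtain f P t where f': "f holomorphic_curve_on unit_disc" "f ` unit_disc \<subseteq> unit_ball"
     "P holomorphic_fun_on unit_ball" "P ` unit_ball \<subseteq> unit_disc" "\<forall>j. norm (t j) < 1 \<and> f (t j) = z j \<and> P (z j) = t j"
    using assms(1) unfolding on_geodesic_def by blast
  have f: "f holomorphic_curve_on unit_disc" "f ` unit_disc \<subseteq> unit_ball"
     "P holomorphic_fun_on unit_ball" "P ` unit_ball \<subseteq> unit_disc" "\<And>j. norm (t j) < 1" "\<And>j. f (t j) = z j" "\<And>j. P (z j) = t j"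
    using f' by auto
  obtain h where h: "h holomorphic_on unit_disc" "h ` unit_disc \<subseteq> cball 0 1" "\<And>j. f (t j) = z j \<Longrightarrow> h (t j) = q j"
    by (rule disc_solvableE[OF assms(2) f(1,2), of t]) (use f(5) in \<open>auto intro: that\<close>)
  have "(\<lambda>x. h (P x)) holomorphic_fun_on unit_ball" by (rule holomorphic_fun_compose[OF f(3) h(1) open_ball f(4)])
  moreover have "(\<lambda>x. h (P x)) ` unit_ball \<subseteq> cball 0 1" using h(2) f(4) by (auto simp: image_subset_iff)
  ultimately show ?thesis unfolding pick_solvable_def using h(3) f(6,7)
    by (intro exI[of _ "\<lambda>x. h (P x)"]) auto
qed

text \<open>Equality in the Cauchy-Schwarz inequality would place the normalised points on one
  complex line through 0, and the coordinate on that line would be a left inverse.\<close>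

lemma not_on_geodesic_cinner:
  assumes nc: "\<not> on_geodesic z" and z: "\<And>j. norm (z j) < 1" "inj z" and d: "i \<noteq> j" "l \<noteq> j" "\<And>x. x = i \<or> x = j \<or> x = l"
  shows "norm (cinner (ball_auto (z j) (z i)) (ball_auto (z j) (z l)))
     < norm (ball_auto (z j) (z i)) * norm (ball_auto (z j) (z l))"
proof (rule ccontr)
  define a where "a = z j"
  have a: "norm a < 1" using z(1) by (simp add: a_def)
  define Z W where "Z = ball_auto a (z i)" and "W = ball_auto a (z l)"
  assume "\<not> ?thesis"
  then have eq: "norm (cinner Z W) = norm Z * norm W"
    using norm_cinner_le[of Z W] by (simp add: Z_def W_def a_def)
  have inv: "ball_auto a (ball_auto a (z k)) = z k" for k
    using ball_auto_involution[OF a refl, of "z k"] z(1)[of k] by simp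
  have ZW1: "norm Z < 1" "norm W < 1" using ball_auto_in_ball[OF a refl z(1)] by (auto simp: Z_def W_def)
  have Z0: "Z \<noteq> 0"
  proof
    assume "Z = 0"
    then have "z i = a" using inv[of i] by (simp add: Z_def)
    then show False using z(2) d(1) by (simp add: a_def inj_eq)
  qed
  define e where "e = (1 / of_real (norm Z)) *s Z"
  have e: "norm e = 1" using Z0 by (simp add: e_def norm_scale_complex norm_divide)
  have Ze: "Z = of_real (norm Z) *s e" using Z0 by (simp add: e_def)
  have "norm (cinner Z W) = norm Z * norm (cinner e W)" by (subst Ze) (simp add: norm_mult)
  then have "norm (cinner e W) = norm W" using eq Z0 by simp
  then have "norm W \<le> norm (cinner W e)" by (metis cnj_cinner complex_mod_cnj order_refl)
  then have We: "W = cinner W e *s e" by (rule cinner_eq_imp_scale[OF refl e])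
  define t where "t k = cinner (ball_auto a (z k)) e" for k
  have te: "ball_auto a (z k) = t k *s e" for k
  proof -
    consider "k = i" | "k = j" | "k = l" using d(3) by blast
    then show ?thesis
    proof cases
      case 1
      have "cinner Z e = of_real (norm Z)" by (subst Ze) (simp add: cinner_self e)
      then show ?thesis using Ze 1 by (simp add: t_def Z_def)
    next
      case 2
      then show ?thesis using a by (simp add: t_def a_def)
    next
      case 3
      then show ?thesis using We by (simp add: t_def W_def)
    qed
  qed
  have P1: "norm (cinner x e) < 1" if "norm x < 1" for x
    using norm_cinner_le[of x e] e that by simp
  have t1: "norm (t k) < 1" for k unfolding t_def using P1 ball_auto_in_ball[OF a refl z(1)] by blast
  have c: "(\<lambda>\<zeta>. \<zeta> *s e) holomorphic_curve_on unit_disc" "(\<lambda>\<zeta>. \<zeta> *s e) ` unit_disc \<subseteq> unit_ball"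
    using e by (auto simp: holomorphic_curve_on_def norm_scale_complex intro!: holomorphic_intros)
  have sub: "ball_auto a ` unit_ball \<subseteq> unit_ball" using ball_auto_in_ball[OF a refl] by auto
  have "on_geodesic z"
    unfolding on_geodesic_def
  proof (intro exI conjI allI)
    show "(\<lambda>\<zeta>. ball_auto a (\<zeta> *s e)) holomorphic_curve_on unit_disc" by (rule holomorphic_curve_ball_auto[OF a c])
    show "(\<lambda>\<zeta>. ball_auto a (\<zeta> *s e)) ` unit_disc \<subseteq> unit_ball" using sub c(2) by (auto simp: image_subset_iff)
    show "(\<lambda>x. cinner (ball_auto a x) e) holomorphic_fun_on unit_ball"
      by (rule holomorphic_fun_o[OF holomorphic_fun_cinner holomorphic_fun_ball_auto[OF a] sub])
    show "(\<lambda>x. cinner (ball_auto a x) e) ` unit_ball \<subseteq> unit_disc" using sub P1 by (auto simp: image_subset_iff)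
    show "norm (t k) < 1" "ball_auto a (t k *s e) = z k" "cinner (ball_auto a (z k)) e = t k" for k
      using t1 te[of k] inv[of k] by (auto simp: t_def)
  qed
  then show False using nc by simp
qed

lemma tendsto_mob:
  assumes "(x \<longlongrightarrow> a) G" "(y \<longlongrightarrow> b) G" "norm a < 1" "norm b \<le> 1"
  shows "((\<lambda>k. mob (x k) (y k)) \<longlongrightarrow> mob a b) G"
  unfolding mob_def using one_minus_cnj_mult_neq_0[OF assms(3,4)] by (intro tendsto_intros assms) auto

lemma eventually_strict_pair:
  assumes "strict_pair z q i j" "\<And>j. ((\<lambda>k. qk k j) \<longlongrightarrow> q j) G"
  shows "\<forall>\<^sub>F k in G. strict_pair z (qk k) i j"
proof -
  have "((\<lambda>k. (1 - nsq (qk k i)) * (1 - nsq (qk k j)) * nsq (1 - cinner (z i) (z j))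
     - (1 - nsq (z i)) * (1 - nsq (z j)) * nsq (1 - qk k i * cnj (qk k j))) \<longlongrightarrow>
    (1 - nsq (q i)) * (1 - nsq (q j)) * nsq (1 - cinner (z i) (z j))
     - (1 - nsq (z i)) * (1 - nsq (z j)) * nsq (1 - q i * cnj (q j))) G"
    by (intro tendsto_intros assms)
  then have "\<forall>\<^sub>F k in G. 0 < (1 - nsq (qk k i)) * (1 - nsq (qk k j)) * nsq (1 - cinner (z i) (z j))
     - (1 - nsq (z i)) * (1 - nsq (z j)) * nsq (1 - qk k i * cnj (qk k j))"
    by (rule order_tendstoD) (use assms(1) in \<open>simp add: strict_pair_def\<close>)
  then show ?thesis by eventually_elim (simp add: strict_pair_def)
qed

text \<open>The unsolvable problems near \<open>q\<close> supply nodes with violated scalar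
  determinant, and these nodes have a limit by \<open>touching_limit\<close>. Solvability of
  \<open>q\<close> on discs makes the limiting scalar determinant zero, so interpolation there is by
  a Blaschke product. The disc serves the forward implication and the interior argument near extreme
  points, the last conclusion the approximation.\<close>

lemma touching_disc:
  fixes z :: "3 \<Rightarrow> complex ^ 'n"
  assumes z: "\<And>j. norm (z j) < 1" "inj z" and Q: "disc_solvable z q"
    and sp: "\<And>i j. i \<noteq> j \<Longrightarrow> strict_pair z q i j"
    and nQ: "\<And>k::nat. \<not> disc_solvable z (qk k)" and lim: "\<And>j. (\<lambda>k. qk k j) \<longlonglongrightarrow> q j"
  obtains f t B where "f holomorphic_curve_on unit_disc" "f ` unit_disc \<subseteq> unit_ball" "\<And>j. norm (t j) < 1" "\<And>j. f (t j) = z j"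
    "blaschke_product 2 B" "\<And>j. B (t j) = q j" "\<not> on_geodesic z \<Longrightarrow> pick_solvable z q"
proof -
  have d: "(1::3) \<noteq> 2" "(1::3) \<noteq> 3" "(2::3) \<noteq> 3" "(2::3) \<noteq> 1" "(3::3) \<noteq> 1" by simp_all
  have q1: "norm (q j) < 1" for j
  proof -
    obtain i where "j \<noteq> i" using exhaust_3_other[of j] by metis
    then show ?thesis using strict_pair_less_1[OF sp[OF \<open>j \<noteq> i\<close>]] disc_solvable_norm_le[OF Q z(1)] z(1) by blast
  qed
  have "\<forall>\<^sub>F k in sequentially. norm (qk k j) < 1" for j
    using order_tendstoD(2)[OF tendsto_norm[OF lim[of j]]] q1 by blast
  then have ev1: "\<forall>\<^sub>F k in sequentially. \<forall>j. norm (qk k j) < 1" by (simp add: eventually_all_finite)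
  have "\<forall>\<^sub>F k in sequentially. i \<noteq> j \<longrightarrow> strict_pair z (qk k) i j" for i j
    using eventually_strict_pair[OF sp lim, of i j] by (cases "i = j") auto
  then have ev2: "\<forall>\<^sub>F k in sequentially. \<forall>i j. i \<noteq> j \<longrightarrow> strict_pair z (qk k) i j" by (simp add: eventually_all_finite)
  obtain k0 where k0: "\<And>k j. k \<ge> k0 \<Longrightarrow> norm (qk k j) < 1" "\<And>k i j. k \<ge> k0 \<Longrightarrow> i \<noteq> j \<Longrightarrow> strict_pair z (qk k) i j"
    using eventually_conj[OF ev1 ev2] unfolding eventually_sequentially by blast
  define a where "a = z 1"
  \<comment> \<open>Dropping initial terms makes the strict pair inequalities available for every
    index.\<close>
  define p where "p k = qk (k + k0)" for k
  have p: "norm (p k j) < 1" "i \<noteq> j \<Longrightarrow> strict_pair z (p k) i j" "\<not> disc_solvable z (p k)" for k i j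
    using k0(1)[of "k+k0"] k0(2)[of "k+k0"] nQ by (auto simp: p_def)
  have plim: "(\<lambda>k. p k j) \<longlonglongrightarrow> q j" for j unfolding p_def by (rule LIMSEQ_ignore_initial_segment[OF lim])
  have a: "norm a < 1" using z(1) by (simp add: a_def)
  define Z where "Z j = ball_auto a (z j)" for j
  define l where "l j = mob (q 1) (q j)" for j
  \<comment> \<open>Each approximating problem is normalised by its own first value, so that this
    value becomes exactly 0 before the limit is taken.\<close>
  define lk where "lk k j = mob (p k 1) (p k j)" for k j
  have Z1: "norm (Z j) < 1" for j using ball_auto_in_ball[OF a refl z(1)] by (simp add: Z_def)
  have inv: "ball_auto a (Z j) = z j" for j
    unfolding Z_def using ball_auto_involution[OF a refl, of "z j"] z(1)[of j] by simp
  have injZ: "inj Z"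
  proof (rule injI)
    fix x y assume "Z x = Z y"
    then have "z x = z y" using inv by metis
    then show "x = y" using z(2) by (simp add: inj_eq)
  qed
  have Zone: "Z 1 = 0" using a by (simp add: Z_def a_def)
  have Z0: "Z 2 \<noteq> 0" "Z 3 \<noteq> 0" "Z 2 \<noteq> Z 3" using injZ Zone d by (metis injD)+
  have l1: "norm (l j) < 1" for j using norm_mob_less_1[OF q1 q1] by (simp add: l_def)
  have lone: "l 1 = 0" by (simp add: l_def)
  have ql: "norm (q j) \<le> 1" and pl: "norm (p k j) \<le> 1" for k j using q1[of j] p(1)[of k j] by auto
  have Zeq: "Z = (\<lambda>j. ball_auto a (z j))" "l = (\<lambda>j. mob (q 1) (q j))" "\<And>k. lk k = (\<lambda>j. mob (p k 1) (p k j))"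
    by (auto simp: Z_def l_def lk_def)
  have QZ: "disc_solvable Z l" unfolding Zeq by (rule disc_solvable_normalise[OF Q a q1 z(1)])
  have spZ: "strict_pair Z l i j" if "i \<noteq> j" for i j
    unfolding Zeq strict_pair_normalise[OF a q1 z(1) ql] using sp that by blast
  have nQZ: "\<not> disc_solvable Z (lk k)" for k
    unfolding Zeq disc_solvable_normalise_iff[OF a p(1) z(1) pl] by (rule p(3))
  have spk: "strict_pair Z (lk k) i j" if "i \<noteq> j" for i j k
    unfolding Zeq strict_pair_normalise[OF a p(1) z(1) pl] using p(2) that by blast
  have lk1: "norm (lk k j) < 1" for k j using norm_mob_less_1[OF p(1) p(1)] by (simp add: lk_def)
  define A where "A k s t \<longleftrightarrow> norm s < 1 \<and> norm t < 1 \<and> norm (Z 2) \<le> norm s \<and> norm (Z 3) \<le> norm t \<and>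
    0 \<le> ball_det (Z 2) (Z 3) s t \<and>
    scalar_det (lk k 2) (lk k 3) s t < 0" for k s t
  have "\<exists>s t. A k s t" for k
    unfolding A_def by (rule not_disc_solvable_pick_det[OF nQZ[of k] Z1 injZ Zone _ spk lk1]) (auto simp: lk_def)
  then obtain sk tk where A: "\<And>k. A k (sk k) (tk k)" by metis
  have skt: "\<And>k. norm (sk k) < 1" "\<And>k. norm (tk k) < 1" "\<And>k. norm (Z 2) \<le> norm (sk k)" "\<And>k. norm (Z 3) \<le> norm (tk k)"
    "\<And>k. 0 \<le> ball_det (Z 2) (Z 3) (sk k) (tk k)"
    "\<And>k. scalar_det (lk k 2) (lk k 3) (sk k) (tk k) < 0"
    using A unfolding A_def by auto
  have lkl: "(\<lambda>k. lk k j) \<longlonglongrightarrow> l j" for j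
    unfolding lk_def l_def by (intro tendsto_mob plim q1 ql)
  have lZ: "norm (l j) < norm (Z j)" if "1 \<noteq> j" for j
  proof -
    have "nsq (l j) < nsq (Z j)" using spZ[OF that] Zone lone unfolding strict_pair_def by simp
    then show ?thesis by (rule power2_less_imp_less) simp
  qed
  have third: "(1 - nsq (Z 2)) * (1 - nsq (Z 3)) * nsq (1 - l 2 * cnj (l 3))
      < (1 - nsq (l 2)) * (1 - nsq (l 3)) * nsq (1 - cinner (Z 2) (Z 3))"
    using spZ[OF d(3)] unfolding strict_pair_def .
  obtain s t where st: "norm s < 1" "norm t < 1" "norm (Z 2) \<le> norm s" "norm (Z 3) \<le> norm t" "s \<noteq> t"
    and E: "0 \<le> ball_det (Z 2) (Z 3) s t"
    and H: "scalar_det (l 2) (l 3) s t \<le> 0"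
    using touching_limit[OF Z1 Z1 Z0(3) lkl lkl lZ[OF d(1)] lZ[OF d(2)] third skt] by blast
  have ineq: "0 \<le> scalar_det (l 2) (l 3) s t"
    if "norm s < 1" "norm (Z 2) \<le> norm s" "norm t < 1" "norm (Z 3) \<le> norm t" "s \<noteq> t"
      "0 \<le> ball_det (Z 2) (Z 3) s t" for s t
    by (rule disc_solvable_pick_det[OF QZ Zone lone d(4,5,3) Z0(1,2) that])
  have H0: "scalar_det (l 2) (l 3) s t = 0"
    using H ineq[OF st(1,3,2,4,5) E] by linarith
  have s0: "s \<noteq> 0" "t \<noteq> 0" using st Z0 by auto
  obtain f where f: "f holomorphic_curve_on unit_disc" "f ` unit_disc \<subseteq> unit_ball" "f 0 = 0" "f s = Z 2" "f t = Z 3"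
    using three_point_sufficient_ball[OF st(1) s0(1) st(2) s0(2) st(5,3,4) E] by blast
  obtain v \<beta> where v: "norm v = 1" "norm \<beta> < 1" "l 2 = s * (v * mob \<beta> s)" "l 3 = t * (v * mob \<beta> t)"
    using three_point_equality_disc[OF st(1) s0(1) st(2) s0(2) st(5) less_le_trans[OF lZ[OF d(1)] st(3)]
        less_le_trans[OF lZ[OF d(2)] st(4)] H0] by blast
  define u where "u j = (if j = 2 then s else if j = 3 then t else 0)" for j :: 3
  have three: "j = 1 \<or> j = 2 \<or> j = 3" for j :: 3 using exhaust_3 .
  show ?thesis
  proof (rule that)
    show "(\<lambda>x. ball_auto a (f x)) holomorphic_curve_on unit_disc" by (rule holomorphic_curve_ball_auto[OF a f(1,2)])
    show "(\<lambda>x. ball_auto a (f x)) ` unit_disc \<subseteq> unit_ball" using f(2) ball_auto_in_ball[OF a refl] by (auto simp: image_subset_iff)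
    show "norm (u j) < 1" for j using st by (simp add: u_def)
    show "ball_auto a (f (u j)) = z j" for j
      using three[of j] f(3-5) inv[of j] d Zone by (auto simp: u_def)
    show "blaschke_product 2 (\<lambda>\<zeta>. mob (- q 1) (\<zeta> * (v * mob \<beta> \<zeta>)))" by (rule blaschke_product_mob[OF v(1,2) q1])
    have "u j * (v * mob \<beta> (u j)) = l j" for j
      using three[of j] v(3,4) lone d by (auto simp: u_def)
    then show "mob (- q 1) (u j * (v * mob \<beta> (u j))) = q j" for j
      using mob_inverse[OF q1 ql] by (simp add: l_def)
    show "pick_solvable z q" if nc: "\<not> on_geodesic z"
    proof -
      have "norm (cinner (Z 2) (Z 3)) < norm (Z 2) * norm (Z 3)"
        unfolding Z_def a_def by (rule not_on_geodesic_cinner[OF nc z d(4,5)]) (use three in blast)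
      then obtain F where F: "F holomorphic_fun_on unit_ball" "F ` unit_ball \<subseteq> cball 0 1" "F 0 = 0" "F (Z 2) = l 2" "F (Z 3) = l 3"
        by (rule interpolation_at_touching_point[OF _ Z1 Z1 lZ[OF d(1)] lZ[OF d(2)] st(1,3,2,4,5) E H0])
          (use ineq in \<open>auto intro: that\<close>)
      have "F (Z j) = l j" for j using three[of j] F(3-5) Zone lone by auto
      then have "pick_solvable Z l" unfolding pick_solvable_def using F(1,2) by blast
      then show ?thesis unfolding Zeq by (rule pick_solvable_normalise[OF _ a q1 z(1) ql])
    qed
  qed
qed

section \<open>Approximation of extreme points\<close>

text \<open>When the norms agree, the two determinants differ only in the numbers \<open>A\<close>
  and \<open>b\<close>, and independence of \<open>z\<close> and \<open>w\<close> gives |b| < |A|.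
  It suffices to find nodes at which the determinant of the ball vanishes and
  \<open>s * cnj t\<close> is farther from \<open>A\<close> than from \<open>b\<close>.\<close>

lemma double_equality_violation:
  fixes z w :: "complex ^ 'n" and l m :: complex
  assumes zw: "norm z < 1" "norm w < 1" and nc: "norm (cinner z w) < norm z * norm w"
    and lm: "norm l = norm z" "norm m = norm w"
  obtains s t where "norm s < 1" "norm t < 1" "norm z \<le> norm s" "norm w \<le> norm t" "s \<noteq> t"
    "0 \<le> ball_det z w s t"
    "scalar_det l m s t < 0"
proof -
  define A b C where "A = l * cnj m" and "b = cinner z w" and "C = A - b"
  have Ab: "norm b < norm A" using nc lm by (simp add: A_def b_def norm_mult)
  then have C0: "C \<noteq> 0" by (auto simp: C_def)
  \<comment> \<open>The direction opposite to \<open>A - b\<close>; moving \<open>s * cnj t\<close>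
    along it from 0 increases the advantage of \<open>b\<close> over \<open>A\<close>.\<close>
  define \<phi> where "\<phi> = - C / of_real (norm C)"
  have \<phi>: "norm \<phi> = 1" using C0 by (simp add: \<phi>_def norm_divide)
  have \<phi>C: "cnj \<phi> * C = - of_real (norm C)"
  proof -
    have "cnj \<phi> * C = - (C * cnj C) / of_real (norm C)" by (simp add: \<phi>_def mult.commute)
    also have "C * cnj C = of_real (norm C) * of_real (norm C)" unfolding complex_norm_square[symmetric] by (simp add: power2_eq_square)
    finally show ?thesis using C0 by simp
  qed
  define y where "y = (1 + norm w) / 2"
  have y: "norm w < y" "y < 1" "0 < y" using zw(2) norm_ge_zero[of w] by (auto simp: y_def simp del: norm_ge_zero)
  define t where "t = complex_of_real y"
  have t: "norm t = y" using y by (simp add: t_def)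
  define g where "g x = pick_det (nsq z) (nsq w) b (of_real x * \<phi>) t" for x :: real
  have g0: "g (norm z) \<le> 0"
  proof -
    have "g (norm z) = - (nsq (of_real (norm z) * \<phi> * cnj t - b) * ((1 - nsq z) * (1 - nsq t)))"
      by (simp add: g_def pick_det_def norm_mult \<phi>)
    moreover have "0 \<le> nsq (of_real (norm z) * \<phi> * cnj t - b) * ((1 - nsq z) * (1 - nsq t))"
      using zw y t by (intro mult_nonneg_nonneg) auto
    ultimately show ?thesis by linarith
  qed
  have "norm (\<phi> * cnj t) \<noteq> norm (1::complex)" using y by (simp add: norm_mult \<phi> t)
  then have "1 - \<phi> * cnj t \<noteq> 0" by auto
  moreover have "nsq w < y\<^sup>2" using y by (intro power_strict_mono) auto
  ultimately have g1: "0 < g 1" using zw by (simp add: g_def pick_det_def norm_mult \<phi> t)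
  \<comment> \<open>The determinant is nonpositive where |s| = |z| and positive on the circle, so it
    vanishes at some radius in between.\<close>
  have "\<exists>x. norm z \<le> x \<and> x \<le> 1 \<and> g x = 0"
    by (rule IVT') (use g0 g1 zw in \<open>auto simp: g_def pick_det_def intro!: continuous_intros\<close>)
  then obtain x where x: "norm z \<le> x" "x \<le> 1" "g x = 0" by blast
  then have x1: "x < 1" using g1 by (cases "x = 1") auto
  define s where "s = of_real x * \<phi>"
  have x0: "0 \<le> x" using x(1) norm_ge_zero[of z] by linarith
  have s: "norm s = x" using x0 by (simp add: s_def norm_mult \<phi>)
  have E: "pick_det (nsq z) (nsq w) b s t = 0" using x(3) by (simp add: g_def s_def)
  have st1: "norm s < 1" "norm t < 1" using s t x1 y by auto
  have "nsq (s * cnj t - A) - nsq (s * cnj t - b) = nsq A - nsq b - 2 * Re (cnj (s * cnj t) * C)"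
    unfolding cmod_power2 C_def by (simp add: algebra_simps power2_eq_square)
  also have "cnj (s * cnj t) * C = of_real (x * y) * (cnj \<phi> * C)" by (simp add: s_def t_def mult_ac)
  also have "\<dots> = of_real (- (x * y * norm C))" unfolding \<phi>C by simp
  finally have diff: "nsq (s * cnj t - A) - nsq (s * cnj t - b) = nsq A - nsq b + 2 * (x * y * norm C)"
    by simp
  have "nsq b < nsq A" using Ab by (intro power_strict_mono) auto
  then have "nsq (s * cnj t - A) - nsq (s * cnj t - b) > 0" unfolding diff using x0 y by (intro add_pos_nonneg) auto
  then have "(nsq (s * cnj t - A) - nsq (s * cnj t - b)) * ((1 - nsq s) * (1 - nsq t)) > 0"
    using st1 by (intro mult_pos_pos) auto
  moreover have "pick_det (nsq l) (nsq m) A s t = pick_det (nsq z) (nsq w) b s t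
     - (nsq (s * cnj t - A) - nsq (s * cnj t - b)) * ((1 - nsq s) * (1 - nsq t))"
    unfolding pick_det_def lm by (simp add: left_diff_distrib)
  ultimately have H: "pick_det (nsq l) (nsq m) A s t < 0" using E by simp
  have "z \<noteq> w"
  proof
    assume "z = w"
    then show False using nc by (simp add: cinner_self power2_eq_square norm_mult)
  qed
  then have "s \<noteq> t" using pick_det_diagonal_neg[of z s w] x(1) y st1 s t E by (auto simp: b_def)
  then show ?thesis using that[of s t] st1 x(1) y s t E H by (simp add: A_def b_def)
qed

text \<open>Two nonstrict pairs sharing the index \<open>j\<close> become, with \<open>z j\<close>
  moved to 0, the two norm equalities of \<open>double_equality_violation\<close>, which contradict
  solvability on discs.\<close>

lemma strict_pair_or:
  fixes z :: "3 \<Rightarrow> complex ^ 'n"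
  assumes nc: "\<not> on_geodesic z" and z: "\<And>j. norm (z j) < 1" "inj z" and Q: "disc_solvable z q" and q: "\<And>j. norm (q j) < 1"
    and d: "i \<noteq> j" "l \<noteq> j" "i \<noteq> l" "\<And>x. x = i \<or> x = j \<or> x = l"
  shows "strict_pair z q j i \<or> strict_pair z q j l"
proof (rule ccontr)
  assume n: "\<not> ?thesis"
  define a where "a = z j"
  define Z where "Z = (\<lambda>k. ball_auto a (z k))"
  define m where "m = (\<lambda>k. mob (q j) (q k))"
  have a: "norm a < 1" using z(1) by (simp add: a_def)
  have ql: "norm (q k) \<le> 1" for k using q[of k] by simp
  have Z1: "norm (Z k) < 1" for k using ball_auto_in_ball[OF a refl z(1)] by (simp add: Z_def)
  have zero: "Z j = 0" "m j = 0" using a by (simp_all add: Z_def m_def a_def)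
  have inv: "ball_auto a (Z k) = z k" for k
    unfolding Z_def using ball_auto_involution[OF a refl, of "z k"] z(1)[of k] by simp
  have Zk: "Z k \<noteq> 0" if "k \<noteq> j" for k
  proof
    assume "Z k = 0"
    then have "z k = z j" using inv[of k] by (simp add: a_def)
    then show False using z(2) that by (simp add: inj_eq)
  qed
  have QZ: "disc_solvable Z m" unfolding Z_def m_def by (rule disc_solvable_normalise[OF Q a q z(1)])
  have eq: "norm (m k) = norm (Z k)" if "k \<noteq> j" "\<not> strict_pair z q j k" for k
  proof -
    have "\<not> strict_pair Z m j k"
      unfolding Z_def m_def strict_pair_normalise[OF a q z(1) ql] by (rule that(2))
    moreover have "Z j \<noteq> Z k" using Zk[OF that(1)] zero by simp
    from disc_solvable_weak_pair[OF QZ Z1 this]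
    have "nsq (m k) \<le> nsq (Z k)" using zero by simp
    ultimately have "nsq (m k) = nsq (Z k)" using zero by (simp add: strict_pair_def)
    then show ?thesis by (rule power2_eq_imp_eq) simp_all
  qed
  have "norm (cinner (Z i) (Z l)) < norm (Z i) * norm (Z l)"
    unfolding Z_def a_def by (rule not_on_geodesic_cinner[OF nc z d(1,2,4)])
  then obtain s t where st: "norm s < 1" "norm t < 1" "norm (Z i) \<le> norm s" "norm (Z l) \<le> norm t" "s \<noteq> t"
    "0 \<le> ball_det (Z i) (Z l) s t"
    "scalar_det (m i) (m l) s t < 0"
    using double_equality_violation[OF Z1 Z1 _ eq eq] d n by blast
  have "0 \<le> scalar_det (m i) (m l) s t"
    by (rule disc_solvable_pick_det[OF QZ zero d(1,2,3) Zk[OF d(1)] Zk[OF d(2)] st(1,3,2,4,5,6)])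
  then show False using st(7) by simp
qed

section \<open>Convexity, compactness and approximation of the data sets\<close>

lemma convex_disc_solvable: "convex {v :: complex ^ 3. disc_solvable z (($) v)}"
proof (rule convexI)
  fix x y :: "complex ^ 3" and u v :: real
  assume x: "x \<in> {v. disc_solvable z (($) v)}" and y: "y \<in> {v. disc_solvable z (($) v)}" and uv: "0 \<le> u" "0 \<le> v" "u + v = 1"
  have "disc_solvable z (($) (u *\<^sub>R x + v *\<^sub>R y))"
    unfolding disc_solvable_def
  proof (intro allI impI)
    fix f :: "complex \<Rightarrow> complex ^ 'a" and t :: "3 \<Rightarrow> complex"
    assume f: "f holomorphic_curve_on unit_disc" "f ` unit_disc \<subseteq> unit_ball" and t: "\<forall>j. norm (t j) < 1"
    obtain h where h: "h holomorphic_on unit_disc" "h ` unit_disc \<subseteq> cball 0 1" "\<And>j. f (t j) = z j \<Longrightarrow> h (t j) = x $ j"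
      by (rule disc_solvableE[of z "($) x" f t]) (use x f t in auto)
    obtain k where k: "k holomorphic_on unit_disc" "k ` unit_disc \<subseteq> cball 0 1" "\<And>j. f (t j) = z j \<Longrightarrow> k (t j) = y $ j"
      by (rule disc_solvableE[of z "($) y" f t]) (use y f t in auto)
    have "norm (of_real u * h w + of_real v * k w) \<le> 1" if "norm w < 1" for w
    proof -
      have "norm (h w) \<le> 1" "norm (k w) \<le> 1" using h(2) k(2) that by (auto simp: image_subset_iff)
      then have "u * norm (h w) + v * norm (k w) \<le> u * 1 + v * 1" using uv by (intro add_mono mult_left_mono) auto
      then have "norm (of_real u * h w) + norm (of_real v * k w) \<le> 1" using uv by (simp add: norm_mult)
      then show ?thesis by (rule norm_triangle_le)
    qed
    then show "\<exists>h. h holomorphic_on unit_disc \<and> h ` unit_disc \<subseteq> cball 0 1 \<and> (\<forall>j. f (t j) = z j \<longrightarrow> h (t j) = (u *\<^sub>R x + v *\<^sub>R y) $ j)"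
      using h(3) k(3)
      by (intro exI[of _ "\<lambda>w. of_real u * h w + of_real v * k w"])
        (auto intro!: holomorphic_intros h(1) k(1) simp: scaleR_conv_of_real[where 'a = complex])
  qed
  then show "u *\<^sub>R x + v *\<^sub>R y \<in> {v. disc_solvable z (($) v)}" by simp
qed

lemma compact_disc_solvable:
  assumes z: "\<And>j. norm (z j) < 1"
  shows "compact {v :: complex ^ 3. disc_solvable z (($) v)}"
proof -
  let ?S = "{v :: complex ^ 3. disc_solvable z (($) v)}"
  have "norm v \<le> 3" if "v \<in> ?S" for v
  proof -
    have "norm v \<le> (\<Sum>j\<in>UNIV. norm (v $ j))" unfolding norm_vec_def by (rule L2_set_le_sum) simp
    also have "\<dots> \<le> (\<Sum>j\<in>(UNIV :: 3 set). 1)"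
      using disc_solvable_norm_le[where z = z and q = "($) v"] z that by (intro sum_mono) simp
    finally show ?thesis by simp
  qed
  then have "bounded ?S" unfolding bounded_iff by blast
  moreover have "closed ?S"
    unfolding closed_sequential_limits
  proof (intro allI impI, elim conjE)
    fix x :: "nat \<Rightarrow> complex ^ 3" and v
    assume x: "\<forall>n. x n \<in> ?S" and lim: "x \<longlonglongrightarrow> v"
    have "disc_solvable z (($) v)"
      unfolding disc_solvable_def
    proof (intro allI impI)
      fix f :: "complex \<Rightarrow> complex ^ 'a" and t :: "3 \<Rightarrow> complex"
      assume f: "f holomorphic_curve_on unit_disc" "f ` unit_disc \<subseteq> unit_ball" and t: "\<forall>j. norm (t j) < 1"
      have "\<exists>h. h holomorphic_on unit_disc \<and> h ` unit_disc \<subseteq> cball 0 1 \<and> (\<forall>j. f (t j) = z j \<longrightarrow> h (t j) = x n $ j)" for n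
        using x f t unfolding disc_solvable_def by blast
      then obtain h where h: "\<And>n. h n holomorphic_on unit_disc" "\<And>n. h n ` unit_disc \<subseteq> cball 0 1"
        "\<And>n j. f (t j) = z j \<Longrightarrow> h n (t j) = x n $ j" by metis
      define HH where "HH = {h. h holomorphic_on unit_disc \<and> h ` unit_disc \<subseteq> cball 0 1}"
      \<comment> \<open>Montel's theorem yields one limit function; its bound and its values at the
        nodes pass to the limit along the subsequence.\<close>
      obtain g r where g: "g holomorphic_on unit_disc" "strict_mono (r :: nat \<Rightarrow> nat)"
        "\<And>w. w \<in> unit_disc \<Longrightarrow> (\<lambda>n. h (r n) w) \<longlonglongrightarrow> g w"
      proof (rule Montel[of unit_disc HH h])
        show "\<exists>B. \<forall>h\<in>HH. \<forall>w\<in>K. norm (h w) \<le> B" if "K \<subseteq> unit_disc" for K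
          using that by (intro exI[of _ 1]) (auto simp: HH_def image_subset_iff)
        show "range h \<subseteq> HH" using h(1,2) by (auto simp: HH_def)
      qed (auto simp: HH_def)
      have "norm (g w) \<le> 1" if "w \<in> unit_disc" for w
        by (rule LIMSEQ_le_const2[OF tendsto_norm[OF g(3)[OF that]]])
          (use h(2) that in \<open>auto simp: image_subset_iff\<close>)
      moreover have "g (t j) = v $ j" if "f (t j) = z j" for j
      proof -
        have "(\<lambda>n. x (r n) $ j) \<longlonglongrightarrow> v $ j"
          using LIMSEQ_subseq_LIMSEQ[OF lim g(2)] by (auto simp: o_def intro: tendsto_vec_nth)
        moreover have "(\<lambda>n. x (r n) $ j) \<longlonglongrightarrow> g (t j)" using g(3)[of "t j"] t h(3)[OF that] by simp
        ultimately show ?thesis using LIMSEQ_unique by blast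
      qed
      ultimately show "\<exists>h. h holomorphic_on unit_disc \<and> h ` unit_disc \<subseteq> cball 0 1 \<and> (\<forall>j. f (t j) = z j \<longrightarrow> h (t j) = v $ j)"
        using g(1) by (intro exI[of _ g]) auto
    qed
    then show "v \<in> ?S" by simp
  qed
  ultimately show ?thesis by (simp add: compact_eq_bounded_closed)
qed

lemma convex_pick_solvable: "convex {v :: complex ^ 3. pick_solvable z (($) v)}"
proof (rule convexI)
  fix x y :: "complex ^ 3" and u v :: real
  assume x: "x \<in> {v. pick_solvable z (($) v)}" and y: "y \<in> {v. pick_solvable z (($) v)}" and uv: "0 \<le> u" "0 \<le> v" "u + v = 1"
  obtain F where F: "F holomorphic_fun_on unit_ball" "F ` unit_ball \<subseteq> cball 0 1" "\<And>j. F (z j) = x $ j"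
    using x unfolding pick_solvable_def by auto
  obtain G where G: "G holomorphic_fun_on unit_ball" "G ` unit_ball \<subseteq> cball 0 1" "\<And>j. G (z j) = y $ j"
    using y unfolding pick_solvable_def by auto
  have "norm (of_real u * F w + of_real v * G w) \<le> 1" if "norm w < 1" for w
  proof -
    have "norm (F w) \<le> 1" "norm (G w) \<le> 1" using F(2) G(2) that by (auto simp: image_subset_iff)
    then have "u * norm (F w) + v * norm (G w) \<le> u * 1 + v * 1" using uv by (intro add_mono mult_left_mono) auto
    then have "norm (of_real u * F w) + norm (of_real v * G w) \<le> 1" using uv by (simp add: norm_mult)
    then show ?thesis by (rule norm_triangle_le)
  qed
  moreover have "(\<lambda>w. of_real u * F w + of_real v * G w) holomorphic_fun_on unit_ball"
    by (intro holomorphic_fun_intros F(1) G(1))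
  ultimately show "u *\<^sub>R x + v *\<^sub>R y \<in> {v. pick_solvable z (($) v)}"
    unfolding pick_solvable_def using F(3) G(3)
    by (auto intro!: exI[of _ "\<lambda>w. of_real u * F w + of_real v * G w"] simp: scaleR_conv_of_real[where 'a = complex])
qed

text \<open>The closure is convex, so extreme points suffice. Near an extreme point \<open>x\<close>
  a boundary point \<open>r *\<^sub>R y\<close> with three strict pairs is constructed, at which the
  touching argument produces a solution on the ball.\<close>

lemma disc_solvable_imp_closure_pick_solvable:
  fixes z :: "3 \<Rightarrow> complex ^ 'n"
  assumes z: "\<And>j. norm (z j) < 1" "inj z"
  shows "{v :: complex ^ 3. disc_solvable z (($) v)} \<subseteq> closure {v. pick_solvable z (($) v)}"
    (is "?Q \<subseteq> closure ?P")
proof (cases "on_geodesic z")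
  case True
  then have "?Q \<subseteq> ?P" using on_geodesic_pick_solvable by blast
  then show ?thesis by (rule order_trans[OF _ closure_subset])
next
  case nc: False
  have comQ: "compact ?Q" by (rule compact_disc_solvable[OF z(1)])
  have ext: "x \<in> closure ?P" if xe: "x extreme_point_of ?Q" for x :: "complex ^ 3"
  proof -
    have x: "disc_solvable z (($) x)" using xe unfolding extreme_point_of_def by auto
    have x1: "norm (x $ j) \<le> 1" for j using disc_solvable_norm_le[OF x z(1)] .
    have zd: "z i \<noteq> z j" if "i \<noteq> j" for i j using z(2) that by (simp add: inj_eq)
    show ?thesis
    proof (cases "\<exists>j. norm (x $ j) = 1")
      case True
      then obtain j where j: "norm (x $ j) = 1" by blast
      \<comment> \<open>A value on the circle makes the weak pair inequality force all values to
        coincide, and the problem is solved by a constant.\<close>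
      have xj: "x $ j = x $ i" for i
      proof (cases "i = j")
        case False
        have "(1 - nsq (z i)) * (1 - nsq (z j)) * nsq (1 - x $ i * cnj (x $ j)) \<le> 0"
          using disc_solvable_weak_pair[OF x z(1) zd[OF False]] j by simp
        moreover have "(1 - nsq (z i)) * (1 - nsq (z j)) > 0" using z(1)[of i] z(1)[of j] by simp
        moreover have "b \<le> 0" if "a * b \<le> 0" "a > 0" for a b :: real
          using that by (simp add: mult_le_0_iff)
        ultimately have "nsq (1 - x $ i * cnj (x $ j)) \<le> 0" by blast
        then have "x $ i * cnj (x $ j) = 1" by simp
        moreover have "x $ j * cnj (x $ j) = 1" using complex_norm_square[of "x $ j"] j by simp
        ultimately show ?thesis by (metis mult_right_cancel mult_zero_right zero_neq_one)
      qed simp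
      have "pick_solvable z (($) x)"
        unfolding pick_solvable_def
      proof (rule exI[of _ "\<lambda>_. x $ j"], intro conjI allI)
        show "(\<lambda>_. x $ j) holomorphic_fun_on unit_ball" by (rule holomorphic_fun_const)
        show "(\<lambda>_. x $ j) ` unit_ball \<subseteq> cball 0 1" using j by (simp add: image_subset_iff)
        show "x $ j = x $ i" for i by (rule xj)
      qed
      then show ?thesis by (intro closure_subset[THEN subsetD]) simp
    next
      case False
      then have lt1: "norm (x $ j) < 1" for j using x1[of j] by (metis less_le)
      \<comment> \<open>Two different nonstrict pairs would share an index, so at most one pair is
        nonstrict; the index outside it has strict pairs with both others.\<close>
      have "\<exists>l. \<forall>i. i \<noteq> l \<longrightarrow> strict_pair z (($) x) l i"
      proof (cases "\<forall>i j. i \<noteq> j \<longrightarrow> strict_pair z (($) x) i j")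
        case False
        then obtain i j where ij: "i \<noteq> j" "\<not> strict_pair z (($) x) i j" by blast
        obtain l where l: "l \<noteq> i" "l \<noteq> j" "\<And>y. y = i \<or> y = j \<or> y = l"
          using ij(1) exhaust_3_other[of i] by metis
        have "strict_pair z (($) x) i l"
          using strict_pair_or[OF nc z x lt1, of j i l] ij l by metis
        moreover have "strict_pair z (($) x) j l"
          using strict_pair_or[OF nc z x lt1, of i j l] ij l strict_pair_commute[of z "($) x" i j] by metis
        ultimately show ?thesis using l(3) strict_pair_commute by metis
      qed auto
      then obtain l where l: "\<And>i. i \<noteq> l \<Longrightarrow> strict_pair z (($) x) l i" by blast
      have scaled: "strict_pair z (($) (r *\<^sub>R y)) i j"
        if "0 \<le> r" "r < 1" "i \<noteq> j" "y $ i = x $ i" "y $ j = x $ j" for r i j and y :: "complex ^ 3"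
      proof -
        have "strict_pair z (\<lambda>j. of_real r * x $ j) i j"
          by (rule strict_pair_scale[OF disc_solvable_weak_pair[OF x z(1) zd[OF that(3)]] lt1 lt1 z(1) zd[OF that(3)] that(1,2)])
        then show ?thesis using that(4,5) by (simp add: strict_pair_def scaleR_conv_of_real[where 'a = complex])
      qed
      \<comment> \<open>Otherwise \<open>touching_disc\<close> applies to
        \<open>\<rho> *\<^sub>R x\<close> and gives a Blaschke product with these values at three
        nodes. On the same disc \<rho> times an interpolant of \<open>x\<close> has these values
        too; uniqueness identifies the two and bounds the Blaschke product by \<rho> < 1.\<close>
      have near: "\<exists>\<delta>>0. \<forall>y. dist y x < \<delta> \<longrightarrow> disc_solvable z (($) (\<rho> *\<^sub>R y))" if \<rho>: "0 \<le> \<rho>" "\<rho> < 1" for \<rho> :: real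
      proof (rule ccontr)
        assume "\<not> ?thesis"
        then have "\<exists>y. dist y x < inverse (real (Suc k)) \<and> \<not> disc_solvable z (($) (\<rho> *\<^sub>R y))" for k
          by (metis of_nat_0_less_iff zero_less_Suc inverse_positive_iff_positive)
        then obtain Y where Y: "\<And>k. dist (Y k) x < inverse (real (Suc k))" "\<And>k. \<not> disc_solvable z (($) (\<rho> *\<^sub>R Y k))" by metis
        have "Y \<longlonglongrightarrow> x"
          unfolding tendsto_dist_iff[of Y]
          by (rule tendsto_sandwich[OF _ _ tendsto_const LIMSEQ_inverse_real_of_nat])
            (intro always_eventually allI zero_le_dist less_imp_le[OF Y(1)])+
        then have L: "(\<lambda>k. (\<rho> *\<^sub>R Y k) $ j) \<longlonglongrightarrow> (\<rho> *\<^sub>R x) $ j" for j by (intro tendsto_intros)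
        have Qr: "disc_solvable z (($) (\<rho> *\<^sub>R x))"
        proof -
          have "0 \<in> ?Q" by (auto simp: disc_solvable_def image_subset_iff intro!: exI[of _ "\<lambda>_. 0"])
          then show ?thesis using convexD[OF convex_disc_solvable _ _ _ _ , of 0 z x "1 - \<rho>" \<rho>] x \<rho> by simp
        qed
        have Sr: "strict_pair z (($) (\<rho> *\<^sub>R x)) i j" if "i \<noteq> j" for i j
          using scaled[OF \<rho> that] by simp
        obtain f t B where f: "f holomorphic_curve_on unit_disc" "f ` unit_disc \<subseteq> unit_ball" "\<And>j. norm (t j) < 1" "\<And>j. f (t j) = z j"
          "blaschke_product 2 B" "\<And>j. B (t j) = (\<rho> *\<^sub>R x) $ j"
          by (rule touching_disc[OF z Qr Sr, of "\<lambda>k. ($) (\<rho> *\<^sub>R Y k)"]) (use Y(2) L in \<open>blast intro: that\<close>)+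
        obtain h where h: "h holomorphic_on unit_disc" "h ` unit_disc \<subseteq> cball 0 1" "\<And>j. f (t j) = z j \<Longrightarrow> h (t j) = x $ j"
          by (rule disc_solvableE[OF x f(1,2), of t]) (use f(3) in auto)
        have "inj t" by (rule injI) (metis f(4) z(2) injD)
        then have card: "card (range t) = 3" by (simp add: card_image)
        have hb: "norm (of_real \<rho> * h w) \<le> \<rho>" if "w \<in> unit_disc" for w
          using h(2) that \<rho> by (auto simp: image_subset_iff norm_mult mult_left_le)
        have "of_real \<rho> * h w = B w" if "w \<in> unit_disc" for w
        proof (rule Pick_unique_blaschke[OF _ _ f(5), where T = "range t"])
          show "(\<lambda>w. of_real \<rho> * h w) holomorphic_on unit_disc" by (intro holomorphic_intros h(1))
          show "(\<lambda>w. of_real \<rho> * h w) ` unit_disc \<subseteq> cball 0 1" using hb \<rho> by fastforce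
        qed (use f card h that in \<open>auto simp: scaleR_conv_of_real[where 'a = complex]\<close>)
        then have "1 \<le> \<rho>" using blaschke_product_unbounded[OF f(5), of \<rho>] hb by metis
        then show False using \<rho> by simp
      qed
      show ?thesis
        unfolding closure_approachable
      proof (intro allI impI)
        fix \<epsilon> :: real assume "\<epsilon> > 0"
        have "\<forall>\<^sub>F y in nhds x. strict_pair z (($) y) l i" if "i \<noteq> l" for i
          by (rule eventually_strict_pair[OF l[OF that]]) (auto intro!: tendsto_intros filterlim_ident)
        then have "\<forall>\<^sub>F y in nhds x. \<forall>i. i \<noteq> l \<longrightarrow> strict_pair z (($) y) l i"
          by (simp add: eventually_all_finite)
        then obtain e where e: "e > 0" "\<And>y i. dist y x < e \<Longrightarrow> i \<noteq> l \<Longrightarrow> strict_pair z (($) y) l i"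
          unfolding eventually_nhds_metric by blast
        define e' where "e' = min e \<epsilon>"
        have e': "e' > 0" using e \<open>\<epsilon> > 0\<close> by (simp add: e'_def)
        define \<rho> where "\<rho> = max 0 (1 - e' / (2 * (norm x + 1)))"
        have nx: "norm x + 1 > 0" by (simp add: add_nonneg_pos)
        have \<rho>: "0 \<le> \<rho>" "\<rho> < 1" using e' nx by (auto simp: \<rho>_def)
        have \<rho>x: "(1 - \<rho>) * norm x \<le> e' / 2"
        proof -
          have "(1 - \<rho>) \<le> e' / (2 * (norm x + 1))" by (simp add: \<rho>_def)
          then have "(1 - \<rho>) * norm x \<le> e' / (2 * (norm x + 1)) * (norm x + 1)"
            using \<rho> e' nx by (intro mult_mono) auto
          moreover have "a / (2 * c) * c = a / 2" if "c > 0" for a c :: real using that by simp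
          ultimately show ?thesis using nx by metis
        qed
        obtain \<delta> where \<delta>: "\<delta> > 0" "\<And>y. dist y x < \<delta> \<Longrightarrow> disc_solvable z (($) (\<rho> *\<^sub>R y))" using near[OF \<rho>] by blast
        \<comment> \<open>A perturbation of this size keeps the point multiplied by \<rho> solvable
          on discs and uses less than the other half of \<open>e'\<close>.\<close>
        define \<eta> where "\<eta> = min \<delta> e' / 4"
        have \<eta>: "\<eta> > 0" "\<eta> < \<delta>" "\<eta> < e' / 2" using \<delta>(1) e' by (auto simp: \<eta>_def min_def)
        define u where "u = axis l (complex_of_real \<eta>)"
        have u: "norm u = \<eta>" "u \<noteq> 0" "\<And>j. j \<noteq> l \<Longrightarrow> u $ j = 0"
          using \<eta> by (auto simp: u_def axis_eq_0_iff) (simp_all add: axis_def norm_vec_def L2_set_def if_distrib[of norm] if_distrib[of "\<lambda>x. x\<^sup>2"] cong: if_cong)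
        \<comment> \<open>\<open>x\<close> is the midpoint of the two perturbed points, so
          extremality excludes that both belong to the set.\<close>
        have "x + u \<notin> ?Q \<or> x - u \<notin> ?Q"
        proof (rule ccontr)
          assume "\<not> ?thesis"
          moreover have "x \<in> open_segment (x - u) (x + u)"
          proof -
            have "midpoint (x - u) (x + u) = x" by (simp add: midpoint_def scaleR_2[symmetric])
            moreover have "x - u \<noteq> x + u"
            proof
              assume "x - u = x + u"
              then have "2 *\<^sub>R u = 0" by (simp add: scaleR_2 algebra_simps)
              then show False using u(2) by simp
            qed
            ultimately show ?thesis by (metis midpoint_in_open_segment)
          qed
          ultimately show False using xe unfolding extreme_point_of_def by blast
        qed
        then obtain y where y: "y \<notin> ?Q" "y = x + u \<or> y = x - u" by blast
        have yx: "dist y x = \<eta>" using y(2) u(1) by (auto simp: dist_norm)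
        have yj: "y $ j = x $ j" if "j \<noteq> l" for j using y(2) u(3)[OF that] by auto
        \<comment> \<open>Its maximum \<open>r\<close> marks the last point of the ray through
          \<open>y\<close> that is solvable on discs. It is at least \<rho>, hence near 1, and below
          1 because \<open>y\<close> itself fails.\<close>
        define R where "R = {0..1} \<inter> (\<lambda>r. r *\<^sub>R y) -` ?Q"
        have "compact R" unfolding R_def
          by (intro compact_Int_closed compact_Icc continuous_closed_vimage compact_imp_closed[OF comQ]) (auto intro!: continuous_intros)
        moreover have \<rho>R: "\<rho> \<in> R" using \<delta>(2)[of y] yx \<eta> \<rho> by (auto simp: R_def)
        ultimately obtain r where r: "r \<in> R" "\<And>r'. r' \<in> R \<Longrightarrow> r' \<le> r" using compact_attains_sup[of R] by blast
        have r01: "\<rho> \<le> r" "0 \<le> r" "r \<noteq> 1" "r \<le> 1" using r \<rho>R y(1) by (auto simp: R_def)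
        then have r1: "r < 1" by simp
        have rQ: "disc_solvable z (($) (r *\<^sub>R y))" using r(1) by (simp add: R_def)
        have "dist (r *\<^sub>R y) x \<le> dist (r *\<^sub>R y) (r *\<^sub>R x) + dist (r *\<^sub>R x) x" by (rule dist_triangle)
        also have "dist (r *\<^sub>R y) (r *\<^sub>R x) \<le> \<eta>"
          using r01 yx \<eta> by (simp add: dist_norm mult_left_le_one_le flip: scaleR_diff_right)
        also have "dist (r *\<^sub>R x) x = (1 - r) * norm x"
        proof -
          have "r *\<^sub>R x - x = (r - 1) *\<^sub>R x" by (simp add: scaleR_diff_left)
          then show ?thesis using r01 by (simp add: dist_norm abs_if)
        qed
        also have "(1 - r) * norm x \<le> e' / 2"
          using \<rho>x r01 by (smt (verit) mult_right_mono norm_ge_zero)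
        finally have dr: "dist (r *\<^sub>R y) x < e'" using \<eta>(3) by linarith
        have sp: "strict_pair z (($) (r *\<^sub>R y)) i j" if ij: "i \<noteq> j" for i j
        proof -
          consider "i = l" | "j = l" | "i \<noteq> l" "j \<noteq> l" by blast
          then show ?thesis
          proof cases
            case 1
            then show ?thesis using e(2)[of "r *\<^sub>R y" j] dr ij by (simp add: e'_def)
          next
            case 2
            then show ?thesis using e(2)[of "r *\<^sub>R y" i] dr ij strict_pair_commute[of z _ i j] by (simp add: e'_def)
          next
            \<comment> \<open>The pair avoiding \<open>l\<close> may be nonstrict for
              \<open>x\<close>, but \<open>y\<close> agrees with \<open>x\<close> in these
              coordinates and the factor \<open>r < 1\<close> makes it strict.\<close>
            case 3
            then show ?thesis using scaled[OF r01(2) r1 ij] yj by blast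
          qed
        qed
        define rk where "rk k = r + (1 - r) / real (Suc k)" for k
        have rk: "r < rk k" "rk k \<le> 1" for k
        proof -
          have "(1 - r) / real (Suc k) \<le> (1 - r) / 1" using r1 by (intro divide_left_mono) auto
          then show "rk k \<le> 1" by (simp add: rk_def)
          show "r < rk k" using r1 by (simp add: rk_def)
        qed
        have nrk: "\<not> disc_solvable z (($) (rk k *\<^sub>R y))" for k
        proof
          assume "disc_solvable z (($) (rk k *\<^sub>R y))"
          then have "rk k \<in> R" using rk[of k] r01 by (simp add: R_def)
          then show False using r(2) rk(1)[of k] by fastforce
        qed
        have "rk \<longlonglongrightarrow> r"
          unfolding rk_def using tendsto_add[OF tendsto_const[of r] LIMSEQ_Suc[OF lim_const_over_n[of "1 - r"]]] by simp
        then have L: "(\<lambda>k. (rk k *\<^sub>R y) $ j) \<longlonglongrightarrow> (r *\<^sub>R y) $ j" for j by (intro tendsto_intros)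
        have "pick_solvable z (($) (r *\<^sub>R y))"
          by (rule touching_disc[OF z rQ sp, of "\<lambda>k. ($) (rk k *\<^sub>R y)"]) (use nrk L nc in blast)+
        then show "\<exists>y\<in>?P. dist y x < \<epsilon>" using dr by (intro bexI[of _ "r *\<^sub>R y"]) (auto simp: e'_def)
      qed
    qed
  qed
  have "?Q = convex hull {x. x extreme_point_of ?Q}"
    by (rule Krein_Milman_Minkowski[OF comQ convex_disc_solvable])
  also have "\<dots> \<subseteq> closure ?P"
    by (rule hull_minimal) (use ext in \<open>auto intro: convex_closure convex_pick_solvable\<close>)
  finally show ?thesis .
qed

section \<open>Strict solvability and the two implications\<close>

lemma relatively_compact_in_disc_bound:
  assumes "relatively_compact_in (G ` S) unit_disc" "S \<noteq> {}"
  obtains \<rho> where "\<rho> < 1" "\<And>x. x \<in> S \<Longrightarrow> norm (G x) \<le> \<rho>"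
proof -
  have c: "compact (closure (G ` S))" "closure (G ` S) \<subseteq> unit_disc"
    using assms(1) unfolding relatively_compact_in_def by auto
  have "closure (G ` S) \<noteq> {}" using assms(2) by simp
  then obtain y where y: "y \<in> closure (G ` S)" "\<And>x. x \<in> closure (G ` S) \<Longrightarrow> norm x \<le> norm y"
    using continuous_attains_sup[OF c(1), of norm] by (auto intro: continuous_intros)
  show ?thesis
  proof (rule that[of "norm y"])
    show "norm y < 1" using y(1) c(2) by auto
    show "norm (G x) \<le> norm y" if "x \<in> S" for x using y(2) closure_subset that by blast
  qed
qed

lemma relatively_compact_in_discI:
  assumes "\<And>x. x \<in> S \<Longrightarrow> norm (G x) \<le> \<rho>" "\<rho> < 1"
  shows "relatively_compact_in (G ` S) unit_disc"
proof -
  have "closure (G ` S) \<subseteq> cball 0 \<rho>" using assms(1) by (intro closure_minimal) auto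
  moreover have "cball 0 \<rho> \<subseteq> unit_disc" using assms(2) by auto
  moreover have "compact (closure (G ` S))" 
    using bounded_subset[OF bounded_cball calculation(1)] by (simp add: compact_eq_bounded_closed)
  ultimately show ?thesis unfolding relatively_compact_in_def by (meson order_trans)
qed

text \<open>A competitor agrees with \<open>F\<close> at more nodes of the disc than the degree, so
  by uniqueness it agrees with \<open>F\<close> along the whole disc, where its modulus cannot stay
  below a constant less than 1.\<close>

lemma pick_extremal_if_blaschke:
  fixes F :: "complex ^ 'n \<Rightarrow> complex" and z :: "nat \<Rightarrow> complex ^ 'n"
  assumes F: "F holomorphic_fun_on unit_ball" "F ` unit_ball \<subseteq> unit_disc"
    and f: "f holomorphic_curve_on unit_disc" "f ` unit_disc \<subseteq> unit_ball"
    and B: "blaschke_product d (F \<circ> f)"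
    and T: "T \<subseteq> unit_disc" "finite T" "d < card T" "\<And>t. t \<in> T \<Longrightarrow> f t \<in> z ` {1..N}"
  shows "pick_extremal unit_ball N z (\<lambda>j. F (z j))"
proof -
  have "pick_solution unit_ball N z (\<lambda>j. F (z j)) F" using F by (simp add: pick_solution_def)
  moreover have False if G: "pick_solution unit_ball N z (\<lambda>j. F (z j)) G" and rc: "relatively_compact_in (G ` unit_ball) unit_disc" for G
  proof -
    have G': "G holomorphic_fun_on unit_ball" "G ` unit_ball \<subseteq> unit_disc" "\<And>j. j \<in> {1..N} \<Longrightarrow> G (z j) = F (z j)"
      using G unfolding pick_solution_def by auto
    obtain \<rho> where \<rho>: "\<rho> < 1" "\<And>x. x \<in> unit_ball \<Longrightarrow> norm (G x) \<le> \<rho>"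
      by (rule relatively_compact_in_disc_bound[OF rc]) auto
    have "G (f t) = (F \<circ> f) t" if "t \<in> unit_disc" for t
    proof (rule Pick_unique_blaschke[OF _ _ B T(1,2,3) _ that])
      show "(\<lambda>t. G (f t)) holomorphic_on unit_disc" by (rule holomorphic_fun_o_curve[OF G'(1) f])
      show "(\<lambda>t. G (f t)) ` unit_disc \<subseteq> cball 0 1" using G'(2) f(2) by (force simp: image_subset_iff)
      show "G (f t) = (F \<circ> f) t" if "t \<in> T" for t using T(4)[OF that] G'(3) by auto
    qed
    then have "norm ((F \<circ> f) t) \<le> \<rho>" if "t \<in> unit_disc" for t
      using \<rho>(2)[of "f t"] f(2) that by (metis image_subset_iff)
    then have "1 \<le> \<rho>" by (rule blaschke_product_unbounded[OF B])
    then show False using \<rho>(1) by simp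
  qed
  ultimately show ?thesis unfolding pick_extremal_def by blast
qed

text \<open>Lagrange polynomials: pairing with \<open>z j - z i\<close> gives an affine function
  that vanishes at \<open>z i\<close>, normalised to be 1 at \<open>z j\<close>. They correct
  approximate solutions.\<close>

lemma interpolation_basis:
  fixes z :: "3 \<Rightarrow> complex ^ 'n"
  assumes z: "\<And>j. norm (z j) < 1" "inj z"
  obtains e K where "K > 0" "\<And>j. e j holomorphic_fun_on unit_ball" "\<And>j x. x \<in> unit_ball \<Longrightarrow> norm (e j x) \<le> K"
    "\<And>i j. e j (z i) = (if i = j then 1 else 0)"
proof -
  define e where "e j x = (\<Prod>i\<in>UNIV - {j}. cinner (x - z i) (z j - z i) / cinner (z j - z i) (z j - z i))" for j x
  define k where "k j = (\<Prod>i\<in>UNIV - {j}. 2 * norm (z j - z i) / norm (cinner (z j - z i) (z j - z i)))" for j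
  define K where "K = 1 + (\<Sum>j\<in>UNIV. k j)"
  have k0: "0 \<le> k j" for j unfolding k_def by (intro prod_nonneg) auto
  have ke: "norm (e j x) \<le> K" if "x \<in> unit_ball" for j x
  proof -
    have "norm (e j x) \<le> k j"
      unfolding e_def k_def prod_norm[symmetric]
    proof (rule prod_mono, intro conjI)
      fix i
      have "norm (x - z i) \<le> 2" using norm_triangle_ineq4[of x "z i"] that z(1)[of i] by simp
      then have "norm (x - z i) * norm (z j - z i) \<le> 2 * norm (z j - z i)" by (rule mult_right_mono) simp
      then have "norm (cinner (x - z i) (z j - z i)) \<le> 2 * norm (z j - z i)"
        using norm_cinner_le[of "x - z i" "z j - z i"] by linarith
      then show "norm (cinner (x - z i) (z j - z i) / cinner (z j - z i) (z j - z i))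
         \<le> 2 * norm (z j - z i) / norm (cinner (z j - z i) (z j - z i))"
        unfolding norm_divide by (rule divide_right_mono) simp
    qed simp
    also have "k j \<le> (\<Sum>j\<in>UNIV. k j)" using k0 by (intro member_le_sum) auto
    finally show ?thesis by (simp add: K_def)
  qed
  have hol: "e j holomorphic_fun_on unit_ball" for j
    unfolding e_def divide_inverse cinner_simps(2)
    by (intro holomorphic_fun_prod holomorphic_fun_mult holomorphic_fun_diff holomorphic_fun_cinner holomorphic_fun_const)
  have one: "e j (z j) = 1" for j
  proof -
    have "cinner (z j - z i) (z j - z i) \<noteq> 0" if "i \<noteq> j" for i
      using z(2) that unfolding cinner_self by (simp add: inj_eq)
    then show ?thesis unfolding e_def by (intro prod.neutral) simp
  qed
  have zero: "e j (z i) = 0" if "i \<noteq> j" for i j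
    unfolding e_def using that by (intro prod_zero bexI[of _ i]) simp_all
  show ?thesis
    by (rule that[of K e]) (use hol ke one zero k0 in \<open>auto simp: K_def add_pos_nonneg sum_nonneg\<close>)
qed

text \<open>Data close to (1 + \<epsilon>) q are solvable on the ball. Correcting the error costs at
  most \<epsilon> / 2 in the supremum norm, and division by 1 + \<epsilon> leaves a bound below
  1.\<close>

lemma strictly_solvable_if_disc_solvable:
  fixes z :: "3 \<Rightarrow> complex ^ 'n"
  assumes z: "\<And>j. norm (z j) < 1" "inj z" and \<epsilon>: "\<epsilon> > 0"
    and Q: "disc_solvable z (\<lambda>j. of_real (1 + \<epsilon>) * q j)"
  obtains G \<rho> where "G holomorphic_fun_on unit_ball" "\<And>x. x \<in> unit_ball \<Longrightarrow> norm (G x) \<le> \<rho>" "\<rho> < 1" "\<And>j. G (z j) = q j"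
proof -
  obtain e K where e: "K > 0" "\<And>j. e j holomorphic_fun_on unit_ball" "\<And>j x. x \<in> unit_ball \<Longrightarrow> norm (e j x) \<le> K"
    "\<And>i j. e j (z i) = (if i = j then 1 else 0)"
    by (rule interpolation_basis[OF z]) (rule that)
  define v :: "complex ^ 3" where "v = (\<chi> j. of_real (1 + \<epsilon>) * q j)"
  have "v \<in> closure {v. pick_solvable z (($) v)}"
  proof (rule subsetD[OF disc_solvable_imp_closure_pick_solvable[OF z]])
    have "($) v = (\<lambda>j. of_real (1 + \<epsilon>) * q j)" by (simp add: v_def fun_eq_iff)
    then show "v \<in> {v. disc_solvable z (($) v)}" using Q by simp
  qed
  \<comment> \<open>Three correction terms, each bounded by this tolerance times \<open>K\<close>,
    add up to \<epsilon> / 2.\<close>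
  moreover have "\<epsilon> / (6 * K) > 0" using \<epsilon> e(1) by simp
  ultimately obtain y where y: "pick_solvable z (($) y)" "dist y v < \<epsilon> / (6 * K)"
    unfolding closure_approachable by auto
  obtain F where F: "F holomorphic_fun_on unit_ball" "F ` unit_ball \<subseteq> cball 0 1" "\<And>j. F (z j) = y $ j"
    using y(1) unfolding pick_solvable_def by blast
  define G where "G x = (F x + (\<Sum>j\<in>UNIV. (v $ j - y $ j) * e j x)) / of_real (1 + \<epsilon>)" for x
  have ne: "complex_of_real (1 + \<epsilon>) \<noteq> 0" using \<epsilon> by (simp only: of_real_eq_0_iff)
  show ?thesis
  proof (rule that[of G "(1 + \<epsilon> / 2) / (1 + \<epsilon>)"])
    show "G holomorphic_fun_on unit_ball"
      unfolding G_def using ne by (intro holomorphic_fun_intros holomorphic_fun_sum F(1) e(2)) auto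
    show "(1 + \<epsilon> / 2) / (1 + \<epsilon>) < 1" using \<epsilon> by simp
    show "norm (G x) \<le> (1 + \<epsilon> / 2) / (1 + \<epsilon>)" if x: "x \<in> unit_ball" for x
    proof -
      have "norm (v $ j - y $ j) \<le> \<epsilon> / (6 * K)" for j
      proof -
        have "norm ((v - y) $ j) \<le> norm (v - y)" by (rule Finite_Cartesian_Product.norm_nth_le)
        then show ?thesis using y(2) by (simp add: dist_norm norm_minus_commute)
      qed
      then have "norm ((v $ j - y $ j) * e j x) \<le> \<epsilon> / (6 * K) * K" for j
        unfolding norm_mult using e(3)[OF x] \<epsilon> e(1) by (intro mult_mono) auto
      then have "norm (\<Sum>j\<in>UNIV. (v $ j - y $ j) * e j x) \<le> (\<Sum>j\<in>(UNIV :: 3 set). \<epsilon> / (6 * K) * K)"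
        by (intro sum_norm_le) auto
      also have "\<dots> = \<epsilon> / 2" using e(1) by simp
      finally have "norm (F x + (\<Sum>j\<in>UNIV. (v $ j - y $ j) * e j x)) \<le> 1 + \<epsilon> / 2"
        using F(2) x by (intro norm_triangle_le add_mono) (auto simp: image_subset_iff)
      moreover have "norm (complex_of_real (1 + \<epsilon>)) = 1 + \<epsilon>" using \<epsilon> unfolding norm_of_real by simp
      ultimately show ?thesis unfolding G_def norm_divide using \<epsilon> by (simp only: divide_right_mono)
    qed
    show "G (z i) = q i" for i
    proof -
      have "(\<Sum>j\<in>UNIV. (v $ j - y $ j) * e j (z i)) = v $ i - y $ i"
        unfolding e(4) by (simp add: if_distrib[of "(*) _"] cong: if_cong)
      then show ?thesis unfolding G_def F(3) using ne by (simp add: v_def)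
    qed
  qed
qed

theorem theorem1:
  fixes F :: "complex ^ 'n \<Rightarrow> complex"
    and z :: "nat \<Rightarrow> complex ^ 'n"
  assumes "F holomorphic_fun_on unit_ball" and "F ` unit_ball \<subseteq> unit_disc"
    and "\<forall>j\<in>{1..3}. z j \<in> unit_ball" and "inj_on z {1..3}"
  shows "pick_extremal unit_ball 3 z (\<lambda>j. F (z j)) \<longleftrightarrow>
    (\<exists>f :: complex \<Rightarrow> complex ^ 'n.
       f holomorphic_curve_on unit_disc \<and> f ` unit_disc \<subseteq> unit_ball \<and>
       ((\<forall>j\<in>{1..3}. z j \<in> f ` unit_disc) \<and>
          (\<exists>d\<le>2. blaschke_product d (F \<circ> f)) \<and> \<not> (F \<circ> f) constant_on unit_disc
        \<or>
        card {j\<in>{1..3}. z j \<in> f ` unit_disc} \<ge> 2 \<and> blaschke_product 1 (F \<circ> f)))"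
  (is "?L \<longleftrightarrow> ?R")
proof
  assume ?R
  then obtain f :: "complex \<Rightarrow> complex ^ 'n" where f: "f holomorphic_curve_on unit_disc" "f ` unit_disc \<subseteq> unit_ball"
    and alt: "(\<forall>j\<in>{1..3}. z j \<in> f ` unit_disc) \<and> (\<exists>d\<le>2. blaschke_product d (F \<circ> f)) \<or>
       card {j\<in>{1..3}. z j \<in> f ` unit_disc} \<ge> 2 \<and> blaschke_product 1 (F \<circ> f)" by blast
  define J where "J = {j\<in>{1..3}. z j \<in> f ` unit_disc}"
  \<comment> \<open>In both alternatives the number of points on the disc exceeds the degree, which
    is all that the uniqueness argument asks for.\<close>
  have "\<exists>d. blaschke_product d (F \<circ> f) \<and> d < card J"
    using alt
  proof
    assume a: "(\<forall>j\<in>{1..3}. z j \<in> f ` unit_disc) \<and> (\<exists>d\<le>2. blaschke_product d (F \<circ> f))"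
    then have "J = {1..3}" by (auto simp: J_def)
    then show ?thesis using a by fastforce
  next
    assume "card {j\<in>{1..3}. z j \<in> f ` unit_disc} \<ge> 2 \<and> blaschke_product 1 (F \<circ> f)"
    then show ?thesis unfolding J_def by (intro exI[of _ 1]) auto
  qed
  then obtain d where d: "blaschke_product d (F \<circ> f)" "d < card J" by blast
  have "\<forall>j\<in>J. \<exists>t. t \<in> unit_disc \<and> f t = z j" by (auto simp: J_def)
  then obtain t where t: "\<And>j. j \<in> J \<Longrightarrow> t j \<in> unit_disc" "\<And>j. j \<in> J \<Longrightarrow> f (t j) = z j" by metis
  have "inj_on t J"
  proof (rule inj_onI)
    fix i j assume ij: "i \<in> J" "j \<in> J" "t i = t j"
    then have "z i = z j" using t(2) by metis
    then show "i = j" using assms(4) ij(1,2) by (auto simp: J_def dest: inj_onD)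
  qed
  then have "d < card (t ` J)" using d(2) by (simp add: card_image)
  moreover have "f x \<in> z ` {1..3}" if xJ: "x \<in> t ` J" for x
  proof -
    obtain j where j: "x = t j" "j \<in> J" using xJ by blast
    then have "f x = z j" "j \<in> {1..3}" using t(2) by (auto simp: J_def)
    then show ?thesis by blast
  qed
  moreover have "t ` J \<subseteq> unit_disc" "finite (t ` J)" using t(1) by (auto simp: J_def)
  ultimately show ?L using pick_extremal_if_blaschke[OF assms(1,2) f d(1)] by blast
next
  assume ext: ?L
  \<comment> \<open>Translates the natural-number indices into the index type \<open>3\<close> used
    for the reduction to discs.\<close>
  define idx where "idx j = (if j = 1 then 1 else if j = 2 then 2 else 3 :: nat)" for j :: 3
  have three: "j = 1 \<or> j = 2 \<or> j = 3" for j :: 3 by (rule exhaust_3)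
  have idx: "idx j \<in> {1..3}" "i \<in> {1..3} \<Longrightarrow> \<exists>j. idx j = i" for i j
  proof -
    show "idx j \<in> {1..3}" by (simp add: idx_def)
    assume "i \<in> {1..3}"
    then have "i = 1 \<or> i = 2 \<or> i = 3" by auto
    moreover have "idx 1 = 1" "idx 2 = 2" "idx 3 = 3" by (simp_all add: idx_def)
    ultimately show "\<exists>j. idx j = i" by metis
  qed
  have injidx: "inj idx"
  proof (rule injI)
    fix x y assume "idx x = idx y"
    then show "x = y" using three[of x] three[of y] by (elim disjE) (simp_all add: idx_def)
  qed
  define w where "w j = z (idx j)" for j
  define q where "q j = F (w j)" for j
  have w: "norm (w j) < 1" for j using assms(3) idx(1)[of j] by (auto simp: w_def)
  have injw: "inj w"
  proof (rule injI)
    fix x y assume "w x = w y"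
    then have "idx x = idx y" using assms(4) idx(1) by (auto simp: w_def dest: inj_onD)
    then show "x = y" using injidx by (simp add: inj_eq)
  qed
  have q1: "norm (q j) < 1" for j using assms(2) w[of j] by (auto simp: q_def image_subset_iff)
  have "pick_solvable w q"
    unfolding pick_solvable_def using assms(1,2) by (intro exI[of _ F]) (auto simp: q_def image_subset_iff less_imp_le)
  then have Q: "disc_solvable w q" by (rule pick_solvable_imp_disc_solvable)
  \<comment> \<open>Otherwise \<open>q\<close> would be interpolated by a function with image in a
    smaller concentric disc, against extremality.\<close>
  have nQ: "\<not> disc_solvable w (\<lambda>j. of_real (1 + \<epsilon>) * q j)" if eps: "\<epsilon> > 0" for \<epsilon>
  proof
    assume "disc_solvable w (\<lambda>j. of_real (1 + \<epsilon>) * q j)"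
    then obtain G \<rho> where G: "G holomorphic_fun_on unit_ball" "\<And>x. x \<in> unit_ball \<Longrightarrow> norm (G x) \<le> \<rho>" "\<rho> < 1" "\<And>j. G (w j) = q j"
      by (rule strictly_solvable_if_disc_solvable[OF w injw eps]) (rule that)
    have "G (z i) = F (z i)" if "i \<in> {1..3}" for i using idx(2)[OF that] G(4) by (auto simp: w_def q_def)
    then have "pick_solution unit_ball 3 z (\<lambda>j. F (z j)) G"
      unfolding pick_solution_def using G(1-3) by fastforce
    moreover have "relatively_compact_in (G ` unit_ball) unit_disc" by (rule relatively_compact_in_discI[OF G(2,3)])
    ultimately show False using ext unfolding pick_extremal_def by blast
  qed
  have FfD: "norm (F (f t)) < 1" if "f ` unit_disc \<subseteq> unit_ball" "t \<in> unit_disc" for f :: "complex \<Rightarrow> complex ^ 'n" and t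
    using assms(2) that by (metis image_subset_iff mem_ball_0)
  have Ffhol: "(\<lambda>t. F (f t)) holomorphic_on unit_disc" "(\<lambda>t. F (f t)) ` unit_disc \<subseteq> cball 0 1"
    if "f holomorphic_curve_on unit_disc" "f ` unit_disc \<subseteq> unit_ball" for f :: "complex \<Rightarrow> complex ^ 'n"
    using holomorphic_fun_o_curve[OF assms(1) that] FfD[OF that(2)] by (auto simp: less_imp_le)
  have cong: "blaschke_product d (F \<circ> f)" if "blaschke_product d B" "\<And>t. t \<in> unit_disc \<Longrightarrow> F (f t) = B t"
    for d B and f :: "complex \<Rightarrow> complex ^ 'n"
    using that unfolding blaschke_product_def by auto
  show ?R
  proof (cases "\<forall>i j. i \<noteq> j \<longrightarrow> strict_pair w q i j")
    case True
    \<comment> \<open>Extremality puts these multiples outside the set of data solvable on discs,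
      and they converge to \<open>q\<close>, as \<open>touching_disc\<close> requires.\<close>
    define qk where "qk k j = of_real (1 + 1 / real (Suc k)) * q j" for k j
    have n: "\<not> disc_solvable w (qk k)" for k unfolding qk_def by (rule nQ) simp
    have L: "(\<lambda>k. qk k j) \<longlonglongrightarrow> q j" for j
    proof -
      have "(\<lambda>k. 1 + 1 / real (Suc k)) \<longlonglongrightarrow> 1 + 0"
        by (intro tendsto_add tendsto_const LIMSEQ_Suc[OF lim_1_over_n])
      then have "(\<lambda>k. qk k j) \<longlonglongrightarrow> of_real (1 + 0) * q j" unfolding qk_def by (rule tendsto_mult[OF tendsto_of_real tendsto_const])
      then show ?thesis by simp
    qed
    obtain f t B where f: "f holomorphic_curve_on unit_disc" "f ` unit_disc \<subseteq> unit_ball" "\<And>j. norm (t j) < 1" "\<And>j. f (t j) = w j"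
      "blaschke_product 2 B" "\<And>j. B (t j) = q j"
      by (rule touching_disc[OF w injw Q _ n L]) (use True in \<open>blast intro: that\<close>)+
    have "inj t" by (rule injI) (metis f(4) injw injD)
    then have card: "card (range t) = 3" by (simp add: card_image)
    have eq: "F (f x) = B x" if "x \<in> unit_disc" for x
      by (rule Pick_unique_blaschke[OF Ffhol[OF f(1,2)] f(5), where T = "range t"])
        (use f card that in \<open>auto simp: q_def\<close>)
    have bl: "blaschke_product 2 (F \<circ> f)" by (rule cong[OF f(5) eq])
    \<comment> \<open>A constant would have modulus at least 1 by the Blaschke property, while
      \<open>F\<close> maps into the open disc.\<close>
    have "\<not> (F \<circ> f) constant_on unit_disc"
    proof
      assume "(F \<circ> f) constant_on unit_disc"
      then obtain c where c: "\<And>x. x \<in> unit_disc \<Longrightarrow> (F \<circ> f) x = c" unfolding constant_on_def by blast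
      have "1 \<le> norm c" by (rule blaschke_product_unbounded[OF bl]) (use c in auto)
      then show False using FfD[OF f(2), of 0] c[of 0] by simp
    qed
    moreover have "\<forall>j\<in>{1..3}. z j \<in> f ` unit_disc"
    proof
      fix i :: nat assume "i \<in> {1..3}"
      then obtain j where "idx j = i" using idx(2) by blast
      then have "f (t j) = z i" using f(4) by (simp add: w_def)
      then show "z i \<in> f ` unit_disc" using f(3)[of j] by (metis image_eqI mem_ball_0)
    qed
    ultimately show ?thesis using f(1,2) bl by (intro exI[of _ f]) auto
  next
    case False
    then obtain i j where ij: "i \<noteq> j" "\<not> strict_pair w q i j" by blast
    have wij: "w i \<noteq> w j" using injw ij(1) by (simp add: inj_eq)
    obtain f r where f: "f holomorphic_curve_on unit_disc" "f ` unit_disc \<subseteq> unit_ball" "norm r < 1" "r \<noteq> 0"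
      "f 0 = w i" "f r = w j" "disc_kernel 0 r * nsq (1 - cinner (w i) (w j)) = (1 - nsq (w i)) * (1 - nsq (w j))"
      using pair_geodesic[OF w w wij] by blast
    define N where "N = nsq (1 - cinner (w i) (w j))"
    have N: "N > 0" using one_minus_cinner_neq_0[of "w i" "w j"] w[of i] w[of j] by (simp add: N_def)
    \<comment> \<open>The weak pair inequality holds and the strict one fails, so the scalar
      two-point problem on the geodesic is extremal and its solution has degree 1.\<close>
    have "disc_kernel 0 r * N * nsq (1 - q i * cnj (q j)) = (1 - nsq (q i)) * (1 - nsq (q j)) * N"
      using disc_solvable_weak_pair[OF Q w wij] ij(2) unfolding strict_pair_def f(7)[symmetric] N_def by linarith
    then have "N * (disc_kernel 0 r * nsq (1 - q i * cnj (q j))) = N * ((1 - nsq (q i)) * (1 - nsq (q j)))"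
      by (simp add: mult_ac)
    then have "disc_kernel 0 r * nsq (1 - q i * cnj (q j)) = (1 - nsq (q i)) * (1 - nsq (q j))"
      using N by (simp only: mult_cancel_left) simp
    then obtain u \<alpha> where u: "norm u = 1" "norm \<alpha> < 1" "q i = u * mob \<alpha> 0" "q j = u * mob \<alpha> r"
      using two_point_Pick_equality[OF q1 q1 _ f(3), of 0 i j] f(4) by auto
    have bl: "blaschke_product 1 (\<lambda>t. u * mob \<alpha> t)"
      unfolding blaschke_product_def mob_def using u(1,2) by (intro exI[of _ u] exI[of _ "\<lambda>_. \<alpha>"]) simp
    have eq: "F (f x) = u * mob \<alpha> x" if "x \<in> unit_disc" for x
      by (rule Pick_unique_blaschke[OF Ffhol[OF f(1,2)] bl, where T = "{0, r}"])
        (use f u that in \<open>auto simp: q_def\<close>)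
    have "{idx i, idx j} \<subseteq> {j\<in>{1..3}. z j \<in> f ` unit_disc}"
    proof -
      have "z (idx i) \<in> f ` unit_disc" "z (idx j) \<in> f ` unit_disc"
        using f(5,6,3) by (metis w_def image_eqI mem_ball_0 norm_zero zero_less_one)+
      then show ?thesis using idx(1) by blast
    qed
    then have "card {idx i, idx j} \<le> card {j\<in>{1..3}. z j \<in> f ` unit_disc}" by (rule card_mono[rotated]) simp
    moreover have "card {idx i, idx j} = 2" using ij(1) injidx by (simp add: inj_eq)
    moreover have "blaschke_product 1 (F \<circ> f)" by (rule cong[OF bl eq])
    ultimately show ?thesis using f(1,2) by (intro exI[of _ f]) auto
  qed
qed

end
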